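(* Let $Z\subseteq\mathbb{P}^n$ be a nonempty finite set of points. If $D_0(\mathcal{A}_Z)$ has splitting type $(a_1,a_2,\ldots,a_n)$, then for a general linear subspace $Q\subseteq\mathbb{P}^n$ of codimension $2$ and every integer $d\geq1$, $$\dim_{\mathbb{K}}[I(Z)\cap I(Q)^{d-1}]_d=\sum_{i=1}^n\max\{0,d-a_i\}.$$
   Context: $\mathbb{K}$ is an algebraically closed field of arbitrary characteristic and $n\ge2$. $S=\mathbb{K}[Y_0,\ldots,Y_n]$ is the coordinate ring of the projective space dual to $\mathbb{P}^n$, ideals $I(\cdot)$ are taken in the coordinate ring $R=\mathbb{K}[X_0,\ldots,X_n]$ of $\mathbb{P}^n$, and $[M]_d$ is the degree $d$ part of a graded module $M$. $\mathcal{A}_Z$ is the arrangement in the dual projective space consisting of the hyperplanes $\{\sum_ic_iY_i=0\}$ for $(c_0:\cdots:c_n)\in Z$. For a hyperplane arrangement $\mathcal{A}$, $D(\mathcal{A})$ is the $S$-module of $\mathbb{K}$-linear derivations $\theta:S\to S$ with $\theta(I(H))\subseteq I(H)$ for all $H\in\mathcal{A}$, graded so that $\deg\theta=\deg\theta(\ell)$ for linear forms $\ell$. $\theta_e=\sum_iY_i\,\partial/\partial Y_i$ and $D_0(\mathcal{A})=D(\mathcal{A})/S\theta_e$. For nonempty $\mathcal{A}$, the splitting type of $D_0(\mathcal{A})$ is the unique tuple of integers $0\le a_1\leq\cdots\leq a_n$ such that, for a general line $L$, the restriction of the sheaf $\widetilde{D_0(\mathcal{A})}$ to $L$ is isomorphic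 to $\bigoplus_{i=1}^n\mathcal{O}_L(-a_i)$. *)

theory Defs
  imports
    "HOL-Analysis.Analysis"
    "HOL-Library.Poly_Mapping"
    "HOL-Library.Function_Algebras"
begin

section \<open>Polynomial rings\<close>

text \<open>
  The polynomial ring over \<open>'k\<close> in variables indexed by \<open>'n\<close>. With \<open>CARD('n) = n + 1\<close> this is both
  \<open>R\<close> (coordinate ring of projective \<open>n\<close>-space) and \<open>S\<close> (coordinate ring of its dual).
\<close>

type_synonym ('n, 'k) mpoly = "('n \<Rightarrow>\<^sub>0 nat) \<Rightarrow>\<^sub>0 'k"

definition mvar :: "'n \<Rightarrow> ('n, 'k::comm_ring_1) mpoly" where
  "mvar i = Poly_Mapping.single (Poly_Mapping.single i 1) 1"

definition pscale :: "'k::comm_ring_1 \<Rightarrow> ('n, 'k) mpoly \<Rightarrow> ('n, 'k) mpoly" where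
  "pscale c f = Poly_Mapping.single 0 c * f"

definition peval :: "('n, 'k::comm_ring_1) mpoly \<Rightarrow> ('n \<Rightarrow> 'k) \<Rightarrow> 'k" where
  "peval f x = (\<Sum>m\<in>Poly_Mapping.keys f. Poly_Mapping.lookup f m *
     (\<Prod>i\<in>Poly_Mapping.keys m. x i ^ Poly_Mapping.lookup m i))"

definition mdeg :: "('n \<Rightarrow>\<^sub>0 nat) \<Rightarrow> nat" where
  "mdeg m = (\<Sum>i\<in>Poly_Mapping.keys m. Poly_Mapping.lookup m i)"

text \<open>The homogeneous part of degree \<open>d\<close>; it is zero for negative \<open>d\<close>.\<close>

definition homog :: "int \<Rightarrow> ('n, 'k::comm_ring_1) mpoly set" where
  "homog d = {f. \<forall>m\<in>Poly_Mapping.keys f. int (mdeg m) = d}"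

definition pdiff :: "'n \<Rightarrow> ('n, 'k::comm_ring_1) mpoly \<Rightarrow> ('n, 'k) mpoly" where
  "pdiff i f = (\<Sum>m\<in>Poly_Mapping.keys f.
     Poly_Mapping.single (m - Poly_Mapping.single i 1)
       (of_nat (Poly_Mapping.lookup m i) * Poly_Mapping.lookup f m))"

global_interpretation mpoly_vs: vector_space "pscale :: 'k::field \<Rightarrow> ('n, 'k) mpoly \<Rightarrow> _"
proof
  fix a b :: 'k and x y :: "('n, 'k) mpoly"
  show "pscale a (x + y) = pscale a x + pscale a y"
    by (simp add: pscale_def distrib_left)
  show "pscale (a + b) x = pscale a x + pscale b x"
    by (simp add: pscale_def single_add distrib_right)
  show "pscale a (pscale b x) = pscale (a * b) x"
    unfolding pscale_def mult.assoc [symmetric] by (simp add: mult_single)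
  show "pscale 1 x = x"
    by (simp add: pscale_def)
qed

text \<open>A commutative ring as a module over itself: \<open>ideal.span\<close> is the ideal generated by a set.\<close>

global_interpretation ideal: module "(*) :: 'r::comm_ring_1 \<Rightarrow> 'r \<Rightarrow> 'r"
  by unfold_locales (simp_all add: distrib_left distrib_right mult.assoc)

lemmas [simp del] = ideal.scale_scale \<comment> \<open>loops with associativity of multiplication\<close>

definition ideal_power :: "'r::comm_ring_1 set \<Rightarrow> nat \<Rightarrow> 'r set" where
  "ideal_power I r = ideal.span {\<Prod>j<r. h j | h. \<forall>j<r. h j \<in> I}"

section \<open>Projective geometry\<close>

text \<open>
  A linear subspace of projective space of dimension \<open>k - 1\<close> is a \<open>k\<close>-dimensional linear subspace
  of \<open>'k ^ 'n\<close>; in particular points are the elements of \<open>grassmannian 1\<close> and lines those of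
  \<open>grassmannian 2\<close>.
\<close>

definition grassmannian :: "nat \<Rightarrow> ('k::field ^ 'n) set set" where
  "grassmannian k = {W. vec.subspace W \<and> vec.dim W = k}"

text \<open>
  The Zariski topology of the Grassmannian, as the quotient of the space of \<open>k\<close>-frames, i.e. of
  linearly independent \<open>k\<close>-tuples of vectors \<open>u 0, \<dots>, u (k - 1)\<close>, by change of basis. The
  entries of the \<open>k\<close> vectors are the coordinates; all other variables are set to \<open>0\<close>.
\<close>

definition grassmannian_open :: "nat \<Rightarrow> ('k::field ^ 'n) set set \<Rightarrow> bool" where
  "grassmannian_open k U \<longleftrightarrow> U \<subseteq> grassmannian k \<and>
     (\<exists>F :: (nat \<times> 'n, 'k) mpoly set. \<forall>u :: nat \<Rightarrow> 'k ^ 'n.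
        vec.span (u ` {..<k}) \<in> grassmannian k \<longrightarrow>
        (vec.span (u ` {..<k}) \<in> U \<longleftrightarrow>
          (\<exists>f\<in>F. peval f (\<lambda>(j, i). if j < k then u j $ i else 0) \<noteq> 0)))"

definition for_general_subspace :: "nat \<Rightarrow> (('k::field ^ 'n) set \<Rightarrow> bool) \<Rightarrow> bool" where
  "for_general_subspace k P \<longleftrightarrow> (\<exists>U. grassmannian_open k U \<and> U \<noteq> {} \<and> (\<forall>W\<in>U. P W))"

text \<open>
  The homogeneous ideal of a projective set whose affine cone is \<open>V\<close>: the polynomials vanishing at
  all homogeneous coordinate vectors of all its points.
\<close>

definition vanishing_ideal :: "('k::field ^ 'n) set \<Rightarrow> ('n, 'k) mpoly set" where
  "vanishing_ideal V = {f. \<forall>x\<in>V. peval f (\<lambda>i. x $ i) = 0}"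

definition dual_hyperplane :: "('k::field ^ 'n) set \<Rightarrow> ('k ^ 'n) set" where
  "dual_hyperplane p = {y. \<forall>c\<in>p. (\<Sum>i\<in>UNIV. c $ i * y $ i) = 0}"

definition dual_arrangement :: "('k::field ^ 'n) set set \<Rightarrow> ('k ^ 'n) set set" where
  "dual_arrangement Z = dual_hyperplane ` Z"

section \<open>Graded modules and the associated sheaves\<close>

text \<open>
  Functions into a ring, as a module with pointwise operations. Both derivations (functions
  \<open>S \<Rightarrow> S\<close>) and tuples (functions \<open>nat \<Rightarrow> S\<close>) live in such a module.
\<close>

definition fscale :: "'r::comm_ring_1 \<Rightarrow> ('i \<Rightarrow> 'r) \<Rightarrow> 'i \<Rightarrow> 'r" where
  "fscale s m = (\<lambda>i. s * m i)"

global_interpretation fmod: module "fscale :: 'r::comm_ring_1 \<Rightarrow> ('i \<Rightarrow> 'r) \<Rightarrow> _"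
  by unfold_locales (simp_all add: fscale_def fun_eq_iff distrib_left distrib_right mult.assoc)

text \<open>
  A graded module presented as a subquotient \<open>gsub / grel\<close> of a module of functions, where
  \<open>grel\<close> is a graded submodule of \<open>gsub\<close>; \<open>gdeg d\<close> consists of the degree \<open>d\<close>
  elements of \<open>gsub\<close>, whose residue classes are the degree \<open>d\<close> part of the quotient.
\<close>

record ('i, 'r) gmodule =
  gsub :: "('i \<Rightarrow> 'r) set"
  grel :: "('i \<Rightarrow> 'r) set"
  gdeg :: "int \<Rightarrow> ('i \<Rightarrow> 'r) set"

text \<open>\<open>M / I M\<close>. For \<open>I\<close> the ideal of a closed subscheme this gives the restriction of the
  sheaf of \<open>M\<close> to that subscheme.\<close>

definition gmod_restrict ::
    "'r::comm_ring_1 set \<Rightarrow> ('i, 'r) gmodule \<Rightarrow> ('i, 'r) gmodule" where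
  "gmod_restrict I M =
     M\<lparr>grel := fmod.span (grel M \<union> {fscale s m | s m. s \<in> I \<and> m \<in> gsub M})\<rparr>"

text \<open>
  The sheaf associated with \<open>M\<close> has as sections over the basic open set \<open>f \<noteq> 0\<close>, where
  \<open>f\<close> is homogeneous of degree \<open>e > 0\<close>, the degree \<open>0\<close> part of the localization of
  \<open>M\<close> at \<open>f\<close>, i.e. the classes of fractions \<open>m / f ^ r\<close> with \<open>m\<close> of degree \<open>r * e\<close>. Such
  a fraction is encoded as the pair \<open>(m, r)\<close>. The degree \<open>e\<close> is carried along because it is
  not determined by \<open>f\<close> if \<open>f = 0\<close>, where the open set is empty and there is only one section.
\<close>

definition fractions ::
    "('i, ('n, 'k::comm_ring_1) mpoly) gmodule \<Rightarrow> nat \<Rightarrow> (('i \<Rightarrow> ('n, 'k) mpoly) \<times> nat) set" where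
  "fractions M e = {(m, r). m \<in> gdeg M (int (r * e))}"

definition frac_eq ::
    "('i, ('n, 'k::comm_ring_1) mpoly) gmodule \<Rightarrow> nat \<Rightarrow> ('n, 'k) mpoly \<Rightarrow>
      (('i \<Rightarrow> ('n, 'k) mpoly) \<times> nat) rel" where
  "frac_eq M e f = {((m, r), (m', r')). (m, r) \<in> fractions M e \<and> (m', r') \<in> fractions M e \<and>
     (\<exists>j. fscale (f ^ j) (fscale (f ^ r') m - fscale (f ^ r) m') \<in> grel M)}"

definition sections ::
    "('i, ('n, 'k::comm_ring_1) mpoly) gmodule \<Rightarrow> nat \<Rightarrow> ('n, 'k) mpoly \<Rightarrow>
      (('i \<Rightarrow> ('n, 'k) mpoly) \<times> nat) set set" where
  "sections M e f = fractions M e // frac_eq M e f"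

definition frac_class ::
    "('i, ('n, 'k::comm_ring_1) mpoly) gmodule \<Rightarrow> nat \<Rightarrow> ('n, 'k) mpoly \<Rightarrow>
      ('i \<Rightarrow> ('n, 'k) mpoly) \<Rightarrow> nat \<Rightarrow> (('i \<Rightarrow> ('n, 'k) mpoly) \<times> nat) set" where
  "frac_class M e f m r = frac_eq M e f `` {(m, r)}"

text \<open>
  Operations on sections are given on representatives; since these operations respect
  \<open>frac_eq\<close>, each union below is over copies of one and the same class.
\<close>

definition sec_add ::
    "('i, ('n, 'k::comm_ring_1) mpoly) gmodule \<Rightarrow> nat \<Rightarrow> ('n, 'k) mpoly \<Rightarrow>
      (('i \<Rightarrow> ('n, 'k) mpoly) \<times> nat) set \<Rightarrow> (('i \<Rightarrow> ('n, 'k) mpoly) \<times> nat) set \<Rightarrow>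
      (('i \<Rightarrow> ('n, 'k) mpoly) \<times> nat) set" where
  "sec_add M e f X Y = (\<Union>(m, r)\<in>X. \<Union>(m', r')\<in>Y.
     frac_class M e f (fscale (f ^ r') m + fscale (f ^ r) m') (r + r'))"

text \<open>Multiplication by \<open>s / f ^ t\<close>, where \<open>s\<close> is homogeneous of degree \<open>t * e\<close>.\<close>

definition sec_scale ::
    "('i, ('n, 'k::comm_ring_1) mpoly) gmodule \<Rightarrow> nat \<Rightarrow> ('n, 'k) mpoly \<Rightarrow>
      ('n, 'k) mpoly \<Rightarrow> nat \<Rightarrow>
      (('i \<Rightarrow> ('n, 'k) mpoly) \<times> nat) set \<Rightarrow> (('i \<Rightarrow> ('n, 'k) mpoly) \<times> nat) set" where
  "sec_scale M e f s t X = (\<Union>(m, r)\<in>X. frac_class M e f (fscale s m) (t + r))"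

text \<open>Restriction from \<open>f \<noteq> 0\<close> to \<open>f * g \<noteq> 0\<close>, where \<open>g\<close> is homogeneous of degree \<open>e'\<close>.\<close>

definition sec_restrict ::
    "('i, ('n, 'k::comm_ring_1) mpoly) gmodule \<Rightarrow> nat \<Rightarrow> ('n, 'k) mpoly \<Rightarrow>
      nat \<Rightarrow> ('n, 'k) mpoly \<Rightarrow>
      (('i \<Rightarrow> ('n, 'k) mpoly) \<times> nat) set \<Rightarrow> (('i \<Rightarrow> ('n, 'k) mpoly) \<times> nat) set" where
  "sec_restrict M e f e' g X =
     (\<Union>(m, r)\<in>X. frac_class M (e + e') (f * g) (fscale (g ^ r) m) r)"

text \<open>
  Isomorphism of the sheaves of modules associated with \<open>M\<close> and \<open>N\<close>: isomorphisms of the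
  modules of sections over all basic open sets that commute with restriction. If \<open>M\<close> and \<open>N\<close> are
  annihilated by the ideal of a closed subscheme \<open>L\<close>, the basic open sets may be read as those of
  \<open>L\<close>, and linearity over \<open>S\<close> and over the coordinate ring of \<open>L\<close> mean the same.
\<close>

definition sheaves_isomorphic ::
    "('i, ('n, 'k::comm_ring_1) mpoly) gmodule \<Rightarrow> ('j, ('n, 'k) mpoly) gmodule \<Rightarrow> bool" where
  "sheaves_isomorphic M N \<longleftrightarrow>
     (\<exists>\<phi> :: nat \<Rightarrow> ('n, 'k) mpoly \<Rightarrow>
          (('i \<Rightarrow> ('n, 'k) mpoly) \<times> nat) set \<Rightarrow> (('j \<Rightarrow> ('n, 'k) mpoly) \<times> nat) set.
       \<forall>e>0. \<forall>f\<in>homog (int e).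
         bij_betw (\<phi> e f) (sections M e f) (sections N e f) \<and>
         (\<forall>X\<in>sections M e f. \<forall>Y\<in>sections M e f.
            \<phi> e f (sec_add M e f X Y) = sec_add N e f (\<phi> e f X) (\<phi> e f Y)) \<and>
         (\<forall>t. \<forall>s\<in>homog (int (t * e)). \<forall>X\<in>sections M e f.
            \<phi> e f (sec_scale M e f s t X) = sec_scale N e f s t (\<phi> e f X)) \<and>
         (\<forall>e'. \<forall>g\<in>homog (int e'). \<forall>X\<in>sections M e f.
            \<phi> (e + e') (f * g) (sec_restrict M e f e' g X) =
              sec_restrict N e f e' g (\<phi> e f X)))"

text \<open>The direct sum of the twisted modules \<open>S(- a\<^sub>i)\<close>, whose degree \<open>d\<close> part is that of \<open>S\<close> in
  degree \<open>d - a\<^sub>i\<close>; its sheaf is the direct sum of the line bundles \<open>O(- a\<^sub>i)\<close>.\<close>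

definition twisted_free :: "int list \<Rightarrow> (nat, ('n, 'k::comm_ring_1) mpoly) gmodule" where
  "twisted_free a =
     \<lparr>gsub = {v. \<forall>j\<ge>length a. v j = 0},
      grel = {0},
      gdeg = (\<lambda>d. {v. (\<forall>j<length a. v j \<in> homog (d - a ! j)) \<and> (\<forall>j\<ge>length a. v j = 0)})\<rparr>"

section \<open>Logarithmic derivations and splitting type\<close>

definition derivation :: "(('n, 'k::field) mpoly \<Rightarrow> ('n, 'k) mpoly) \<Rightarrow> bool" where
  "derivation \<theta> \<longleftrightarrow> Vector_Spaces.linear pscale pscale \<theta> \<and>
     (\<forall>f g. \<theta> (f * g) = f * \<theta> g + g * \<theta> f)"

definition log_derivations ::
    "('k::field ^ 'n) set set \<Rightarrow> (('n, 'k) mpoly \<Rightarrow> ('n, 'k) mpoly) set" where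
  "log_derivations \<A> = {\<theta>. derivation \<theta> \<and>
     (\<forall>H\<in>\<A>. \<theta> ` vanishing_ideal H \<subseteq> vanishing_ideal H)}"

definition euler_derivation :: "('n::finite, 'k::field) mpoly \<Rightarrow> ('n, 'k) mpoly" where
  "euler_derivation f = (\<Sum>i\<in>UNIV. mvar i * pdiff i f)"

text \<open>\<open>D\<^sub>0(\<A>) = D(\<A>) / S \<theta>\<^sub>e\<close>, graded by polynomial degree.\<close>

definition D0 ::
    "('k::field ^ 'n) set set \<Rightarrow> (('n, 'k) mpoly, ('n::finite, 'k) mpoly) gmodule" where
  "D0 \<A> =
     \<lparr>gsub = log_derivations \<A>,
      grel = {fscale s euler_derivation | s. True},
      gdeg = (\<lambda>d. {\<theta> \<in> log_derivations \<A>. \<forall>l\<in>homog 1. \<theta> l \<in> homog d})\<rparr>"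

definition has_splitting_type :: "('k::field ^ 'n::finite) set set \<Rightarrow> int list \<Rightarrow> bool" where
  "has_splitting_type \<A> a \<longleftrightarrow>
     length a = CARD('n) - 1 \<and> sorted a \<and> (\<forall>x\<in>set a. 0 \<le> x) \<and>
     for_general_subspace 2 (\<lambda>L :: ('k ^ 'n) set.
       sheaves_isomorphic
         (gmod_restrict (vanishing_ideal L) (D0 \<A>))
         (gmod_restrict (vanishing_ideal L) (twisted_free a)))"

end

theory Submission
  imports Defs
begin

text \<open>
  Let \<open>L\<close> be a general line in the dual space and \<open>Q\<close> the codimension two center dual to it. Writing
  a form of degree \<open>m + 1\<close> in \<open>I(Q)\<^sup>m\<close> as \<open>\<Sum> X\<^sub>i G\<^sub>i(l\<^sub>2, - l\<^sub>1)\<close>, where \<open>l\<^sub>1, l\<^sub>2\<close> generate \<open>I(Q)\<close> and the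
  \<open>G\<^sub>i\<close> are binary forms of degree \<open>m\<close>, identifies it with a vector field of degree \<open>m\<close> along \<open>L\<close>,
  unique up to multiples of the Euler field. The form vanishes at \<open>c \<in> Z\<close> if and only if the
  vector field is tangent to the hyperplane of \<open>c\<close> at the point where it meets \<open>L\<close>. As these points are
  distinct, the vector fields with this property modulo the Euler field are the global sections of the
  \<open>m\<close>-th twist of the restriction of \<open>D\<^sub>0\<close> to \<open>L\<close>, and these are counted by the splitting type.
\<close>

section \<open>Substitution and evaluation of polynomials\<close>

text \<open>The hypothesis is an isomorphism of sheaves given on basic open sets, so the count runs
  through explicit global sections: pairs of sections on the charts of \<open>x\<close> and
  \<open>y\<close> that match on the overlap after a twist. Two obstacles shape the work. In D0
  restricted to L one divides by I(L) D and the Euler multiples; after inverting \<open>x\<close> or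
  \<open>y\<close> these relations must be shown to be all logarithmic fields that are radial along
  L, and tangent fields on L must lift to logarithmic derivations. Both are local questions near
  each point of the arrangement; a Lagrange partition of unity, writing \<open>z ^ K\<close> through
  the products \<open>Q c\<close>, makes them global at the cost of a power of \<open>z\<close>.
  Secondly, D0 is a quotient, and in arbitrary characteristic no complement of the Euler field is at
  hand. A global section of the quotient still lifts to a vector field along L because H1 of O(m -
  1) vanishes; concretely this is a division with remainder. Finally, generality is given for lines
  but asked for centers: a frame of the annihilator is polynomial in a frame of the center by cross
  products, which transports openness.\<close>

lemma infinite_UNIV_alg_closed_field: "infinite (UNIV :: 'k::alg_closed_field set)"
proof
  assume fin: "finite (UNIV :: 'k set)"
  define p :: "'k poly" where "p = (\<Prod>a\<in>UNIV. [:-a, 1:]) + 1"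
  have ev: "poly p x = 1" for x
    using fin by (simp add: p_def poly_prod prod_zero_iff)
  have "degree (\<Prod>a\<in>(UNIV::'k set). [:-a, 1:]) = card (UNIV::'k set)"
    by (subst degree_prod_eq_sum_degree) auto
  moreover have "card (UNIV::'k set) > 0" using fin by (simp add: card_gt_0_iff)
  ultimately have "degree p > 0" by (simp add: p_def degree_add_eq_left)
  then obtain x where "poly p x = 0" using alg_closed_imp_poly_has_root by blast
  with ev show False by simp
qed

definition monomial_eval :: "('n \<Rightarrow> 'r::comm_ring_1) \<Rightarrow> ('n \<Rightarrow>\<^sub>0 nat) \<Rightarrow> 'r" where
  "monomial_eval x m = (\<Prod>i\<in>Poly_Mapping.keys m. x i ^ Poly_Mapping.lookup m i)"

text \<open>Three coefficient maps are used: the identity gives \<open>peval\<close>,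
  \<open>mconst\<close> gives substitution of polynomials for variables, and
  \<open>\<lambda>c. [:c:]\<close> gives the restriction to a parametrized line.\<close>

definition msubst :: "('k::comm_ring_1 \<Rightarrow> 'r::comm_ring_1) \<Rightarrow> ('n \<Rightarrow> 'r) \<Rightarrow> ('n, 'k) mpoly \<Rightarrow> 'r" where
  "msubst h x f = (\<Sum>m\<in>Poly_Mapping.keys f. h (Poly_Mapping.lookup f m) * monomial_eval x m)"

definition mconst :: "'k::comm_ring_1 \<Rightarrow> ('n, 'k) mpoly" where
  "mconst c = Poly_Mapping.single 0 c"

lemma peval_eq_msubst: "peval f x = msubst (\<lambda>c. c) x f"
  by (simp add: peval_def msubst_def monomial_eval_def)

lemma monomial_eval_superset:
  assumes "finite A" "Poly_Mapping.keys m \<subseteq> A"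
  shows "monomial_eval x m = (\<Prod>i\<in>A. x i ^ Poly_Mapping.lookup m i)"
  unfolding monomial_eval_def
  by (rule prod.mono_neutral_left) (use assms in \<open>auto simp: in_keys_iff\<close>)

lemma monomial_eval_0 [simp]: "monomial_eval x 0 = 1"
  by (simp add: monomial_eval_def)

lemma monomial_eval_add: "monomial_eval x (m + m') = monomial_eval x m * monomial_eval x m'"
proof -
  let ?A = "Poly_Mapping.keys m \<union> Poly_Mapping.keys m'"
  have "monomial_eval x (m + m') = (\<Prod>i\<in>?A. x i ^ Poly_Mapping.lookup (m + m') i)"
    by (rule monomial_eval_superset) (auto dest: Poly_Mapping.keys_add[THEN subsetD])
  moreover have "monomial_eval x m = (\<Prod>i\<in>?A. x i ^ Poly_Mapping.lookup m i)"
    by (rule monomial_eval_superset) auto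
  moreover have "monomial_eval x m' = (\<Prod>i\<in>?A. x i ^ Poly_Mapping.lookup m' i)"
    by (rule monomial_eval_superset) auto
  ultimately show ?thesis by (simp add: lookup_add power_add prod.distrib)
qed

lemma monomial_eval_single [simp]: "monomial_eval x (Poly_Mapping.single i k) = x i ^ k"
  by (cases "k = 0") (simp_all add: monomial_eval_def)

lemma mpoly_eq_sum_monomials:
  "f = (\<Sum>m\<in>Poly_Mapping.keys f. Poly_Mapping.single m (Poly_Mapping.lookup f m))"
proof (rule poly_mapping_eqI)
  fix k
  show "Poly_Mapping.lookup f k =
    Poly_Mapping.lookup (\<Sum>m\<in>Poly_Mapping.keys f. Poly_Mapping.single m (Poly_Mapping.lookup f m)) k"
    by (auto simp: lookup_sum lookup_single when_def in_keys_iff)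
qed

lemma mconst_0 [simp]: "mconst 0 = 0"
  and mconst_1 [simp]: "mconst 1 = 1"
  and mconst_add: "mconst (a + b) = mconst a + mconst b"
  and mconst_uminus: "mconst (- a) = - mconst a"
  and mconst_mult: "mconst (a * b) = mconst a * mconst b"
  by (simp_all add: mconst_def single_add single_diff single_uminus mult_single)

lemma mconst_sum: "mconst (\<Sum>i\<in>A. f i) = (\<Sum>i\<in>A. mconst (f i))"
  by (induction A rule: infinite_finite_induct) (auto simp: mconst_add)

lemma pscale_eq: "pscale c f = mconst c * f"
  by (simp add: pscale_def mconst_def)

lemma single_eq_mvar_power: "Poly_Mapping.single (Poly_Mapping.single i k) 1 = (mvar i ^ k :: ('n, 'k::comm_ring_1) mpoly)"
proof (induction k)
  case (Suc k)
  have "Poly_Mapping.single i (Suc k) = Poly_Mapping.single i 1 + Poly_Mapping.single i k"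
    by (simp flip: single_add)
  then have "Poly_Mapping.single (Poly_Mapping.single i (Suc k)) (1::'k)
      = mvar i * Poly_Mapping.single (Poly_Mapping.single i k) 1"
    by (simp add: mvar_def mult_single)
  then show ?case by (simp add: Suc)
qed simp

lemma single_eq_prod_mvar:
  fixes c :: "'k::comm_ring_1"
  shows "Poly_Mapping.single m c = mconst c * monomial_eval mvar m"
proof -
  have "Poly_Mapping.single (\<Sum>i\<in>A. Poly_Mapping.single i (Poly_Mapping.lookup m i)) (1::'k)
      = (\<Prod>i\<in>A. mvar i ^ Poly_Mapping.lookup m i)" if "finite A" for A
    using that
  proof (induction A)
    case (insert a A)
    have "Poly_Mapping.single (\<Sum>i\<in>insert a A. Poly_Mapping.single i (Poly_Mapping.lookup m i)) (1::'k)
      = Poly_Mapping.single (Poly_Mapping.single a (Poly_Mapping.lookup m a)) 1 *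
        Poly_Mapping.single (\<Sum>i\<in>A. Poly_Mapping.single i (Poly_Mapping.lookup m i)) 1"
      using insert.hyps by (simp add: mult_single)
    then show ?case
      using insert.hyps by (simp add: insert.IH single_eq_mvar_power)
  qed simp
  from this[of "Poly_Mapping.keys m"]
  have "Poly_Mapping.single m (1::'k) = monomial_eval mvar m"
    unfolding monomial_eval_def by (simp only: mpoly_eq_sum_monomials[symmetric] finite_keys)
  then have "mconst c * monomial_eval mvar m = mconst c * Poly_Mapping.single m (1::'k)"
    by simp
  then show ?thesis by (simp add: mconst_def mult_single)
qed

text \<open>Treats a polynomial as a ring expression, so that identities between ring homomorphisms,
  or between derivations, need checking only on constants and variables.\<close>

lemma mpoly_induct [case_names const var add mult]:
  fixes f :: "('n, 'k::comm_ring_1) mpoly"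
  assumes const: "\<And>c. P (mconst c)" and var: "\<And>i. P (mvar i)"
    and add: "\<And>f g. P f \<Longrightarrow> P g \<Longrightarrow> P (f + g)"
    and mult: "\<And>f g. P f \<Longrightarrow> P g \<Longrightarrow> P (f * g)"
  shows "P f"
proof -
  have one: "P 1" using const[of 1] by simp
  have zero: "P 0" using const[of 0] by simp
  have pow: "P (mvar i ^ k)" for i k
    by (induction k) (auto intro: one mult var)
  have "P (\<Prod>i\<in>A. mvar i ^ k i)" if "finite A" for A k
    using that by induction (auto intro: one mult pow)
  then have mon: "P (Poly_Mapping.single m c)" for m c
    by (auto simp: single_eq_prod_mvar monomial_eval_def intro: mult const)
  have "P (\<Sum>m\<in>A. Poly_Mapping.single m (k m))" if "finite A" for A k
    using that by induction (auto intro: zero add mon)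
  from this[of "Poly_Mapping.keys f" "Poly_Mapping.lookup f"] show ?thesis
    by (simp only: mpoly_eq_sum_monomials[symmetric] finite_keys)
qed

locale coeff_hom =
  fixes h :: "'k::comm_ring_1 \<Rightarrow> 'r::comm_ring_1"
  assumes h_1: "h 1 = 1" and h_add: "h (a + b) = h a + h b" and h_mult: "h (a * b) = h a * h b"
begin

lemma h_0 [simp]: "h 0 = 0"
  using h_add[of 0 0] by simp

lemma msubst_superset:
  assumes "finite A" "Poly_Mapping.keys f \<subseteq> A"
  shows "msubst h x f = (\<Sum>m\<in>A. h (Poly_Mapping.lookup f m) * monomial_eval x m)"
  unfolding msubst_def
  by (rule sum.mono_neutral_left) (use assms in \<open>auto simp: in_keys_iff\<close>)

lemma msubst_add: "msubst h x (f + g) = msubst h x f + msubst h x g"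
proof -
  let ?A = "Poly_Mapping.keys f \<union> Poly_Mapping.keys g"
  have "Poly_Mapping.keys (f + g) \<subseteq> ?A" by (rule Poly_Mapping.keys_add)
  then show ?thesis
    by (simp add: msubst_superset[of ?A] lookup_add h_add distrib_right sum.distrib)
qed

lemma msubst_0 [simp]: "msubst h x 0 = 0"
  by (simp add: msubst_def)

lemma msubst_single: "msubst h x (Poly_Mapping.single m c) = h c * monomial_eval x m"
  by (simp add: msubst_def)

lemma msubst_sum: "msubst h x (\<Sum>i\<in>A. f i) = (\<Sum>i\<in>A. msubst h x (f i))"
  by (induction A rule: infinite_finite_induct) (auto simp: msubst_add)

lemma msubst_mult: "msubst h x (f * g) = msubst h x f * msubst h x g"
proof -
  let ?s = Poly_Mapping.single and ?l = Poly_Mapping.lookup and ?k = Poly_Mapping.keys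
  have "f * g = (\<Sum>m\<in>?k f. ?s m (?l f m)) * (\<Sum>m\<in>?k g. ?s m (?l g m))"
    by (simp only: mpoly_eq_sum_monomials[symmetric])
  also have "\<dots> = (\<Sum>m\<in>?k f. \<Sum>m'\<in>?k g. ?s (m + m') (?l f m * ?l g m'))"
    by (simp add: sum_product mult_single)
  finally have "msubst h x (f * g) =
      (\<Sum>m\<in>?k f. \<Sum>m'\<in>?k g. (h (?l f m) * monomial_eval x m) * (h (?l g m') * monomial_eval x m'))"
    by (simp add: msubst_sum msubst_single monomial_eval_add h_mult mult.assoc mult.left_commute)
  then show ?thesis by (simp add: msubst_def sum_product)
qed

lemma msubst_const [simp]: "msubst h x (mconst c) = h c"
  by (simp add: mconst_def msubst_single)

lemma msubst_1 [simp]: "msubst h x 1 = 1"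
  using msubst_const[of x 1] by (simp add: h_1)

lemma msubst_var [simp]: "msubst h x (mvar i) = x i"
  by (simp add: mvar_def msubst_single h_1)

lemma msubst_uminus: "msubst h x (- f) = - msubst h x f"
  using msubst_add[of x f "- f"] by (simp add: eq_neg_iff_add_eq_0 add.commute)

lemma msubst_diff: "msubst h x (f - g) = msubst h x f - msubst h x g"
  using msubst_add[of x f "- g"] by (simp add: msubst_uminus)

lemma msubst_power: "msubst h x (f ^ k) = msubst h x f ^ k"
  by (induction k) (auto simp: msubst_mult)

lemma msubst_prod: "msubst h x (\<Prod>i\<in>A. f i) = (\<Prod>i\<in>A. msubst h x (f i))"
  by (induction A rule: infinite_finite_induct) (auto simp: msubst_mult)

lemmas msubst_simps = msubst_add msubst_mult msubst_sum msubst_prod msubst_power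
  msubst_diff msubst_uminus

end

lemma coeff_hom_id: "coeff_hom (\<lambda>c :: 'k::comm_ring_1. c)"
  by unfold_locales simp_all

lemmas peval_const [simp] = coeff_hom.msubst_const[OF coeff_hom_id, folded peval_eq_msubst]
  and peval_var [simp] = coeff_hom.msubst_var[OF coeff_hom_id, folded peval_eq_msubst]
  and peval_0 [simp] = coeff_hom.msubst_0[OF coeff_hom_id, folded peval_eq_msubst]
  and peval_1 [simp] = coeff_hom.msubst_1[OF coeff_hom_id, folded peval_eq_msubst]
  and peval_simps = coeff_hom.msubst_simps[OF coeff_hom_id, folded peval_eq_msubst]

global_interpretation cst: coeff_hom "mconst :: 'k::comm_ring_1 \<Rightarrow> ('n, 'k) mpoly"
  by unfold_locales (simp_all add: mconst_add mconst_mult)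

global_interpretation upol: coeff_hom "\<lambda>c :: 'k::comm_ring_1. [:c:]"
  by unfold_locales (simp_all add: one_pCons)

lemma msubst_hom:
  fixes \<psi> :: "'r::comm_ring_1 \<Rightarrow> 's::comm_ring_1"
  assumes "coeff_hom h" "\<And>a b. \<psi> (a + b) = \<psi> a + \<psi> b" "\<And>a b. \<psi> (a * b) = \<psi> a * \<psi> b"
    "\<And>c. \<psi> (h c) = h' c" "coeff_hom h'"
  shows "\<psi> (msubst h x f) = msubst h' (\<lambda>i. \<psi> (x i)) f"
proof -
  interpret a: coeff_hom h by fact
  interpret b: coeff_hom h' by fact
  show ?thesis
    by (induction f rule: mpoly_induct) (simp_all add: assms a.msubst_simps b.msubst_simps)
qed

lemmas coeff_homs = coeff_hom_id cst.coeff_hom_axioms upol.coeff_hom_axioms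

lemma peval_msubst_mconst: "peval (msubst mconst g f) x = peval f (\<lambda>i. peval (g i) x)"
  unfolding peval_eq_msubst
  by (rule msubst_hom[OF coeff_homs(2) _ _ _ coeff_homs(1)])
    (simp_all add: peval_simps flip: peval_eq_msubst)

lemma poly_msubst_pCons: "poly (msubst (\<lambda>c. [:c:]) g f) u = peval f (\<lambda>i. poly (g i) u)"
  unfolding peval_eq_msubst
  by (rule msubst_hom[OF coeff_homs(3) _ _ _ coeff_homs(1)]) simp_all

text \<open>On the line through \<open>x\<close> and \<open>y\<close> both polynomials become
  nonzero univariate ones, whose product has finitely many roots. This is irreducibility of affine
  space in the form used throughout: two nonempty open conditions hold at a common point.\<close>

lemma nonzero_on_line:
  fixes f g :: "('n, 'k::field) mpoly"
  assumes inf: "infinite (UNIV :: 'k set)" and "peval f x \<noteq> 0" "peval g y \<noteq> 0"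
  obtains t where "peval f (\<lambda>i. x i + t * (y i - x i)) \<noteq> 0" "peval g (\<lambda>i. x i + t * (y i - x i)) \<noteq> 0"
proof -
  define R where "R = msubst (\<lambda>c. [:c:]) (\<lambda>i. [:x i, y i - x i:])"
  have R: "poly (R f) t = peval f (\<lambda>i. x i + t * (y i - x i))" for f t
    by (simp add: R_def poly_msubst_pCons)
  have "R f \<noteq> 0" using R[of f 0] assms by auto
  moreover have "R g \<noteq> 0" using R[of g 1] assms by auto
  ultimately have "finite {t. poly (R f * R g) t = 0}" by (intro poly_roots_finite) auto
  with inf have "{t. poly (R f * R g) t = 0} \<noteq> UNIV" by metis
  then obtain t where "poly (R f * R g) t \<noteq> 0" by blast
  then show thesis using that by (auto simp: R)
qed

lemma poly_eq_0_infinite: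
  fixes p :: "'k::field poly"
  assumes "infinite (UNIV :: 'k set)" "\<And>t. poly p t = 0"
  shows "p = 0"
  using poly_roots_finite[of p] assms by auto

text \<open>Extracting the coefficient of degree \<open>k\<close> in the variable \<open>a\<close>
  keeps exactly the exponents with \<open>m a = k\<close>. These agree at \<open>a\<close>, so the
  remaining variables still separate them, which is why the separation hypothesis is relative to
  \<open>A\<close>.\<close>

lemma monomials_independent:
  fixes c :: "('n \<Rightarrow> nat) \<Rightarrow> 'k::field"
  assumes inf: "infinite (UNIV :: 'k set)" and "finite A"
  shows "finite M \<Longrightarrow> (\<And>m m'. m \<in> M \<Longrightarrow> m' \<in> M \<Longrightarrow> (\<And>i. i \<in> A \<Longrightarrow> m i = m' i) \<Longrightarrow> m = m')
    \<Longrightarrow> (\<And>x. (\<Sum>m\<in>M. c m * (\<Prod>i\<in>A. x i ^ m i)) = 0) \<Longrightarrow> m \<in> M \<Longrightarrow> c m = 0"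
  using \<open>finite A\<close>
proof (induction A arbitrary: M m rule: finite_induct)
  case empty
  then have "M = {m}" by auto
  with empty(3) show ?case by simp
next
  case (insert a A M m0)
  define k where "k = m0 a"
  have "(\<Sum>m\<in>{m \<in> M. m a = k}. c m * (\<Prod>i\<in>A. x i ^ m i)) = 0" for x
  proof -
    define p where "p = (\<Sum>m\<in>M. monom (c m * (\<Prod>i\<in>A. x i ^ m i)) (m a))"
    have "poly p t = 0" for t
    proof -
      have "(\<Prod>i\<in>A. x i ^ m i) = (\<Prod>i\<in>A. (x(a := t)) i ^ m i)" for m
        using insert.hyps by (intro prod.cong) auto
      then have "poly p t = (\<Sum>m\<in>M. c m * (\<Prod>i\<in>insert a A. (x(a := t)) i ^ m i))"
        using insert.hyps by (simp add: p_def poly_sum poly_monom mult_ac)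
      then show ?thesis using insert.prems(3) by simp
    qed
    then have "p = 0" by (rule poly_eq_0_infinite[OF inf])
    then have "coeff p k = 0" by simp
    moreover have "coeff p k = (\<Sum>m\<in>M. if m a = k then c m * (\<Prod>i\<in>A. x i ^ m i) else 0)"
      by (simp add: p_def coeff_sum)
    ultimately show ?thesis by (simp add: sum.inter_filter insert.prems)
  qed
  moreover have "m = m'" if "m \<in> {m \<in> M. m a = k}" "m' \<in> {m \<in> M. m a = k}"
      "\<And>i. i \<in> A \<Longrightarrow> m i = m' i" for m m'
    using that by (intro insert.prems(2)) auto
  ultimately show ?case
    using insert.IH[of "{m \<in> M. m a = k}" m0] insert.prems by (simp add: k_def)
qed

lemma mpoly_eq_0I:
  fixes f :: "('n::finite, 'k::field) mpoly"
  assumes inf: "infinite (UNIV :: 'k set)" and zero: "\<And>x. peval f x = 0"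
  shows "f = 0"
proof (rule poly_mapping_eqI)
  fix m
  define M where "M = Poly_Mapping.lookup ` Poly_Mapping.keys f"
  \<comment> \<open>Exponents become plain functions to fit \<open>monomials_independent\<close>;
    \<open>THE\<close> inverts the injective map \<open>Poly_Mapping.lookup\<close>.\<close>
  define c where "c e = Poly_Mapping.lookup f (THE m. Poly_Mapping.lookup m = e)" for e
  have the: "(THE m'. Poly_Mapping.lookup m' = Poly_Mapping.lookup m) = m" for m :: "'n \<Rightarrow>\<^sub>0 nat"
    by (rule the_equality) (auto intro: poly_mapping_eqI)
  have inj: "inj_on Poly_Mapping.lookup (Poly_Mapping.keys f)"
    by (auto intro: inj_onI poly_mapping_eqI)
  have "(\<Sum>e\<in>M. c e * (\<Prod>i\<in>UNIV. x i ^ e i)) = 0" for x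
  proof -
    have "(\<Sum>e\<in>M. c e * (\<Prod>i\<in>UNIV. x i ^ e i)) = peval f x"
      unfolding M_def sum.reindex[OF inj] peval_eq_msubst msubst_def
      by (simp add: c_def the monomial_eval_superset[of UNIV])
    then show ?thesis using zero by simp
  qed
  from monomials_independent[OF inf finite_class.finite_UNIV _ _ this]
  have "e \<in> M \<Longrightarrow> c e = 0" for e by (auto simp: M_def)
  from this[of "Poly_Mapping.lookup m"]
  show "Poly_Mapping.lookup f m = Poly_Mapping.lookup 0 m"
    by (cases "m \<in> Poly_Mapping.keys f") (auto simp: M_def c_def the in_keys_iff)
qed

section \<open>Homogeneous polynomials and binary forms\<close>

lemma mdeg_superset:
  assumes "finite A" "Poly_Mapping.keys m \<subseteq> A"
  shows "mdeg m = (\<Sum>i\<in>A. Poly_Mapping.lookup m i)"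
  unfolding mdeg_def
  by (rule sum.mono_neutral_left) (use assms in \<open>auto simp: in_keys_iff\<close>)

lemma mdeg_add [simp]: "mdeg (m + m') = mdeg m + mdeg m'"
proof -
  let ?A = "Poly_Mapping.keys m \<union> Poly_Mapping.keys m'"
  have "Poly_Mapping.keys (m + m') \<subseteq> ?A" by (rule Poly_Mapping.keys_add)
  then show ?thesis by (simp add: mdeg_superset[of ?A] lookup_add sum.distrib)
qed

lemma mdeg_0 [simp]: "mdeg 0 = 0"
  by (simp add: mdeg_def)

lemma mdeg_single [simp]: "mdeg (Poly_Mapping.single i k) = k"
  by (cases "k = 0") (simp_all add: mdeg_def)

lemma homog_0 [simp]: "0 \<in> homog d"
  by (simp add: homog_def)

lemma homog_add: "f \<in> homog d \<Longrightarrow> g \<in> homog d \<Longrightarrow> f + g \<in> homog d"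
  using Poly_Mapping.keys_add[of f g] by (auto simp: homog_def)

lemma homog_uminus: "f \<in> homog d \<Longrightarrow> - f \<in> homog d"
  by (auto simp: homog_def in_keys_iff)

lemma homog_diff: "f \<in> homog d \<Longrightarrow> g \<in> homog d \<Longrightarrow> f - g \<in> homog d"
  using homog_add[of f d "- g"] homog_uminus[of g d] by simp

lemma homog_sum: "(\<And>i. i \<in> A \<Longrightarrow> f i \<in> homog d) \<Longrightarrow> (\<Sum>i\<in>A. f i) \<in> homog d"
  by (induction A rule: infinite_finite_induct) (auto intro: homog_add)

lemma homog_mult: "f \<in> homog d \<Longrightarrow> g \<in> homog e \<Longrightarrow> f * g \<in> homog (d + e)"
  unfolding homog_def using Poly_Mapping.keys_mult[of f g] by fastforce

lemma homog_mconst [simp]: "mconst c \<in> homog 0"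
  by (auto simp: homog_def mconst_def)

lemma homog_one [simp]: "1 \<in> homog 0"
  using homog_mconst[of 1] by simp

lemma homog_mvar [simp]: "mvar i \<in> homog 1"
  by (auto simp: homog_def mvar_def)

lemma homog_mconst_mult: "f \<in> homog d \<Longrightarrow> mconst c * f \<in> homog d"
  using homog_mult[of "mconst c" 0 f d] by simp

lemma homog_power: "f \<in> homog d \<Longrightarrow> f ^ k \<in> homog (int k * d)"
proof (induction k)
  case (Suc k)
  then show ?case using homog_mult[of f d "f ^ k" "int k * d"] by (simp add: algebra_simps)
qed simp

lemma homog_linear_power: "f \<in> homog 1 \<Longrightarrow> f ^ k \<in> homog (int k)"
  using homog_power[of f 1 k] by simp

lemma homog_prod: "finite A \<Longrightarrow> (\<And>i. i \<in> A \<Longrightarrow> f i \<in> homog 1) \<Longrightarrow> (\<Prod>i\<in>A. f i) \<in> homog (int (card A))"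
proof (induction A rule: finite_induct)
  case (insert a A)
  then show ?case using homog_mult[of "f a" 1 "\<Prod>i\<in>A. f i" "int (card A)"] by simp
qed simp

lemma homog_negative: "d < 0 \<Longrightarrow> f \<in> homog d \<Longrightarrow> f = 0"
  unfolding homog_def by (cases "Poly_Mapping.keys f = {}") auto

lemma monomial_eval_scaled:
  "monomial_eval (\<lambda>i. t * x i) m = t ^ mdeg m * monomial_eval x m"
  by (simp add: monomial_eval_def mdeg_def power_mult_distrib prod.distrib power_sum)

lemma peval_homog_scaled:
  assumes "f \<in> homog (int d)"
  shows "peval f (\<lambda>i. t * x i) = t ^ d * peval f x"
  using assms unfolding peval_eq_msubst msubst_def homog_def
  by (auto simp: monomial_eval_scaled sum_distrib_left mult.left_commute intro!: sum.cong)

lemma degree_monomial_eval: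
  fixes g :: "'n \<Rightarrow> 'k::idom poly"
  assumes "\<And>i. degree (g i) \<le> 1"
  shows "degree (monomial_eval g m) \<le> mdeg m"
proof -
  have "degree (monomial_eval g m) \<le> (\<Sum>i\<in>Poly_Mapping.keys m. degree (g i ^ Poly_Mapping.lookup m i))"
    unfolding monomial_eval_def by (rule order.trans[OF degree_prod_sum_le]) simp_all
  also have "\<dots> \<le> mdeg m"
    unfolding mdeg_def
  proof (rule sum_mono)
    fix i
    have "degree (g i ^ Poly_Mapping.lookup m i) \<le> degree (g i) * Poly_Mapping.lookup m i"
      by (rule degree_power_le)
    also have "\<dots> \<le> 1 * Poly_Mapping.lookup m i" by (rule mult_right_mono[OF assms]) simp
    finally show "degree (g i ^ Poly_Mapping.lookup m i) \<le> Poly_Mapping.lookup m i" by simp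
  qed
  finally show ?thesis .
qed

lemma degree_msubst:
  fixes g :: "'n \<Rightarrow> 'k::idom poly"
  assumes "\<And>i. degree (g i) \<le> 1" "f \<in> homog (int d)"
  shows "degree (msubst (\<lambda>c. [:c:]) g f) \<le> d"
  unfolding msubst_def
proof (rule degree_sum_le)
  fix m assume "m \<in> Poly_Mapping.keys f"
  then have "mdeg m = d" using assms(2) by (auto simp: homog_def)
  then show "degree ([:Poly_Mapping.lookup f m:] * monomial_eval g m) \<le> d"
    using degree_monomial_eval[of g m] assms(1) by (simp add: order.trans[OF degree_smult_le])
qed simp

section \<open>Homogeneous components and homogenization\<close>

definition hpart :: "nat \<Rightarrow> ('n, 'k::comm_ring_1) mpoly \<Rightarrow> ('n, 'k) mpoly" where
  "hpart d f = (\<Sum>m\<in>{m\<in>Poly_Mapping.keys f. mdeg m = d}. Poly_Mapping.single m (Poly_Mapping.lookup f m))"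

lemma lookup_hpart: "Poly_Mapping.lookup (hpart d f) m = (if mdeg m = d then Poly_Mapping.lookup f m else 0)"
  by (auto simp: hpart_def lookup_sum lookup_single when_def in_keys_iff)

lemma hpart_homog: "hpart d f \<in> homog (int d)"
  by (auto simp: homog_def in_keys_iff lookup_hpart split: if_splits)

lemma hpart_add: "hpart d (f + g) = hpart d f + hpart d g"
  by (rule poly_mapping_eqI) (simp add: lookup_hpart lookup_add)

lemma hpart_zero [simp]: "hpart d 0 = 0"
  by (rule poly_mapping_eqI) (simp add: lookup_hpart)

lemma hpart_sum: "hpart d (\<Sum>i\<in>A. f i) = (\<Sum>i\<in>A. hpart d (f i))"
  by (induction A rule: infinite_finite_induct) (auto simp: hpart_add)

lemma hpart_single: "hpart d (Poly_Mapping.single m c) = (if mdeg m = d then Poly_Mapping.single m c else 0)"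
  by (rule poly_mapping_eqI) (auto simp: lookup_hpart lookup_single when_def)

lemma hpart_id: "f \<in> homog (int d) \<Longrightarrow> hpart d f = f"
  by (rule poly_mapping_eqI) (auto simp: lookup_hpart homog_def in_keys_iff)

text \<open>Multiplication by a form of degree \<open>e\<close> shifts all degrees by
  \<open>e\<close>. This later replaces arbitrary ideal coefficients by homogeneous ones.\<close>

lemma hpart_mult_homog:
  assumes "g \<in> homog (int e)"
  shows "hpart (d + e) (f * g) = hpart d f * g"
proof -
  let ?s = Poly_Mapping.single and ?l = Poly_Mapping.lookup and ?k = Poly_Mapping.keys
  have g: "g = (\<Sum>m'\<in>?k g. ?s m' (?l g m'))" by (rule mpoly_eq_sum_monomials)
  have single: "hpart (d + e) (?s m c * g) = hpart d (?s m c) * g" for m c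
  proof -
    have "?s m c * g = (\<Sum>m'\<in>?k g. ?s (m + m') (c * ?l g m'))"
      by (subst g) (simp add: sum_distrib_left mult_single)
    then have "hpart (d + e) (?s m c * g) =
        (\<Sum>m'\<in>?k g. hpart (d + e) (?s (m + m') (c * ?l g m')))"
      by (simp add: hpart_sum)
    also have "\<dots> = (\<Sum>m'\<in>?k g. hpart d (?s m c) * ?s m' (?l g m'))"
      using assms by (intro sum.cong) (auto simp: hpart_single homog_def mult_single)
    also have "\<dots> = hpart d (?s m c) * g"
      by (subst (2) g) (simp add: sum_distrib_left)
    finally show ?thesis .
  qed
  have "hpart (d + e) (f * g) = hpart (d + e) ((\<Sum>m\<in>?k f. ?s m (?l f m)) * g)"
    by (simp only: mpoly_eq_sum_monomials[symmetric])
  also have "\<dots> = (\<Sum>m\<in>?k f. hpart d (?s m (?l f m))) * g"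
    by (simp add: sum_distrib_right hpart_sum single)
  also have "\<dots> = hpart d f * g"
    by (simp only: hpart_sum[symmetric] mpoly_eq_sum_monomials[symmetric])
  finally show ?thesis .
qed

lemma linear_form_expansion:
  fixes f :: "('n::finite, 'k::comm_ring_1) mpoly"
  assumes "f \<in> homog 1"
  obtains c where "f = (\<Sum>i\<in>UNIV. mconst (c i) * mvar i)"
proof
  show "f = (\<Sum>i\<in>UNIV. mconst (Poly_Mapping.lookup f (Poly_Mapping.single i 1)) * mvar i)" (is "_ = ?g")
  proof (rule poly_mapping_eqI)
    fix m
    have g: "Poly_Mapping.lookup ?g m =
        (\<Sum>i\<in>UNIV. Poly_Mapping.lookup f m when Poly_Mapping.single i 1 = m)"
      by (auto simp: mconst_def mvar_def mult_single lookup_sum lookup_single when_def intro!: sum.cong)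
    show "Poly_Mapping.lookup f m = Poly_Mapping.lookup ?g m"
    proof (cases "\<exists>i. m = Poly_Mapping.single i 1")
      case True
      then obtain j where j: "m = Poly_Mapping.single j 1" by blast
      have "Poly_Mapping.single i 1 = m \<longleftrightarrow> i = j" for i
        unfolding j by (metis keys_single one_neq_zero singleton_inject)
      then show ?thesis unfolding g by (simp only: when_def sum.delta'[OF finite_class.finite_UNIV] UNIV_I simp_thms if_True if_False sum.neutral_const) (auto simp: sum.delta)
    next
      case False
      have "Poly_Mapping.lookup f m = 0"
      proof (rule ccontr)
        assume "Poly_Mapping.lookup f m \<noteq> 0"
        then have "mdeg m = 1" using assms by (auto simp: homog_def in_keys_iff)
        then have "(\<Sum>i\<in>UNIV. Poly_Mapping.lookup m i) = 1"
          using mdeg_superset[of UNIV m] by simp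
        then obtain i where "Poly_Mapping.lookup m i = 1" "\<forall>j. j \<noteq> i \<longrightarrow> Poly_Mapping.lookup m j = 0"
          using sum_eq_1_iff[of "UNIV :: 'n set" "Poly_Mapping.lookup m"] by auto
        then have "m = Poly_Mapping.single i 1"
          by (intro poly_mapping_eqI) (auto simp: lookup_single when_def)
        with False show False by blast
      qed
      then show ?thesis unfolding g by (simp only: when_def sum.delta'[OF finite_class.finite_UNIV] UNIV_I simp_thms if_True if_False sum.neutral_const) (auto simp: sum.delta)
    qed
  qed
qed

text \<open>The homogenization of \<open>p\<close> in degree \<open>D\<close>, evaluated at two
  polynomials, with \<open>t / s\<close> in place of the variable. Coefficients beyond
  \<open>D\<close> are dropped, so \<open>p\<close> can be recovered only under a degree
  bound.\<close>

definition bform :: "nat \<Rightarrow> 'k::comm_ring_1 poly \<Rightarrow> ('n, 'k) mpoly \<Rightarrow> ('n, 'k) mpoly \<Rightarrow> ('n, 'k) mpoly" where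
  "bform D p s t = (\<Sum>k\<le>D. mconst (coeff p k) * s ^ (D - k) * t ^ k)"

lemma bform_homog:
  assumes "s \<in> homog 1" "t \<in> homog 1"
  shows "bform D p s t \<in> homog (int D)"
  unfolding bform_def
proof (rule homog_sum)
  fix k assume "k \<in> {..D}"
  then have D: "int D = 0 + int (D - k) + int k" by simp
  show "mconst (coeff p k) * s ^ (D - k) * t ^ k \<in> homog (int D)"
    unfolding D by (intro homog_mult homog_linear_power assms homog_mconst)
qed

lemma bform_add: "bform D (p + q) s t = bform D p s t + bform D q s t"
  by (simp add: bform_def mconst_add distrib_right sum.distrib)

lemma bform_smult: "bform D (smult c p) s t = mconst c * bform D p s t"
  by (simp add: bform_def mconst_mult sum_distrib_left mult.assoc)

lemma msubst_bform:
  assumes "degree p \<le> D" "msubst (\<lambda>c. [:c:]) g s = 1" "msubst (\<lambda>c. [:c:]) g t = [:0, 1:]"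
  shows "msubst (\<lambda>c. [:c:]) g (bform D p s t) = p"
proof -
  have "msubst (\<lambda>c. [:c:]) g (bform D p s t) = (\<Sum>k\<le>D. monom (coeff p k) k)"
    unfolding bform_def by (simp add: upol.msubst_simps assms(2,3) monom_altdef)
  then show ?thesis by (simp add: poly_as_sum_of_monoms' assms(1))
qed

lemma peval_bform:
  fixes p :: "'k::field poly"
  assumes "degree p \<le> D" "peval s x \<noteq> 0"
  shows "peval (bform D p s t) x = peval s x ^ D * poly p (peval t x / peval s x)"
proof -
  have "peval (bform D p s t) x = (\<Sum>k\<le>D. peval s x ^ D * (coeff p k * (peval t x / peval s x) ^ k))"
    unfolding bform_def peval_simps
  proof (rule sum.cong)
    fix k assume "k \<in> {..D}"
    then have "peval s x ^ D = peval s x ^ (D - k) * peval s x ^ k" by (simp flip: power_add)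
    then show "peval (mconst (coeff p k)) x * peval s x ^ (D - k) * peval t x ^ k
      = peval s x ^ D * (coeff p k * (peval t x / peval s x) ^ k)"
      using assms(2) by (simp add: power_divide field_simps)
  qed simp
  also have "\<dots> = peval s x ^ D * (\<Sum>k\<le>degree p. coeff p k * (peval t x / peval s x) ^ k)"
    unfolding sum_distrib_left
    by (rule sum.mono_neutral_right) (use assms(1) in \<open>auto simp: coeff_eq_0\<close>)
  finally show ?thesis by (simp add: poly_altdef)
qed

section \<open>Derivations and linear forms\<close>

lemma pdiff_superset:
  assumes "finite A" "Poly_Mapping.keys f \<subseteq> A"
  shows "pdiff i f = (\<Sum>m\<in>A. Poly_Mapping.single (m - Poly_Mapping.single i 1)
       (of_nat (Poly_Mapping.lookup m i) * Poly_Mapping.lookup f m))"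
  unfolding pdiff_def
  by (rule sum.mono_neutral_left) (use assms in \<open>auto simp: in_keys_iff\<close>)

lemma pdiff_add: "pdiff i (f + g) = pdiff i f + pdiff i g"
proof -
  let ?A = "Poly_Mapping.keys f \<union> Poly_Mapping.keys g"
  have "Poly_Mapping.keys (f + g) \<subseteq> ?A" by (rule Poly_Mapping.keys_add)
  then show ?thesis
    by (simp add: pdiff_superset[of ?A] lookup_add distrib_left single_add sum.distrib)
qed

lemma pdiff_single:
  "pdiff i (Poly_Mapping.single m c) = Poly_Mapping.single (m - Poly_Mapping.single i 1) (of_nat (Poly_Mapping.lookup m i) * c)"
  by (subst pdiff_superset[of "{m}"]) auto

lemma pdiff_0 [simp]: "pdiff i 0 = 0"
  by (simp add: pdiff_def)

lemma pdiff_sum: "pdiff i (\<Sum>j\<in>A. f j) = (\<Sum>j\<in>A. pdiff i (f j))"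
  by (induction A rule: infinite_finite_induct) (auto simp: pdiff_add)

lemma pdiff_mult_single:
  fixes c c' :: "'k::comm_ring_1"
  shows "pdiff i (Poly_Mapping.single m c * Poly_Mapping.single m' c') =
    Poly_Mapping.single m c * pdiff i (Poly_Mapping.single m' c') +
    Poly_Mapping.single m' c' * pdiff i (Poly_Mapping.single m c)"
proof -
  let ?s = "Poly_Mapping.single i (1::nat)" and ?l = Poly_Mapping.lookup
  \<comment> \<open>Subtraction of exponents is truncated, so regrouping can fail when
    \<open>i\<close> does not occur in \<open>q\<close>; in that case the coefficient is zero and
    both sides vanish.\<close>
  have shift: "Poly_Mapping.single (p + q - ?s) (of_nat (?l q i) * b) =
      Poly_Mapping.single (p + (q - ?s)) (of_nat (?l q i) * b)" for p q and b :: 'k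
  proof (cases "?l q i = 0")
    case False
    then have "p + q - ?s = p + (q - ?s)"
      by (intro poly_mapping_eqI) (auto simp: lookup_add lookup_minus lookup_single when_def)
    then show ?thesis by simp
  qed simp
  have "pdiff i (Poly_Mapping.single m c * Poly_Mapping.single m' c') =
      Poly_Mapping.single (m + m' - ?s) (of_nat (?l m i) * (c * c')) +
      Poly_Mapping.single (m + m' - ?s) (of_nat (?l m' i) * (c * c'))"
    by (simp add: mult_single pdiff_single lookup_add distrib_right single_add)
  also have "Poly_Mapping.single (m + m' - ?s) (of_nat (?l m i) * (c * c')) =
      Poly_Mapping.single m' c' * pdiff i (Poly_Mapping.single m c)"
    using shift[of m' m "c * c'"] by (simp add: mult_single pdiff_single add.commute mult_ac)
  also have "Poly_Mapping.single (m + m' - ?s) (of_nat (?l m' i) * (c * c')) =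
      Poly_Mapping.single m c * pdiff i (Poly_Mapping.single m' c')"
    using shift[of m m' "c * c'"] by (simp add: mult_single pdiff_single mult_ac)
  finally show ?thesis by (simp add: add.commute)
qed

lemma pdiff_mult: "pdiff i (f * g) = f * pdiff i g + g * pdiff i f"
proof -
  let ?s = Poly_Mapping.single and ?l = Poly_Mapping.lookup and ?k = Poly_Mapping.keys
  have "pdiff i (f * g) = pdiff i ((\<Sum>m\<in>?k f. ?s m (?l f m)) * (\<Sum>m'\<in>?k g. ?s m' (?l g m')))"
    by (simp only: mpoly_eq_sum_monomials[symmetric])
  also have "\<dots> = (\<Sum>m\<in>?k f. \<Sum>m'\<in>?k g. ?s m (?l f m) * pdiff i (?s m' (?l g m'))) +
      (\<Sum>m\<in>?k f. \<Sum>m'\<in>?k g. ?s m' (?l g m') * pdiff i (?s m (?l f m)))"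
    by (simp only: sum_product pdiff_sum pdiff_mult_single sum.distrib)
  also have "(\<Sum>m\<in>?k f. \<Sum>m'\<in>?k g. ?s m (?l f m) * pdiff i (?s m' (?l g m'))) =
      (\<Sum>m\<in>?k f. ?s m (?l f m)) * pdiff i (\<Sum>m'\<in>?k g. ?s m' (?l g m'))"
    by (simp only: sum_product pdiff_sum)
  also have "(\<Sum>m\<in>?k f. \<Sum>m'\<in>?k g. ?s m' (?l g m') * pdiff i (?s m (?l f m))) =
      (\<Sum>m'\<in>?k g. ?s m' (?l g m')) * pdiff i (\<Sum>m\<in>?k f. ?s m (?l f m))"
    by (subst sum.swap) (simp only: sum_product pdiff_sum)
  finally show ?thesis by (simp only: mpoly_eq_sum_monomials[symmetric])
qed

lemma pdiff_mconst [simp]: "pdiff i (mconst c) = 0"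
  by (simp add: mconst_def pdiff_single)

lemma pdiff_mvar: "pdiff i (mvar j) = (if i = j then 1 else 0)"
  by (auto simp: mvar_def pdiff_single lookup_single when_def)

definition vfield :: "('n::finite \<Rightarrow> ('n, 'k::comm_ring_1) mpoly) \<Rightarrow> ('n, 'k) mpoly \<Rightarrow> ('n, 'k) mpoly" where
  "vfield G f = (\<Sum>i\<in>UNIV. G i * pdiff i f)"

lemma vfield_mvar [simp]: "vfield G (mvar i) = G i"
  by (simp add: vfield_def pdiff_mvar if_distrib cong: if_cong)

lemma vfield_add: "vfield G (f + g) = vfield G f + vfield G g"
  by (simp add: vfield_def pdiff_add distrib_left sum.distrib)

lemma vfield_mult: "vfield G (f * g) = f * vfield G g + g * vfield G f"
  unfolding vfield_def pdiff_mult distrib_left sum.distrib sum_distrib_left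
  by (simp add: mult.left_commute)

lemma vfield_mconst [simp]: "vfield G (mconst c) = 0"
  by (simp add: vfield_def)

lemma derivation_vfield: "derivation (vfield G)"
  unfolding derivation_def
proof (intro conjI allI)
  show "Vector_Spaces.linear pscale pscale (vfield G)"
    by unfold_locales (simp_all add: vfield_add pscale_eq vfield_mult)
qed (rule vfield_mult)

text \<open>The Leibniz rule at \<open>1 * 1\<close> shows that constants are killed, and then it
  propagates the values on the variables to all polynomials.\<close>

lemma derivation_eq_vfield:
  assumes "derivation \<theta>"
  shows "\<theta> = vfield (\<lambda>i. \<theta> (mvar i))"
proof
  fix f
  interpret l: Vector_Spaces.linear pscale pscale \<theta> using assms by (simp add: derivation_def)
  have leib: "\<theta> (f * g) = f * \<theta> g + g * \<theta> f" for f g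
    using assms by (simp add: derivation_def)
  have one: "\<theta> 1 = 0" using leib[of 1 1] by simp
  have const: "\<theta> (mconst c) = 0" for c
    using l.scale[of c 1] by (simp add: pscale_eq one)
  show "\<theta> f = vfield (\<lambda>i. \<theta> (mvar i)) f"
    by (induction f rule: mpoly_induct) (simp_all add: const leib l.add vfield_add vfield_mult)
qed

lemma vfield_add_left: "vfield G + vfield G' = vfield (\<lambda>i. G i + G' i)"
  by (auto simp: vfield_def distrib_right sum.distrib)

lemma vfield_fscale: "fscale s (vfield G) = vfield (\<lambda>i. s * G i)"
  by (auto simp: vfield_def fscale_def sum_distrib_left mult.assoc)

lemma vfield_sum_left: "(\<Sum>j\<in>A. vfield (G j)) = vfield (\<lambda>i. \<Sum>j\<in>A. G j i)"
proof (induction A rule: infinite_finite_induct)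
  case (insert a A)
  then show ?case by (simp add: vfield_add_left)
qed (auto simp: vfield_def)

lemma euler_eq_vfield: "euler_derivation = vfield mvar"
  by (auto simp: euler_derivation_def vfield_def)

definition dot :: "'k::comm_ring_1 ^ 'n::finite \<Rightarrow> 'k ^ 'n \<Rightarrow> 'k" where
  "dot c x = (\<Sum>i\<in>UNIV. c $ i * x $ i)"

definition lform :: "'k::comm_ring_1 ^ 'n::finite \<Rightarrow> ('n, 'k) mpoly" where
  "lform c = (\<Sum>i\<in>UNIV. mconst (c $ i) * mvar i)"

lemma dot_commute: "dot x y = dot y x"
  by (simp add: dot_def mult.commute)

lemma dot_add: "dot c (x + y) = dot c x + dot c y"
  and dot_diff: "dot c (x - y) = dot c x - dot c y"
  and dot_scale: "dot c (t *s x) = t * dot c x"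
  and dot_0 [simp]: "dot c 0 = 0"
  by (simp_all add: dot_def algebra_simps sum.distrib sum_subtractf sum_distrib_left)

lemma dot_add_left: "dot (x + y) c = dot x c + dot y c"
  and dot_diff_left: "dot (x - y) c = dot x c - dot y c"
  and dot_scale_left: "dot (t *s x) c = t * dot x c"
  and dot_0_left [simp]: "dot 0 c = 0"
  by (simp_all add: dot_def algebra_simps sum.distrib sum_subtractf sum_distrib_left)

lemma dot_axis: "dot c (axis i 1) = c $ i"
  by (simp add: dot_def axis_def if_distrib cong: if_cong)

lemma peval_lform: "peval (lform c) x = dot c (\<chi> i. x i)"
  by (simp add: lform_def dot_def peval_simps)

lemma peval_lform_vec [simp]: "peval (lform c) (\<lambda>i. x $ i) = dot c x"
  by (simp add: peval_lform)

lemma lform_homog [simp]: "lform c \<in> homog 1"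
  unfolding lform_def by (intro homog_sum homog_mconst_mult homog_mvar)

lemma vfield_lform: "vfield G (lform c) = (\<Sum>i\<in>UNIV. mconst (c $ i) * G i)"
proof -
  have sum: "vfield G (\<Sum>i\<in>A. f i) = (\<Sum>i\<in>A. vfield G (f i))" for A and f :: "'a \<Rightarrow> ('a, 'b) mpoly"
    by (simp add: vfield_def pdiff_sum sum_distrib_left) (rule sum.swap)
  show ?thesis by (simp add: lform_def sum vfield_mult)
qed

section \<open>Vanishing ideals of linear subspaces\<close>

lemma congruent_msubst:
  assumes I: "ideal.subspace I" and g: "\<And>i. mvar i - g i \<in> I"
  shows "f - msubst mconst g f \<in> I"
proof (induction f rule: mpoly_induct)
  case (const c)
  show ?case using ideal.subspace_0[OF I] by simp
next
  case (var i)
  show ?case using g by simp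
next
  case (add f f')
  have "f + f' - msubst mconst g (f + f') = (f - msubst mconst g f) + (f' - msubst mconst g f')"
    by (simp add: cst.msubst_simps)
  then show ?case by (simp only: ideal.subspace_add[OF I add])
next
  case (mult f f')
  have "f * f' - msubst mconst g (f * f') =
      f' * (f - msubst mconst g f) + msubst mconst g f * (f' - msubst mconst g f')"
    by (simp add: cst.msubst_mult right_diff_distrib mult.commute)
  then show ?case
    by (simp only: ideal.subspace_add[OF I ideal.subspace_scale[OF I mult(1)]
        ideal.subspace_scale[OF I mult(2)]])
qed

text \<open>The \<open>g i\<close> form a polynomial map into \<open>V\<close> that is the identity
  modulo \<open>I\<close>. Composing \<open>f\<close> with it gives a polynomial that vanishes
  everywhere, hence is zero over an infinite field, while \<open>f\<close> is congruent to the
  composite. With a linear projection for \<open>g\<close> this yields generators of the ideals of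
  hyperplanes and centers without the Nullstellensatz.\<close>

lemma vanishing_ideal_projection:
  fixes V :: "('k::field ^ 'n::finite) set"
  assumes inf: "infinite (UNIV :: 'k set)" and I: "ideal.subspace I"
    and g: "\<And>i. mvar i - g i \<in> I" and V: "\<And>x. (\<chi> i. peval (g i) (\<lambda>i. x $ i)) \<in> V"
    and f: "f \<in> vanishing_ideal V"
  shows "f \<in> I"
proof -
  have "msubst mconst g f = 0"
  proof (rule mpoly_eq_0I[OF inf])
    fix x :: "'n \<Rightarrow> 'k"
    have "peval f (\<lambda>i. (\<chi> i. peval (g i) (\<lambda>i. (\<chi> i. x i) $ i)) $ i) = 0"
      using f V[of "\<chi> i. x i"] unfolding vanishing_ideal_def by blast
    then show "peval (msubst mconst g f) x = 0" by (simp add: peval_msubst_mconst)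
  qed
  with congruent_msubst[OF I g, of f] show ?thesis by simp
qed

lemma vanishing_ideal_hyperplane:
  fixes c :: "'k::field ^ 'n::finite"
  assumes inf: "infinite (UNIV :: 'k set)" and c: "c \<noteq> 0"
    and f: "f \<in> vanishing_ideal {y. dot c y = 0}"
  obtains k where "f = lform c * k"
proof -
  obtain i where i: "c $ i \<noteq> 0" using c by (auto simp: vec_eq_iff)
  \<comment> \<open>\<open>c\<close> takes the value 1 on this vector; projecting along it lands in
    the hyperplane and changes each variable by a multiple of \<open>lform c\<close>.\<close>
  define e where "e = (inverse (c $ i)) *s axis i 1"
  have e: "dot c e = 1" using i by (simp add: e_def dot_scale dot_axis)
  let ?I = "ideal.span {lform c}"
  define g where "g j = mvar j - mconst (e $ j) * lform c" for j
  have "f \<in> ?I"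
  proof (rule vanishing_ideal_projection[OF inf _ _ _ f])
    show "ideal.subspace ?I" by (rule ideal.subspace_span)
    show "mvar j - g j \<in> ?I" for j
      by (simp add: g_def ideal.span_scale ideal.span_base)
    show "(\<chi> j. peval (g j) (\<lambda>i. x $ i)) \<in> {y. dot c y = 0}" for x
    proof -
      have "(\<chi> j. peval (g j) (\<lambda>i. x $ i)) = x - dot c x *s e"
        by (simp add: vec_eq_iff g_def peval_simps mult.commute)
      then show ?thesis by (simp add: dot_diff dot_scale e)
    qed
  qed
  then obtain k where "f = k * lform c"
    by (auto simp: ideal.span_singleton)
  then show thesis using that[of k] by (simp add: mult.commute)
qed

text \<open>By the Leibniz rule, tangency to a hyperplane need only be tested on the generator
  \<open>lform c\<close> of its ideal.\<close>

lemma vfield_log_derivation_iff: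
  fixes C :: "('k::field ^ 'n::finite) set"
  assumes inf: "infinite (UNIV :: 'k set)" and C: "\<And>c. c \<in> C \<Longrightarrow> c \<noteq> 0"
  shows "vfield G \<in> log_derivations ((\<lambda>c. {y. dot c y = 0}) ` C) \<longleftrightarrow>
    (\<forall>c\<in>C. (\<Sum>i\<in>UNIV. mconst (c $ i) * G i) \<in> vanishing_ideal {y. dot c y = 0})"
proof (intro iffI ballI)
  fix c assume "vfield G \<in> log_derivations ((\<lambda>c. {y. dot c y = 0}) ` C)" "c \<in> C"
  then have "vfield G ` vanishing_ideal {y. dot c y = 0} \<subseteq> vanishing_ideal {y. dot c y = 0}"
    by (auto simp: log_derivations_def)
  moreover have "lform c \<in> vanishing_ideal {y. dot c y = 0}"
    by (simp add: vanishing_ideal_def)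
  ultimately show "(\<Sum>i\<in>UNIV. mconst (c $ i) * G i) \<in> vanishing_ideal {y. dot c y = 0}"
    by (auto simp flip: vfield_lform)
next
  assume G: "\<forall>c\<in>C. (\<Sum>i\<in>UNIV. mconst (c $ i) * G i) \<in> vanishing_ideal {y. dot c y = 0}"
  have "vfield G f \<in> vanishing_ideal {y. dot c y = 0}"
    if c: "c \<in> C" and f: "f \<in> vanishing_ideal {y. dot c y = 0}" for c f
  proof -
    obtain k where "f = lform c * k" using vanishing_ideal_hyperplane[OF inf C[OF c] f] .
    then show ?thesis using G c
      by (simp add: vfield_mult vfield_lform vanishing_ideal_def peval_simps)
  qed
  then show "vfield G \<in> log_derivations ((\<lambda>c. {y. dot c y = 0}) ` C)"
    by (auto simp: log_derivations_def derivation_vfield)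
qed

lemma vfield_homog_iff:
  fixes G :: "'n::finite \<Rightarrow> ('n, 'k::comm_ring_1) mpoly"
  shows "(\<forall>l\<in>homog 1. vfield G l \<in> homog d) \<longleftrightarrow> (\<forall>i. G i \<in> homog d)"
proof (intro iffI allI ballI)
  fix i assume "\<forall>l\<in>homog 1. vfield G l \<in> homog d"
  then have "vfield G (mvar i) \<in> homog d" by (rule bspec) simp
  then show "G i \<in> homog d" by simp
next
  fix l :: "('n, 'k) mpoly"
  assume G: "\<forall>i. G i \<in> homog d" and "l \<in> homog 1"
  obtain c where "l = (\<Sum>i\<in>UNIV. mconst (c i) * mvar i)"
    by (rule linear_form_expansion[OF \<open>l \<in> homog 1\<close>])
  then have "l = lform (\<chi> i. c i)" by (simp add: lform_def)
  then show "vfield G l \<in> homog d"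
    using G by (simp add: vfield_lform homog_sum homog_mconst_mult)
qed

section \<open>Sections over the two standard charts of a line\<close>

text \<open>The operations on sections are unions over representatives; they collapse to a single
  class once every representative yields the same one.\<close>

lemma UN_pair_const:
  assumes "X \<noteq> {}" "\<And>v r. (v, r) \<in> X \<Longrightarrow> F v r = C"
  shows "(\<Union>(v, r)\<in>X. F v r) = C"
  using assms by fast

text \<open>
  \<open>R\<close> is restriction to the line followed by setting \<open>x = 1\<close>, so that \<open>y\<close> becomes the variable of
  \<open>'k poly\<close>. Elements of \<open>M\<close> are described by their restrictions \<open>E v\<close>, which matter modulo \<open>P\<close>, and
  \<open>G\<close> represents the global sections of the \<open>m\<close>-th twist.
\<close>

locale charted =
  fixes x y :: "('n::finite, 'k::field) mpoly"
    and R :: "('n, 'k) mpoly \<Rightarrow> 'k poly"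
    and M :: "('i, ('n, 'k) mpoly) gmodule"
    and E :: "('i \<Rightarrow> ('n, 'k) mpoly) \<Rightarrow> 'v \<Rightarrow> 'k poly"
    and P G :: "('v \<Rightarrow> 'k poly) set"
    and m :: nat
  assumes R_1: "R 1 = 1" and R_mult: "R (s * t) = R s * R t"
    and R_mconst: "R (mconst c) = [:c:]" and R_x: "R x = 1" and R_y: "R y = [:0, 1:]"
    and x_homog: "x \<in> homog 1" and y_homog: "y \<in> homog 1"
    and gdeg_add: "v \<in> gdeg M d \<Longrightarrow> v' \<in> gdeg M d \<Longrightarrow> v + v' \<in> gdeg M d"
    and gdeg_scale: "s \<in> homog e \<Longrightarrow> v \<in> gdeg M d \<Longrightarrow> fscale s v \<in> gdeg M (d + e)"
    and E_add: "E (v + v') j = E v j + E v' j"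
    and E_scale: "E (fscale s v) j = R s * E v j"
    and P_0: "(\<lambda>j. 0) \<in> P"
    and P_diff: "p \<in> P \<Longrightarrow> p' \<in> P \<Longrightarrow> (\<lambda>j. p j - p' j) \<in> P"
    and P_scale: "p \<in> P \<Longrightarrow> (\<lambda>j. a * p j) \<in> P"
    and P_cancel: "(\<lambda>j. [:0, 1:] * p j) \<in> P \<Longrightarrow> p \<in> P"
    and rel: "f \<in> {x, y, x * y} \<Longrightarrow> v \<in> gdeg M (int D) \<Longrightarrow>
      (\<exists>j. fscale (f ^ j) v \<in> grel M) \<longleftrightarrow> E v \<in> P"
    and exist_x: "g \<in> G \<Longrightarrow> \<exists>D. \<exists>v\<in>gdeg M (int D). \<forall>j. E v j = g j"
    and exist_y: "g \<in> G \<Longrightarrow> \<exists>D. \<exists>v\<in>gdeg M (int D). \<forall>j. [:0, 1:] ^ m * E v j = [:0, 1:] ^ D * g j"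
    and glue: "v \<in> gdeg M (int r) \<Longrightarrow> w \<in> gdeg M (int r') \<Longrightarrow>
      (\<lambda>j. [:0, 1:] ^ m * E w j - [:0, 1:] ^ r' * E v j) \<in> P \<Longrightarrow> \<exists>g\<in>G. (\<lambda>j. E v j - g j) \<in> P"
    and G_add: "g \<in> G \<Longrightarrow> g' \<in> G \<Longrightarrow> (\<lambda>j. g j + g' j) \<in> G"
    and G_scale: "g \<in> G \<Longrightarrow> (\<lambda>j. [:c:] * g j) \<in> G"
begin

abbreviation u :: "'k poly" where "u \<equiv> [:0, 1:]"

lemma R_power: "R (s ^ k) = R s ^ k"
  by (induction k) (simp_all add: R_1 R_mult)

lemma gdeg_diff:
  assumes "v \<in> gdeg M d" "v' \<in> gdeg M d"
  shows "v - v' \<in> gdeg M d"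
proof -
  have eq: "v - v' = v + fscale (mconst (- 1)) v'"
    by (auto simp: fscale_def mconst_uminus)
  have "fscale (mconst (- 1)) v' \<in> gdeg M d" using gdeg_scale[OF homog_mconst assms(2)] by simp
  then show ?thesis unfolding eq by (rule gdeg_add[OF assms(1)])
qed

lemma E_diff: "E (v - v') j = E v j - E v' j"
proof -
  have eq: "v - v' = v + fscale (mconst (- 1)) v'"
    by (auto simp: fscale_def mconst_uminus)
  show ?thesis unfolding eq E_add E_scale R_mconst by simp
qed

lemma P_add: "p \<in> P \<Longrightarrow> p' \<in> P \<Longrightarrow> (\<lambda>j. p j + p' j) \<in> P"
  using P_diff[of p "\<lambda>j. - 1 * p' j"] P_scale[of p' "- 1"] by simp

lemma P_cancel_power: "(\<lambda>j. u ^ i * p j) \<in> P \<Longrightarrow> p \<in> P"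
proof (induction i)
  case (Suc i)
  then have "(\<lambda>j. u * (u ^ i * p j)) \<in> P" by (simp only: power_Suc mult.assoc)
  from Suc.IH[OF P_cancel[OF this]] show ?case .
qed simp

text \<open>The section with value \<open>B / A\<close> on the chart where the dehomogenized denominator is \<open>q\<close>.\<close>

definition cls :: "nat \<Rightarrow> 'k poly \<Rightarrow> 'k poly \<Rightarrow> ('v \<Rightarrow> 'k poly) \<Rightarrow> (('i \<Rightarrow> ('n, 'k) mpoly) \<times> nat) set" where
  "cls e q A B = {(v, r). v \<in> gdeg M (int (r * e)) \<and> (\<lambda>j. A * E v j - q ^ r * B j) \<in> P}"

lemma cls_cong:
  assumes P: "(\<lambda>j. B j - B' j) \<in> P"
  shows "cls e q A B = cls e q A B'"
proof -
  have "(\<lambda>j. A * E v j - q ^ r * B j) \<in> P \<longleftrightarrow> (\<lambda>j. A * E v j - q ^ r * B' j) \<in> P" for v r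
  proof
    assume "(\<lambda>j. A * E v j - q ^ r * B j) \<in> P"
    from P_add[OF this P_scale[OF P, of "q ^ r"]] show "(\<lambda>j. A * E v j - q ^ r * B' j) \<in> P"
      by (simp add: right_diff_distrib)
  next
    assume "(\<lambda>j. A * E v j - q ^ r * B' j) \<in> P"
    from P_diff[OF this P_scale[OF P, of "q ^ r"]] show "(\<lambda>j. A * E v j - q ^ r * B j) \<in> P"
      by (simp add: right_diff_distrib)
  qed
  then show ?thesis by (simp add: cls_def)
qed

text \<open>Two charts that cover the line and their overlap suffice; \<open>q\<close> is the
  dehomogenization of \<open>f\<close>. The degree \<open>1 + 1\<close> is left in the shape that
  \<open>sec_restrict\<close> produces.\<close>

definition chart :: "nat \<Rightarrow> ('n, 'k) mpoly \<Rightarrow> 'k poly \<Rightarrow> bool" where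
  "chart e f q \<longleftrightarrow> (e, f, q) \<in> {(1, x, 1), (1, y, u), (1 + 1, x * y, u)}"

lemma chart_x: "chart 1 x 1" and chart_y: "chart 1 y u" and chart_xy: "chart (1 + 1) (x * y) u"
  and chart_yx: "chart (1 + 1) (y * x) u"
  by (simp_all add: chart_def mult.commute)

lemma chart_R: "chart e f q \<Longrightarrow> R f = q"
  and chart_homog: "chart e f q \<Longrightarrow> f \<in> homog (int e)"
  and chart_power: "chart e f q \<Longrightarrow> \<exists>l. q = u ^ l"
  using homog_mult[OF x_homog y_homog]
  by (auto simp: chart_def R_mult R_x R_y x_homog y_homog intro: exI[of _ 0] exI[of _ 1])

lemma gdeg_power:
  assumes "g \<in> homog (int e')" "v \<in> gdeg M (int (r * e))"
  shows "fscale (g ^ k) v \<in> gdeg M (int (r * e + k * e'))"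
  using gdeg_scale[OF homog_power[OF assms(1)] assms(2), of k] by simp

text \<open>\<open>rel\<close> turns the existence of a clearing power of \<open>f\<close> into
  membership in \<open>P\<close>, so that fractions are from here on compared through their
  restrictions \<open>E v\<close>.\<close>

lemma frac_eq_iff:
  assumes "chart e f q"
  shows "((v, r), (v', r')) \<in> frac_eq M e f \<longleftrightarrow> v \<in> gdeg M (int (r * e)) \<and> v' \<in> gdeg M (int (r' * e)) \<and>
    (\<lambda>j. q ^ r' * E v j - q ^ r * E v' j) \<in> P"
proof -
  have f: "f \<in> {x, y, x * y}" using assms by (auto simp: chart_def)
  have deg: "fscale (f ^ r') v - fscale (f ^ r) v' \<in> gdeg M (int ((r + r') * e))"
    if "v \<in> gdeg M (int (r * e))" "v' \<in> gdeg M (int (r' * e))"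
  proof (rule gdeg_diff)
    show "fscale (f ^ r') v \<in> gdeg M (int ((r + r') * e))"
      using gdeg_power[OF chart_homog[OF assms] that(1), of r'] by (simp only: distrib_right)
    show "fscale (f ^ r) v' \<in> gdeg M (int ((r + r') * e))"
      using gdeg_power[OF chart_homog[OF assms] that(2), of r] by (simp only: distrib_right add.commute)
  qed
  have "E (fscale (f ^ r') v - fscale (f ^ r) v') = (\<lambda>j. q ^ r' * E v j - q ^ r * E v' j)"
    by (simp add: fun_eq_iff E_diff E_scale R_power chart_R[OF assms])
  with rel[OF f deg] show ?thesis
    by (auto simp: frac_eq_def fractions_def)
qed

text \<open>Either congruence follows from the other by cross-multiplication with the given
  representative, up to a factor \<open>u ^ (l * r)\<close> or \<open>u ^ i\<close> that
  \<open>P_cancel_power\<close> removes. This is the reason for allowing only powers of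
  \<open>u\<close> as denominators.\<close>

lemma frac_class_eq:
  assumes ch: "chart e f q" and vr: "(v, r) \<in> cls e q (u ^ i) B"
  shows "frac_class M e f v r = cls e q (u ^ i) B"
proof -
  obtain l where q: "q = u ^ l" using chart_power[OF ch] by blast
  let ?A = "u ^ i"
  have v: "v \<in> gdeg M (int (r * e))" and 1: "(\<lambda>j. ?A * E v j - q ^ r * B j) \<in> P"
    using vr by (auto simp: cls_def)
  have "(\<lambda>j. q ^ r' * E v j - q ^ r * E v' j) \<in> P \<longleftrightarrow> (\<lambda>j. ?A * E v' j - q ^ r' * B j) \<in> P" for v' r'
  proof
    assume 2: "(\<lambda>j. q ^ r' * E v j - q ^ r * E v' j) \<in> P"
    have "(\<lambda>j. q ^ r' * (?A * E v j - q ^ r * B j) - ?A * (q ^ r' * E v j - q ^ r * E v' j)) \<in> P"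
      by (intro P_diff P_scale 1 2)
    also have "(\<lambda>j. q ^ r' * (?A * E v j - q ^ r * B j) - ?A * (q ^ r' * E v j - q ^ r * E v' j))
        = (\<lambda>j. u ^ (l * r) * (?A * E v' j - q ^ r' * B j))"
      unfolding q power_mult by (rule ext) (simp only: algebra_simps)
    finally show "(\<lambda>j. ?A * E v' j - q ^ r' * B j) \<in> P" by (rule P_cancel_power)
  next
    assume 2: "(\<lambda>j. ?A * E v' j - q ^ r' * B j) \<in> P"
    have "(\<lambda>j. q ^ r' * (?A * E v j - q ^ r * B j) - q ^ r * (?A * E v' j - q ^ r' * B j)) \<in> P"
      by (intro P_diff P_scale 1 2)
    also have "(\<lambda>j. q ^ r' * (?A * E v j - q ^ r * B j) - q ^ r * (?A * E v' j - q ^ r' * B j))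
        = (\<lambda>j. ?A * (q ^ r' * E v j - q ^ r * E v' j))"
      by (rule ext) (simp only: algebra_simps)
    finally show "(\<lambda>j. q ^ r' * E v j - q ^ r * E v' j) \<in> P" by (rule P_cancel_power)
  qed
  then show ?thesis
    using v by (auto simp: frac_class_def frac_eq_iff[OF ch] cls_def)
qed

lemma cls_section:
  assumes "chart e f q" "cls e q (u ^ i) B \<noteq> {}"
  shows "cls e q (u ^ i) B \<in> sections M e f"
proof -
  obtain v r where vr: "(v, r) \<in> cls e q (u ^ i) B" using assms by auto
  then have "(v, r) \<in> fractions M e" by (auto simp: cls_def fractions_def)
  then show ?thesis
    unfolding sections_def using frac_class_eq[OF assms(1) vr]
    by (auto simp: frac_class_def quotient_def)
qed

lemma section_rep:
  assumes "chart e f q" "X \<in> sections M e f"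
  obtains v r where "v \<in> gdeg M (int (r * e))" "X = frac_class M e f v r" "(v, r) \<in> X"
proof -
  obtain v r where vr: "v \<in> gdeg M (int (r * e))" "X = frac_class M e f v r"
    using assms(2) by (auto simp: sections_def quotient_def fractions_def frac_class_def)
  moreover have "(v, r) \<in> X"
    using vr P_0 by (simp add: frac_class_def frac_eq_iff[OF assms(1)])
  ultimately show thesis using that by blast
qed

lemma sec_add_cls:
  assumes ch: "chart e f q" and "cls e q (u ^ i) B \<noteq> {}" "cls e q (u ^ i) B' \<noteq> {}"
  shows "sec_add M e f (cls e q (u ^ i) B) (cls e q (u ^ i) B') = cls e q (u ^ i) (\<lambda>j. B j + B' j)"
  unfolding sec_add_def
proof (intro UN_pair_const assms frac_class_eq[OF ch])
  fix v r v' r'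
  assume 1: "(v, r) \<in> cls e q (u ^ i) B" and 2: "(v', r') \<in> cls e q (u ^ i) B'"
  let ?w = "fscale (f ^ r') v + fscale (f ^ r) v'"
  have "(\<lambda>j. q ^ r' * (u ^ i * E v j - q ^ r * B j) + q ^ r * (u ^ i * E v' j - q ^ r' * B' j)) \<in> P"
    using 1 2 by (intro P_add P_scale) (auto simp: cls_def)
  also have "(\<lambda>j. q ^ r' * (u ^ i * E v j - q ^ r * B j) + q ^ r * (u ^ i * E v' j - q ^ r' * B' j))
      = (\<lambda>j. u ^ i * E ?w j - q ^ (r + r') * (B j + B' j))"
    by (simp only: E_add E_scale R_power chart_R[OF ch] power_add algebra_simps)
  finally have "(\<lambda>j. u ^ i * E ?w j - q ^ (r + r') * (B j + B' j)) \<in> P" .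
  moreover have "fscale (f ^ r') v \<in> gdeg M (int ((r + r') * e))"
    using gdeg_power[OF chart_homog[OF ch], of v r e r'] 1 by (simp add: cls_def distrib_right)
  moreover have "fscale (f ^ r) v' \<in> gdeg M (int ((r + r') * e))"
    using gdeg_power[OF chart_homog[OF ch], of v' r' e r] 2
    by (simp add: cls_def distrib_right add.commute)
  ultimately show "(?w, r + r') \<in> cls e q (u ^ i) (\<lambda>j. B j + B' j)"
    by (simp add: cls_def gdeg_add)
qed

text \<open>The condition on \<open>B'\<close> is the equation
  \<open>B' / u ^ i' = (R s / q ^ t) * (B / u ^ i)\<close> with denominators cleared; the surplus
  factor \<open>u ^ i\<close> is cancelled at the end.\<close>

lemma scale_mem_cls:
  assumes ch: "chart e f q" and s: "s \<in> homog (int (t * e))"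
    and B': "\<And>j. q ^ t * B' j * u ^ i = R s * B j * u ^ i'"
    and 1: "(v, r) \<in> cls e q (u ^ i) B"
  shows "(fscale s v, t + r) \<in> cls e q (u ^ i') B'"
proof -
  have "(\<lambda>j. (R s * u ^ i') * (u ^ i * E v j - q ^ r * B j)) \<in> P"
    using 1 by (intro P_scale) (auto simp: cls_def)
  also have "(\<lambda>j. (R s * u ^ i') * (u ^ i * E v j - q ^ r * B j))
      = (\<lambda>j. u ^ i * (u ^ i' * E (fscale s v) j - q ^ (t + r) * B' j))"
  proof
    fix j
    have "(R s * u ^ i') * (u ^ i * E v j - q ^ r * B j) =
        u ^ i * (u ^ i' * (R s * E v j)) - q ^ r * (R s * B j * u ^ i')"
      by (simp only: algebra_simps)
    also have "\<dots> = u ^ i * (u ^ i' * (R s * E v j)) - q ^ r * (q ^ t * B' j * u ^ i)"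
      by (simp only: B')
    also have "\<dots> = u ^ i * (u ^ i' * E (fscale s v) j - q ^ (t + r) * B' j)"
      by (simp only: E_scale power_add algebra_simps)
    finally show "(R s * u ^ i') * (u ^ i * E v j - q ^ r * B j) =
      u ^ i * (u ^ i' * E (fscale s v) j - q ^ (t + r) * B' j)" .
  qed
  finally have "(\<lambda>j. u ^ i' * E (fscale s v) j - q ^ (t + r) * B' j) \<in> P"
    by (rule P_cancel_power)
  moreover have "fscale s v \<in> gdeg M (int ((t + r) * e))"
    using gdeg_scale[OF s, of v "int (r * e)"] 1
    by (simp add: cls_def distrib_right add.commute)
  ultimately show ?thesis by (simp add: cls_def)
qed

lemma sec_scale_cls:
  assumes ch: "chart e f q" and "cls e q (u ^ i) B \<noteq> {}" and s: "s \<in> homog (int (t * e))"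
    and B': "\<And>j. q ^ t * B' j * u ^ i = R s * B j * u ^ i'"
  shows "sec_scale M e f s t (cls e q (u ^ i) B) = cls e q (u ^ i') B'"
  unfolding sec_scale_def
  by (intro UN_pair_const assms(2) frac_class_eq[OF ch] scale_mem_cls[OF ch s B'])

lemma restrict_mem_cls:
  assumes g: "g \<in> homog (int e')" "R g = q'" and 1: "(v, r) \<in> cls e q (u ^ i) B"
  shows "(fscale (g ^ r) v, r) \<in> cls (e + e') (q * q') (u ^ i) B"
proof -
  have "(\<lambda>j. q' ^ r * (u ^ i * E v j - q ^ r * B j)) \<in> P"
    using 1 by (intro P_scale) (auto simp: cls_def)
  also have "(\<lambda>j. q' ^ r * (u ^ i * E v j - q ^ r * B j)) =
      (\<lambda>j. u ^ i * E (fscale (g ^ r) v) j - (q * q') ^ r * B j)"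
    by (simp only: E_scale R_power g power_mult_distrib algebra_simps)
  finally have "(\<lambda>j. u ^ i * E (fscale (g ^ r) v) j - (q * q') ^ r * B j) \<in> P" .
  moreover have "fscale (g ^ r) v \<in> gdeg M (int (r * (e + e')))"
    using gdeg_power[OF g(1), of v r e r] 1 by (simp add: cls_def distrib_left)
  ultimately show ?thesis by (simp add: cls_def)
qed

lemma sec_restrict_cls:
  assumes ch: "chart (e + e') (f * g) (q * q')" and g: "g \<in> homog (int e')" "R g = q'"
    and "cls e q (u ^ i) B \<noteq> {}"
  shows "sec_restrict M e f e' g (cls e q (u ^ i) B) = cls (e + e') (q * q') (u ^ i) B"
  unfolding sec_restrict_def
  by (intro UN_pair_const assms(4) frac_class_eq[OF ch] restrict_mem_cls[OF g])

lemma section_cls: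
  assumes ch: "chart e f q" and "X \<in> sections M e f"
  obtains i B where "X = cls e q (u ^ i) B" "X \<noteq> {}"
proof -
  obtain v r where v: "v \<in> gdeg M (int (r * e))" "X = frac_class M e f v r" "(v, r) \<in> X"
    using section_rep[OF assms] .
  obtain l where q: "q = u ^ l" using chart_power[OF ch] by blast
  \<comment> \<open>The value of the fraction \<open>v / f ^ r\<close> is
    \<open>E v / q ^ r\<close>, and \<open>q ^ r\<close> is a power of \<open>u\<close>.\<close>
  have "(v, r) \<in> cls e q (u ^ (l * r)) (E v)"
    using v P_0 by (simp add: cls_def q power_mult)
  with frac_class_eq[OF ch this] v that[of "l * r" "E v"] show thesis by blast
qed

lemma sec_restrict_section:
  assumes "chart e f q" and ch: "chart (e + e') (f * g) (q * q')"
    and g: "g \<in> homog (int e')" "R g = q'" and "X \<in> sections M e f"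
  shows "sec_restrict M e f e' g X \<in> sections M (e + e') (f * g)"
proof -
  obtain i B where X: "X = cls e q (u ^ i) B" "X \<noteq> {}" using section_cls[OF assms(1,5)] .
  then have "cls (e + e') (q * q') (u ^ i) B \<noteq> {}" using restrict_mem_cls[OF g] by fast
  then show ?thesis
    unfolding X(1) sec_restrict_cls[OF ch g X(2)[unfolded X(1)]] by (rule cls_section[OF ch])
qed

lemma sec_scale_section:
  assumes ch: "chart e f q" and s: "s \<in> homog (int (t * e))" and "X \<in> sections M e f"
  shows "sec_scale M e f s t X \<in> sections M e f"
proof -
  obtain i B where X: "X = cls e q (u ^ i) B" "X \<noteq> {}" using section_cls[OF assms(1,3)] .
  obtain l where q: "q = u ^ l" using chart_power[OF ch] by blast
  have B': "q ^ t * (R s * B j) * u ^ i = R s * B j * u ^ (i + l * t)" for j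
    by (simp only: q power_add power_mult algebra_simps)
  have "cls e q (u ^ (i + l * t)) (\<lambda>j. R s * B j) \<noteq> {}"
    using scale_mem_cls[OF ch s B'] X by fast
  then show ?thesis
    unfolding X(1) sec_scale_cls[OF ch X(2)[unfolded X(1)] s B'] by (rule cls_section[OF ch])
qed

section \<open>Global sections of the twist as compatible pairs\<close>

definition secx :: "('v \<Rightarrow> 'k poly) \<Rightarrow> (('i \<Rightarrow> ('n, 'k) mpoly) \<times> nat) set" where
  "secx g = cls 1 1 (u ^ 0) g"

text \<open>Relative to the generator \<open>y ^ m\<close> of the twist instead of
  \<open>x ^ m\<close>, the section with value \<open>g\<close> has the value
  \<open>g / u ^ m\<close>.\<close>

definition secy :: "('v \<Rightarrow> 'k poly) \<Rightarrow> (('i \<Rightarrow> ('n, 'k) mpoly) \<times> nat) set" where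
  "secy g = cls 1 u (u ^ m) g"

text \<open>The two sections agree on the overlap after the twist by \<open>(x / y) ^ m = x ^ (2 * m) / (x * y) ^ m\<close>.\<close>

definition compatible where
  "compatible X Y \<longleftrightarrow> sec_scale M (1 + 1) (x * y) (x ^ (2 * m)) m (sec_restrict M 1 x 1 y X) =
     sec_restrict M 1 y 1 x Y"

lemma secx_nonempty: "g \<in> G \<Longrightarrow> secx g \<noteq> {}"
  using exist_x[of g] P_0 by (fastforce simp: secx_def cls_def)

lemma secy_nonempty: "g \<in> G \<Longrightarrow> secy g \<noteq> {}"
  using exist_y[of g] P_0 by (fastforce simp: secy_def cls_def)

lemma secx_section: "g \<in> G \<Longrightarrow> secx g \<in> sections M 1 x"
  unfolding secx_def using cls_section[OF chart_x] secx_nonempty[unfolded secx_def] by blast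

lemma secy_section: "g \<in> G \<Longrightarrow> secy g \<in> sections M 1 y"
  unfolding secy_def using cls_section[OF chart_y] secy_nonempty[unfolded secy_def] by blast

lemma secx_add: "g \<in> G \<Longrightarrow> g' \<in> G \<Longrightarrow> sec_add M 1 x (secx g) (secx g') = secx (\<lambda>j. g j + g' j)"
  unfolding secx_def using sec_add_cls[OF chart_x] secx_nonempty[unfolded secx_def] by blast

lemma secy_add: "g \<in> G \<Longrightarrow> g' \<in> G \<Longrightarrow> sec_add M 1 y (secy g) (secy g') = secy (\<lambda>j. g j + g' j)"
  unfolding secy_def using sec_add_cls[OF chart_y] secy_nonempty[unfolded secy_def] by blast

lemma secx_scale:
  assumes "g \<in> G"
  shows "sec_scale M 1 x (mconst c) 0 (secx g) = secx (\<lambda>j. [:c:] * g j)"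
  unfolding secx_def
  by (rule sec_scale_cls[OF chart_x secx_nonempty[OF assms, unfolded secx_def]])
    (simp_all add: R_mconst)

lemma secy_scale:
  assumes "g \<in> G"
  shows "sec_scale M 1 y (mconst c) 0 (secy g) = secy (\<lambda>j. [:c:] * g j)"
  unfolding secy_def
  by (rule sec_scale_cls[OF chart_y secy_nonempty[OF assms, unfolded secy_def]])
    (simp_all add: R_mconst)

lemma sec_restrict_x:
  assumes "cls 1 1 (u ^ 0) g \<noteq> {}"
  shows "sec_restrict M 1 x 1 y (cls 1 1 (u ^ 0) g) = cls (1 + 1) u (u ^ 0) g"
  using sec_restrict_cls[of 1 1 x y 1 u 0 g] chart_xy y_homog R_y assms by simp

lemma sec_restrict_y:
  assumes "cls 1 u (u ^ m) g \<noteq> {}"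
  shows "sec_restrict M 1 y 1 x (cls 1 u (u ^ m) g) = cls (1 + 1) u (u ^ m) g"
  using sec_restrict_cls[of 1 1 y x u 1 m g] chart_yx x_homog R_x assms by simp

lemma x_power_homog: "x ^ (2 * m) \<in> homog (int (m * (1 + 1)))"
  using homog_linear_power[OF x_homog, of "2 * m"] by (simp add: mult.commute)

text \<open>The twisting factor dehomogenizes to \<open>1 / u ^ m\<close>, so it only changes the
  denominator attached to \<open>g\<close>.\<close>

lemma twisted_overlap:
  assumes "cls 1 1 (u ^ 0) g \<noteq> {}"
  shows "sec_scale M (1 + 1) (x * y) (x ^ (2 * m)) m (sec_restrict M 1 x 1 y (cls 1 1 (u ^ 0) g)) =
    cls (1 + 1) u (u ^ m) g"
proof -
  obtain v r where "(v, r) \<in> cls 1 1 (u ^ 0) g" using assms by auto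
  then have v: "v \<in> gdeg M (int r)" and p: "(\<lambda>j. E v j - g j) \<in> P" by (auto simp: cls_def)
  have "(fscale (y ^ r) v, r) \<in> cls (1 + 1) u (u ^ 0) g"
    using gdeg_scale[OF homog_linear_power[OF y_homog] v, of r] P_scale[OF p, of "u ^ r"]
    by (simp add: cls_def E_scale R_power R_y right_diff_distrib)
  then have ne: "cls (1 + 1) u (u ^ 0) g \<noteq> {}" by blast
  show ?thesis unfolding sec_restrict_x[OF assms]
    by (rule sec_scale_cls[OF chart_xy ne x_power_homog])
      (simp add: R_power R_x mult.commute)
qed

lemma sec_compatible: "g \<in> G \<Longrightarrow> compatible (secx g) (secy g)"
  unfolding compatible_def
  using twisted_overlap[OF secx_nonempty[unfolded secx_def]]
    sec_restrict_y[OF secy_nonempty[unfolded secy_def]]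
  by (simp only: secx_def secy_def)

text \<open>Agreement on the overlap, read on representatives \<open>v / x ^ r\<close> and
  \<open>w / y ^ s\<close>, is precisely the congruence that \<open>glue\<close> asks for.\<close>

lemma compatible_glue:
  assumes X: "X \<in> sections M 1 x" and Y: "Y \<in> sections M 1 y" and XY: "compatible X Y"
  shows "\<exists>g\<in>G. X = secx g \<and> Y = secy g"
proof -
  obtain v r where v: "v \<in> gdeg M (int (r * 1))" "X = frac_class M 1 x v r" "(v, r) \<in> X"
    using section_rep[OF chart_x X] .
  obtain w s where w: "w \<in> gdeg M (int (s * 1))" "Y = frac_class M 1 y w s" "(w, s) \<in> Y"
    using section_rep[OF chart_y Y] .
  have "(v, r) \<in> cls 1 1 (u ^ 0) (E v)" using v P_0 by (simp add: cls_def)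
  then have X': "X = cls 1 1 (u ^ 0) (E v)" using frac_class_eq[OF chart_x] v(2) by blast
  have "(fscale (x ^ s) w, s) \<in> sec_restrict M 1 y 1 x Y"
  proof -
    have "fscale (x ^ s) w \<in> gdeg M (int (s * (1 + 1)))"
      using gdeg_scale[OF homog_linear_power[OF x_homog] w(1), of s] by simp
    then have "(fscale (x ^ s) w, s) \<in> frac_class M (1 + 1) (y * x) (fscale (x ^ s) w) s"
      unfolding frac_class_def Image_singleton_iff frac_eq_iff[OF chart_yx] using P_0 by simp
    then show ?thesis using w(3) by (auto simp: sec_restrict_def)
  qed
  then have "(fscale (x ^ s) w, s) \<in> cls (1 + 1) u (u ^ m) (E v)"
    using XY v(3) unfolding compatible_def X' by (subst (asm) twisted_overlap) auto
  then have p: "(\<lambda>j. u ^ m * E w j - u ^ s * E v j) \<in> P"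
    by (simp add: cls_def E_scale R_power R_x)
  then obtain g where g: "g \<in> G" "(\<lambda>j. E v j - g j) \<in> P"
    using glue[of v r w s] v(1) w(1) by auto
  have "(v, r) \<in> secx g" using v(1) g by (simp add: secx_def cls_def)
  then have "X = secx g" unfolding secx_def using frac_class_eq[OF chart_x] v(2) by blast
  \<comment> \<open>\<open>glue\<close> only relates \<open>g\<close> to \<open>v\<close>; adding
    the congruence on the overlap carries \<open>g\<close> over to \<open>w\<close>.\<close>
  moreover have "(\<lambda>j. (u ^ m * E w j - u ^ s * E v j) + u ^ s * (E v j - g j)) \<in> P"
    by (intro P_add P_scale p g)
  then have "(w, s) \<in> secy g" using w(1) by (simp add: secy_def cls_def algebra_simps)
  then have "Y = secy g" unfolding secy_def using frac_class_eq[OF chart_y] w(2) by blast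
  ultimately show ?thesis using g by blast
qed

lemma secx_eqD:
  assumes "g \<in> G" "secx g = secx g'"
  shows "(\<lambda>j. g j - g' j) \<in> P"
proof -
  obtain v r where vr: "(v, r) \<in> secx g" using secx_nonempty[OF assms(1)] by auto
  then have "(\<lambda>j. E v j - g j) \<in> P" "(\<lambda>j. E v j - g' j) \<in> P"
    using assms(2) by (auto simp: secx_def cls_def)
  from P_diff[OF this(2,1)] show ?thesis by (simp add: algebra_simps)
qed

end

locale charted_pair =
  M: charted x y R M E P G m + N: charted x y R N E' P' G' m
  for x y :: "('n::finite, 'k::field) mpoly" and R m
    and M :: "('i, ('n, 'k) mpoly) gmodule" and E :: "_ \<Rightarrow> 'v \<Rightarrow> _" and P G
    and N :: "('j, ('n, 'k) mpoly) gmodule" and E' :: "_ \<Rightarrow> 'w \<Rightarrow> _" and P' G'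
begin

text \<open>An isomorphism of sheaves commutes with restriction and with the twisting factor on the
  overlap, so it maps compatible pairs to compatible pairs, and these come from \<open>G\<close> and
  \<open>G'\<close>. \<open>T\<close> is a relation because a section determines its representative
  only modulo \<open>P\<close> or \<open>P'\<close>; the last three properties make it a linear
  bijection of the quotients.\<close>

lemma global_sections_correspondence:
  assumes "sheaves_isomorphic M N"
  obtains T where
    "\<And>g. g \<in> G \<Longrightarrow> \<exists>h\<in>G'. T g h"
    "\<And>h. h \<in> G' \<Longrightarrow> \<exists>g\<in>G. T g h"
    "\<And>g h g' h'. g \<in> G \<Longrightarrow> g' \<in> G \<Longrightarrow> h \<in> G' \<Longrightarrow> h' \<in> G' \<Longrightarrow> T g h \<Longrightarrow> T g' h' \<Longrightarrow>
       T (\<lambda>j. g j + g' j) (\<lambda>j. h j + h' j)"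
    "\<And>g h c. g \<in> G \<Longrightarrow> h \<in> G' \<Longrightarrow> T g h \<Longrightarrow> T (\<lambda>j. [:c:] * g j) (\<lambda>j. [:c:] * h j)"
    "\<And>g g' h. g \<in> G \<Longrightarrow> g' \<in> G \<Longrightarrow> h \<in> G' \<Longrightarrow> T g h \<Longrightarrow> T g' h \<Longrightarrow> (\<lambda>j. g j - g' j) \<in> P"
    "\<And>g h h'. g \<in> G \<Longrightarrow> h \<in> G' \<Longrightarrow> h' \<in> G' \<Longrightarrow> T g h \<Longrightarrow> T g h' \<Longrightarrow> (\<lambda>j. h j - h' j) \<in> P'"
    "\<And>g g' h. T g h \<Longrightarrow> (\<lambda>j. g j - g' j) \<in> P \<Longrightarrow> T g' h"
proof -
  obtain \<phi> where \<phi>: "\<forall>e>0. \<forall>f\<in>homog (int e).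
         bij_betw (\<phi> e f) (sections M e f) (sections N e f) \<and>
         (\<forall>X\<in>sections M e f. \<forall>Y\<in>sections M e f.
            \<phi> e f (sec_add M e f X Y) = sec_add N e f (\<phi> e f X) (\<phi> e f Y)) \<and>
         (\<forall>t. \<forall>s\<in>homog (int (t * e)). \<forall>X\<in>sections M e f.
            \<phi> e f (sec_scale M e f s t X) = sec_scale N e f s t (\<phi> e f X)) \<and>
         (\<forall>e'. \<forall>g\<in>homog (int e'). \<forall>X\<in>sections M e f.
            \<phi> (e + e') (f * g) (sec_restrict M e f e' g X) =
              sec_restrict N e f e' g (\<phi> e f X))"
    using assms unfolding sheaves_isomorphic_def by (rule exE)
  have bij: "bij_betw (\<phi> e f) (sections M e f) (sections N e f)"
    and add: "\<And>X Y. X \<in> sections M e f \<Longrightarrow> Y \<in> sections M e f \<Longrightarrow>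
      \<phi> e f (sec_add M e f X Y) = sec_add N e f (\<phi> e f X) (\<phi> e f Y)"
    and scale: "\<And>t s X. s \<in> homog (int (t * e)) \<Longrightarrow> X \<in> sections M e f \<Longrightarrow>
      \<phi> e f (sec_scale M e f s t X) = sec_scale N e f s t (\<phi> e f X)"
    and res: "\<And>e' g X. g \<in> homog (int e') \<Longrightarrow> X \<in> sections M e f \<Longrightarrow>
      \<phi> (e + e') (f * g) (sec_restrict M e f e' g X) = sec_restrict N e f e' g (\<phi> e f X)"
    if "M.chart e f q" for e f q
  proof -
    have "e > 0" "f \<in> homog (int e)" using that M.chart_homog[OF that] by (auto simp: M.chart_def)
    note c = \<phi>[THEN spec, THEN mp, OF this(1), THEN bspec, OF this(2)]
    note c' = c[THEN conjunct2] and c'' = c[THEN conjunct2, THEN conjunct2]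
    show "bij_betw (\<phi> e f) (sections M e f) (sections N e f)"
      by (rule c[THEN conjunct1])
    show "\<phi> e f (sec_add M e f X Y) = sec_add N e f (\<phi> e f X) (\<phi> e f Y)"
      if "X \<in> sections M e f" "Y \<in> sections M e f" for X Y
      by (rule c'[THEN conjunct1, rule_format, OF that])
    show "\<phi> e f (sec_scale M e f s t X) = sec_scale N e f s t (\<phi> e f X)"
      if "s \<in> homog (int (t * e))" "X \<in> sections M e f" for s t X
      by (rule c''[THEN conjunct1, rule_format, OF that])
    show "\<phi> (e + e') (f * g) (sec_restrict M e f e' g X) = sec_restrict N e f e' g (\<phi> e f X)"
      if "g \<in> homog (int e')" "X \<in> sections M e f" for e' g X
      by (rule c''[THEN conjunct2, rule_format, OF that])
  qed
  note cx = M.chart_x and cy = M.chart_y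
  have homog1: "x \<in> homog (int 1)" "y \<in> homog (int 1)" using M.x_homog M.y_homog by simp_all
  have const: "mconst c \<in> homog (int (0 * 1))" for c by simp
  have comp: "M.compatible X Y \<longleftrightarrow> N.compatible (\<phi> 1 x X) (\<phi> 1 y Y)"
    if X: "X \<in> sections M 1 x" and Y: "Y \<in> sections M 1 y" for X Y
  proof -
    let ?s = "x ^ (2 * m)"
    let ?A = "sec_scale M (1 + 1) (x * y) ?s m (sec_restrict M 1 x 1 y X)"
    let ?B = "sec_restrict M 1 y 1 x Y"
    have sX: "sec_restrict M 1 x 1 y X \<in> sections M (1 + 1) (x * y)"
      by (rule M.sec_restrict_section[OF cx _ homog1(2) M.R_y X]) (use M.chart_xy in simp)
    then have sA: "?A \<in> sections M (1 + 1) (x * y)"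
      by (rule M.sec_scale_section[OF M.chart_xy M.x_power_homog])
    have sB: "?B \<in> sections M (1 + 1) (x * y)"
      using M.sec_restrict_section[OF cy _ homog1(1) M.R_x Y] M.chart_yx by (simp add: mult.commute)
    have A: "\<phi> (1 + 1) (x * y) ?A =
        sec_scale N (1 + 1) (x * y) ?s m (sec_restrict N 1 x 1 y (\<phi> 1 x X))"
      by (simp only: scale[OF M.chart_xy M.x_power_homog sX] res[OF cx homog1(2) X])
    have B: "\<phi> (1 + 1) (x * y) ?B = sec_restrict N 1 y 1 x (\<phi> 1 y Y)"
      using res[OF cy homog1(1) Y] by (simp only: mult.commute)
    have "?A = ?B \<longleftrightarrow> \<phi> (1 + 1) (x * y) ?A = \<phi> (1 + 1) (x * y) ?B"
      using bij[OF M.chart_xy] sA sB by (auto simp: bij_betw_def inj_on_def)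
    then show ?thesis by (simp only: M.compatible_def N.compatible_def A B)
  qed
  note bx = bij[OF cx] and by' = bij[OF cy]
  define T where "T g h \<longleftrightarrow> \<phi> 1 x (M.secx g) = N.secx h \<and> \<phi> 1 y (M.secy g) = N.secy h" for g h
  show thesis
  proof
    fix g assume g: "g \<in> G"
    note s = M.secx_section[OF g] M.secy_section[OF g]
    have "\<phi> 1 x (M.secx g) \<in> sections N 1 x" "\<phi> 1 y (M.secy g) \<in> sections N 1 y"
      using s bx by' by (auto simp: bij_betw_def)
    moreover have "N.compatible (\<phi> 1 x (M.secx g)) (\<phi> 1 y (M.secy g))"
      using comp[OF s] M.sec_compatible[OF g] by blast
    ultimately show "\<exists>h\<in>G'. T g h" unfolding T_def by (rule N.compatible_glue)
  next
    fix h assume h: "h \<in> G'"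
    note s = N.secx_section[OF h] N.secy_section[OF h]
    obtain X where X: "X \<in> sections M 1 x" "\<phi> 1 x X = N.secx h"
      using s(1) bij_betw_imp_surj_on[OF bx] by (metis imageE)
    obtain Y where Y: "Y \<in> sections M 1 y" "\<phi> 1 y Y = N.secy h"
      using s(2) bij_betw_imp_surj_on[OF by'] by (metis imageE)
    have "M.compatible X Y" using comp[OF X(1) Y(1)] X Y N.sec_compatible[OF h] by simp
    from M.compatible_glue[OF X(1) Y(1) this] show "\<exists>g\<in>G. T g h"
      unfolding T_def using X Y by blast
  next
    fix g h g' h' assume g: "g \<in> G" "g' \<in> G" and h: "h \<in> G'" "h' \<in> G'" and T: "T g h" "T g' h'"
    show "T (\<lambda>j. g j + g' j) (\<lambda>j. h j + h' j)"
      using T add[OF cx M.secx_section[OF g(1)] M.secx_section[OF g(2)]]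
        add[OF cy M.secy_section[OF g(1)] M.secy_section[OF g(2)]]
      unfolding T_def M.secx_add[OF g] M.secy_add[OF g]
      by (simp only: N.secx_add[OF h] N.secy_add[OF h])
  next
    fix g h c assume g: "g \<in> G" and h: "h \<in> G'" and T: "T g h"
    show "T (\<lambda>j. [:c:] * g j) (\<lambda>j. [:c:] * h j)"
      using T scale[OF cx const M.secx_section[OF g], of c] scale[OF cy const M.secy_section[OF g], of c]
      unfolding T_def M.secx_scale[OF g] M.secy_scale[OF g] by (simp only: N.secx_scale[OF h] N.secy_scale[OF h])
  next
    fix g g' h assume g: "g \<in> G" "g' \<in> G" and h: "h \<in> G'" and T: "T g h" "T g' h"
    then have "\<phi> 1 x (M.secx g) = \<phi> 1 x (M.secx g')" by (simp add: T_def)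
    then have "M.secx g = M.secx g'"
      using bx M.secx_section g by (auto simp: bij_betw_def inj_on_def)
    then show "(\<lambda>j. g j - g' j) \<in> P" by (rule M.secx_eqD[OF g(1)])
  next
    fix g h h' assume h: "h \<in> G'" "h' \<in> G'" and T: "T g h" "T g h'"
    then have "N.secx h = N.secx h'" by (simp add: T_def)
    then show "(\<lambda>j. h j - h' j) \<in> P'" by (rule N.secx_eqD[OF h(1)])
  next
    fix g g' h assume T: "T g h" and P: "(\<lambda>j. g j - g' j) \<in> P"
    show "T g' h" using T by (simp only: T_def M.secx_def M.secy_def M.cls_cong[OF P])
  qed
qed

end

section \<open>Restriction to a line\<close>

lemma fmod_span_subsetI:
  assumes "\<And>v. v \<in> S \<Longrightarrow> v \<in> W" "fmod.subspace W"
  shows "fmod.span S \<subseteq> W"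
  using assms by (intro fmod.span_minimal) auto

text \<open>The vectors \<open>a\<close> and \<open>b\<close> are dual to the frame: they provide
  homogeneous coordinates on the line and also a complement of its annihilator.\<close>

locale line_frame =
  fixes y1 y2 a b :: "'k::field ^ 'n::finite"
  assumes inf: "infinite (UNIV :: 'k set)"
    and a1: "dot a y1 = 1" and a2: "dot a y2 = 0" and b1: "dot b y1 = 0" and b2: "dot b y2 = 1"
begin

definition L :: "('k ^ 'n) set" where "L = {s *s y1 + t *s y2 | s t. True}"

abbreviation IL where "IL \<equiv> vanishing_ideal L"

definition \<rho> :: "('n, 'k) mpoly \<Rightarrow> 'k poly" where
  "\<rho> = msubst (\<lambda>c. [:c:]) (\<lambda>i. [:y1 $ i, y2 $ i:])"

definition x where "x = lform a"
definition y where "y = lform b"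

lemma \<rho>_simps: "\<rho> (f + g) = \<rho> f + \<rho> g" "\<rho> (f * g) = \<rho> f * \<rho> g" "\<rho> (f - g) = \<rho> f - \<rho> g"
  "\<rho> (- f) = - \<rho> f" "\<rho> (f ^ k) = \<rho> f ^ k" "\<rho> (\<Sum>i\<in>A. h i) = (\<Sum>i\<in>A. \<rho> (h i))"
  "\<rho> (\<Prod>i\<in>A. h i) = (\<Prod>i\<in>A. \<rho> (h i))" "\<rho> (mconst c) = [:c:]" "\<rho> 0 = 0" "\<rho> 1 = 1"
  "\<rho> (mvar i) = [:y1 $ i, y2 $ i:]"
  by (simp_all add: \<rho>_def upol.msubst_simps)

lemma sum_pCons: "(\<Sum>i\<in>A. [:f i, g i:]) = [:\<Sum>i\<in>A. f i, \<Sum>i\<in>A. g i:]"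
  by (induction A rule: infinite_finite_induct) auto

lemma \<rho>_lform: "\<rho> (lform c) = [:dot c y1, dot c y2:]"
  by (simp add: lform_def \<rho>_simps dot_def sum_pCons mult.commute)

lemma \<rho>_x [simp]: "\<rho> x = 1" and \<rho>_y [simp]: "\<rho> y = [:0, 1:]"
  by (simp_all add: x_def y_def \<rho>_lform a1 a2 b1 b2 one_pCons)

lemma x_homog: "x \<in> homog 1" and y_homog: "y \<in> homog 1"
  by (simp_all add: x_def y_def)

lemma poly_\<rho>: "poly (\<rho> f) t = peval f (\<lambda>i. (y1 + t *s y2) $ i)"
  by (simp add: \<rho>_def poly_msubst_pCons)

lemma degree_\<rho>: "f \<in> homog (int d) \<Longrightarrow> degree (\<rho> f) \<le> d"
  unfolding \<rho>_def by (rule degree_msubst) simp_all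

lemma L_memI: "s *s y1 + t *s y2 \<in> L"
  by (auto simp: L_def)

lemma \<rho>_eq_0:
  assumes "f \<in> IL"
  shows "\<rho> f = 0"
proof (rule poly_eq_0_infinite[OF inf])
  fix t
  have "y1 + t *s y2 \<in> L" using L_memI[of 1 t] by simp
  then have "peval f (\<lambda>i. (y1 + t *s y2) $ i) = 0"
    using assms unfolding vanishing_ideal_def by blast
  then show "poly (\<rho> f) t = 0" by (simp only: poly_\<rho>)
qed

lemma L_coords: "z \<in> L \<Longrightarrow> z = dot a z *s y1 + dot b z *s y2"
  by (auto simp: L_def dot_add dot_scale a1 a2 b1 b2)

lemma L_closed: "z \<in> L \<Longrightarrow> w \<in> L \<Longrightarrow> z + t *s (w - z) \<in> L"
proof -
  assume "z \<in> L" "w \<in> L"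
  then obtain p q p' q' where "z = p *s y1 + q *s y2" "w = p' *s y1 + q' *s y2" by (auto simp: L_def)
  then have "z + t *s (w - z) = (p + t * (p' - p)) *s y1 + (q + t * (q' - q)) *s y2"
    by (simp add: vec_eq_iff algebra_simps)
  then show ?thesis using L_memI by metis
qed

lemma IL_ideal: "ideal.subspace IL"
  by (auto simp: ideal.subspace_def vanishing_ideal_def peval_simps)

lemmas IL_0 = ideal.subspace_0[OF IL_ideal]
  and IL_scale = ideal.subspace_scale[OF IL_ideal]

text \<open>The line is irreducible: if \<open>f\<close> were nonzero somewhere on it, the segment
  towards \<open>w\<close> would contain a point where neither \<open>f\<close> nor \<open>g\<close>
  vanishes.\<close>

lemma IL_cancel:
  assumes w: "w \<in> L" "peval g (\<lambda>i. w $ i) \<noteq> 0"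
    and fg: "\<And>z. z \<in> L \<Longrightarrow> peval g (\<lambda>i. z $ i) \<noteq> 0 \<Longrightarrow> peval f (\<lambda>i. z $ i) = 0"
  shows "f \<in> IL"
proof -
  have False if z: "z \<in> L" and fz: "peval f (\<lambda>i. z $ i) \<noteq> 0" for z
  proof -
    obtain t where t: "peval f (\<lambda>i. z $ i + t * (w $ i - z $ i)) \<noteq> 0"
      "peval g (\<lambda>i. z $ i + t * (w $ i - z $ i)) \<noteq> 0"
      using nonzero_on_line[OF inf fz w(2)] .
    moreover have "(\<lambda>i. z $ i + t * (w $ i - z $ i)) = (\<lambda>i. (z + t *s (w - z)) $ i)"
      by (simp add: right_diff_distrib)
    ultimately show False using fg[OF L_closed[OF z w(1), of t]] by metis
  qed
  then show ?thesis by (auto simp: vanishing_ideal_def)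
qed

text \<open>\<open>\<rho>\<close> sees only the points of the line with \<open>x = 1\<close>;
  homogeneity extends the vanishing to all points with \<open>x\<close> nonzero, and
  \<open>IL_cancel\<close> to the rest. The polynomial \<open>x - 1\<close> shows what goes wrong
  without homogeneity.\<close>

lemma IL_I:
  assumes f: "f \<in> homog d" and "\<rho> f = 0"
  shows "f \<in> IL"
proof (cases "d < 0")
  case True
  then have "f = 0" using homog_negative f by blast
  then show ?thesis using IL_0 by simp
next
  case False
  then obtain D where d: "d = int D" by (metis nonneg_int_cases not_less)
  show ?thesis
  proof (rule IL_cancel[of y1 x])
    show "y1 \<in> L" using L_memI[of 1 0] by simp
    show "peval x (\<lambda>i. y1 $ i) \<noteq> 0" by (simp add: x_def a1)
    fix z assume z: "z \<in> L" and "peval x (\<lambda>i. z $ i) \<noteq> 0"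
    then have s: "dot a z \<noteq> 0" by (simp add: x_def)
    define w where "w = y1 + (dot b z / dot a z) *s y2"
    have "z = dot a z *s w"
      by (subst L_coords[OF z]) (use s in \<open>simp add: w_def vec_eq_iff algebra_simps\<close>)
    then have "(\<lambda>i. z $ i) = (\<lambda>i. dot a z * w $ i)" by (metis vector_smult_component)
    then have "peval f (\<lambda>i. z $ i) = dot a z ^ D * peval f (\<lambda>i. w $ i)"
      using peval_homog_scaled[OF f[unfolded d]] by simp
    then show "peval f (\<lambda>i. z $ i) = 0" using poly_\<rho>[of f "dot b z / dot a z"] assms(2) by (simp add: w_def)
  qed
qed

text \<open>Global sections of the sum of the line bundles of degrees \<open>m - c ! j\<close>,
  dehomogenized. Zero is listed separately because its degree is 0 while the bound may be
  negative.\<close>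

abbreviation bounded_tuples :: "int list \<Rightarrow> nat \<Rightarrow> (nat \<Rightarrow> 'k poly) set" where
  "bounded_tuples c m \<equiv>
     {h. (\<forall>j<length c. h j = 0 \<or> int (degree (h j)) \<le> int m - c ! j) \<and> (\<forall>j\<ge>length c. h j = 0)}"

text \<open>The module is free, so a homogeneous tuple is a relation exactly when all its entries
  restrict to zero; \<open>P\<close> therefore contains only zero.\<close>

lemma twisted_charted:
  assumes a: "\<And>j. j < length c \<Longrightarrow> 0 \<le> c ! j"
  shows "charted x y \<rho> (gmod_restrict IL (twisted_free c)) (\<lambda>v j. \<rho> (v j)) {\<lambda>j. 0}
    (bounded_tuples c m) m"
proof
  let ?N = "gmod_restrict IL (twisted_free c)"
  have gdeg: "gdeg ?N d = {v. (\<forall>j<length c. v j \<in> homog (d - c ! j)) \<and> (\<forall>j\<ge>length c. v j = 0)}" for d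
    by (simp add: gmod_restrict_def twisted_free_def)
  have grel: "grel ?N = fmod.span ({0} \<union> {fscale s v | s v. s \<in> IL \<and> (\<forall>j\<ge>length c. v j = 0)})"
    by (simp add: gmod_restrict_def twisted_free_def)
  have coord: "\<rho> (v j) = 0" if "v \<in> grel ?N" for v j
  proof -
    have "fmod.span ({0} \<union> {fscale s v | s v. s \<in> IL \<and> (\<forall>j\<ge>length c. v j = 0)}) \<subseteq> {v. \<forall>j. \<rho> (v j) = 0}"
      by (rule fmod_span_subsetI)
        (auto simp: fscale_def \<rho>_simps \<rho>_eq_0 fmod.subspace_def)
    with that show ?thesis unfolding grel by blast
  qed
  show "\<rho> 1 = 1" "\<And>s t. \<rho> (s * t) = \<rho> s * \<rho> t" "\<And>c. \<rho> (mconst c) = [:c:]" "\<rho> x = 1" "\<rho> y = [:0, 1:]"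
    "x \<in> homog 1" "y \<in> homog 1"
    by (simp_all add: \<rho>_simps x_homog y_homog)
  show "v + v' \<in> gdeg ?N d" if "v \<in> gdeg ?N d" "v' \<in> gdeg ?N d" for v v' d
    using that by (auto simp: gdeg homog_add)
  show "fscale s v \<in> gdeg ?N (d + e)" if "s \<in> homog e" "v \<in> gdeg ?N d" for s e v d
  proof -
    have "s * v j \<in> homog (d + e - c ! j)" if "j < length c" for j
      using homog_mult[OF \<open>s \<in> homog e\<close>, of "v j" "d - c ! j"] that \<open>v \<in> gdeg ?N d\<close>
      by (simp add: gdeg algebra_simps)
    then show ?thesis using that by (auto simp: gdeg fscale_def)
  qed
  show "\<rho> ((v + v') j) = \<rho> (v j) + \<rho> (v' j)" "\<rho> (fscale s v j) = \<rho> s * \<rho> (v j)" for v v' s and j :: nat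
    by (simp_all add: fscale_def \<rho>_simps)
  show "(\<exists>j. fscale (f ^ j) v \<in> grel ?N) \<longleftrightarrow> (\<lambda>j. \<rho> (v j)) \<in> {\<lambda>j. 0}"
    if f: "f \<in> {x, y, x * y}" and v: "v \<in> gdeg ?N (int D)" for f v D
  proof
    assume "\<exists>j. fscale (f ^ j) v \<in> grel ?N"
    then obtain k where k: "fscale (f ^ k) v \<in> grel ?N" by blast
    have "\<rho> f \<noteq> 0" using f by (auto simp: \<rho>_simps)
    then have "\<rho> (v j) = 0" for j using coord[OF k, of j] by (simp add: fscale_def \<rho>_simps)
    then show "(\<lambda>j. \<rho> (v j)) \<in> {\<lambda>j. 0}" by simp
  next
    assume "(\<lambda>j. \<rho> (v j)) \<in> {\<lambda>j. 0}"
    then have "\<rho> (v j) = 0" for j by (simp add: fun_eq_iff)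
    then have IL: "v j \<in> IL" for j
      using v IL_I IL_0 by (cases "j < length c") (auto simp: gdeg)
    \<comment> \<open>The unit vectors exhibit \<open>v\<close> as a combination of module elements
      with coefficients in \<open>IL\<close>; no power of \<open>f\<close> is needed.\<close>
    define \<delta> :: "nat \<Rightarrow> nat \<Rightarrow> ('n, 'k) mpoly" where "\<delta> j i = (if i = j then 1 else 0)" for j i
    have "v = (\<Sum>j<length c. fscale (v j) (\<delta> j))"
    proof
      fix i
      have "(\<Sum>j\<in>A. g j) i = (\<Sum>j\<in>A. g j i)" for A and g :: "nat \<Rightarrow> nat \<Rightarrow> ('n, 'k) mpoly"
        by (induction A rule: infinite_finite_induct) auto
      then show "v i = (\<Sum>j<length c. fscale (v j) (\<delta> j)) i"
        using v by (auto simp: gdeg fscale_def \<delta>_def if_distrib cong: if_cong)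
    qed
    also have "\<dots> \<in> grel ?N" unfolding grel
    proof (intro fmod.span_sum fmod.span_base UnI2 CollectI exI conjI)
      fix j assume "j \<in> {..<length c}"
      then show "\<forall>i\<ge>length c. \<delta> j i = 0" by (auto simp: \<delta>_def)
    qed (rule refl IL)+
    finally have "fscale (f ^ 0) v \<in> grel ?N" by (simp add: fscale_def)
    then show "\<exists>j. fscale (f ^ j) v \<in> grel ?N" by blast
  qed
  have lift: "\<exists>v\<in>gdeg ?N (int m). \<forall>j. \<rho> (v j) = h j"
    if h: "h \<in> bounded_tuples c m" for h
  proof -
    define v where "v j = (if h j = 0 then 0 else bform (nat (int m - c ! j)) (h j) x y)" for j
    have *: "v j \<in> homog (int m - c ! j) \<and> \<rho> (v j) = h j" if "j < length c" "h j \<noteq> 0" for j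
    proof -
      have le: "int (degree (h j)) \<le> int m - c ! j" using h that by blast
      then have "bform (nat (int m - c ! j)) (h j) x y \<in> homog (int m - c ! j)"
        using bform_homog[OF x_homog y_homog, of "nat (int m - c ! j)" "h j"] by simp
      moreover have "\<rho> (bform (nat (int m - c ! j)) (h j) x y) = h j"
        unfolding \<rho>_def by (rule msubst_bform) (use le \<rho>_x \<rho>_y in \<open>auto simp: \<rho>_def\<close>)
      ultimately show ?thesis using that by (simp add: v_def)
    qed
    have "v \<in> gdeg ?N (int m)"
      unfolding gdeg using * h by (auto simp: v_def)
    moreover have "\<rho> (v j) = h j" for j
    proof (cases "h j = 0")
      case False
      then have "j < length c" using h by (metis (mono_tags, lifting) mem_Collect_eq not_less)
      with * False show ?thesis by blast
    qed (simp add: v_def \<rho>_simps)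
    ultimately show ?thesis by blast
  qed
  show "\<exists>D. \<exists>v\<in>gdeg ?N (int D). \<forall>j. \<rho> (v j) = h j"
    if h: "h \<in> bounded_tuples c m" for h
    using lift[OF h] by blast
  show "\<exists>D. \<exists>v\<in>gdeg ?N (int D). \<forall>j. [:0, 1:] ^ m * \<rho> (v j) = [:0, 1:] ^ D * h j"
    if h: "h \<in> bounded_tuples c m" for h
    using lift[OF h] by metis
  show "\<exists>g\<in>bounded_tuples c m.
      (\<lambda>j. \<rho> (v j) - g j) \<in> {\<lambda>j. 0}"
    if v: "v \<in> gdeg ?N (int r)" and w: "w \<in> gdeg ?N (int r')"
      and eq: "(\<lambda>j. [:0, 1:] ^ m * \<rho> (w j) - [:0, 1:] ^ r' * \<rho> (v j)) \<in> {\<lambda>j. 0}" for v w r r'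
  proof (intro bexI CollectI conjI allI impI)
    show "(\<lambda>j. \<rho> (v j) - \<rho> (v j)) \<in> {\<lambda>j. 0}" by simp
    show "\<rho> (v j) = 0" if "length c \<le> j" for j using v that by (simp add: gdeg \<rho>_simps)
    show "\<rho> (v j) = 0 \<or> int (degree (\<rho> (v j))) \<le> int m - c ! j" if j: "j < length c" for j
    proof (rule disjCI)
      assume ne: "\<not> int (degree (\<rho> (v j))) \<le> int m - c ! j"
      show "\<rho> (v j) = 0"
      proof (rule ccontr)
        assume v0: "\<rho> (v j) \<noteq> 0"
        have e: "[:0, 1:] ^ m * \<rho> (w j) = [:0, 1:] ^ r' * \<rho> (v j)"
          using eq by (simp add: fun_eq_iff)
        with v0 have w0: "\<rho> (w j) \<noteq> 0" by auto
        have wj: "w j \<in> homog (int r' - c ! j)" using w j by (simp add: gdeg)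
        have nn: "int r' - c ! j \<ge> 0"
          using homog_negative[OF _ wj] w0 by (force simp: \<rho>_simps)
        then have "degree (\<rho> (w j)) \<le> nat (int r' - c ! j)" using wj by (intro degree_\<rho>) simp
        \<comment> \<open>Compare degrees in \<open>e\<close>: \<open>\<rho> (w j)\<close> has
          degree at most \<open>r' - c ! j\<close>, and cancelling \<open>r'\<close> would bound the
          degree of \<open>\<rho> (v j)\<close> by \<open>m - c ! j\<close>.\<close>
        moreover have "m + degree (\<rho> (w j)) = degree ([:0, 1:] ^ m * \<rho> (w j))"
          using w0 by (simp add: degree_mult_eq degree_linear_power)
        then have "m + degree (\<rho> (w j)) = r' + degree (\<rho> (v j))"
          unfolding e using v0 by (simp add: degree_mult_eq degree_linear_power)
        ultimately show False using ne nn by linarith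
      qed
    qed
  qed
  show "(\<lambda>j. g j + g' j) \<in> bounded_tuples c m"
    if "g \<in> bounded_tuples c m" "g' \<in> bounded_tuples c m" for g g'
  proof (intro CollectI conjI allI impI)
    fix j assume "j < length c"
    with that have "g j = 0 \<or> int (degree (g j)) \<le> int m - c ! j" "g' j = 0 \<or> int (degree (g' j)) \<le> int m - c ! j"
      by blast+
    moreover have "degree (g j + g' j) \<le> max (degree (g j)) (degree (g' j))" by (rule degree_add_le_max)
    ultimately show "g j + g' j = 0 \<or> int (degree (g j + g' j)) \<le> int m - c ! j"
      by auto
  qed (use that in auto)
qed (auto simp: fun_eq_iff degree_smult_le)

end

section \<open>Logarithmic derivations along a general line\<close>

text \<open>\<open>y2\<close> lies on no hyperplane, so each hyperplane meets the line at a finite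
  parameter \<open>meet c\<close> of the chart where \<open>x\<close> is nonzero;
  \<open>separated\<close> makes these parameters distinct.\<close>

locale general_line = line_frame y1 y2 a b for y1 y2 a b :: "'k::field ^ 'n::finite" +
  fixes C :: "('k ^ 'n) set"
  assumes finite_C: "finite C" and y2_C: "\<And>c. c \<in> C \<Longrightarrow> dot c y2 \<noteq> 0"
    and C_nonempty: "C \<noteq> {}"
    and separated: "\<And>c c'. c \<in> C \<Longrightarrow> c' \<in> C \<Longrightarrow> c \<noteq> c' \<Longrightarrow> dot c y1 * dot c' y2 \<noteq> dot c' y1 * dot c y2"
begin

abbreviation hyperplane :: "'k ^ 'n \<Rightarrow> ('k ^ 'n) set" where
  "hyperplane c \<equiv> {y. dot c y = 0}"

abbreviation D where "D \<equiv> log_derivations (hyperplane ` C)"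

definition meet :: "'k ^ 'n \<Rightarrow> 'k" where "meet c = - dot c y1 / dot c y2"

definition transversal :: "'k ^ 'n \<Rightarrow> 'k ^ 'n" where "transversal c = (1 / dot c y2) *s y2"

definition contract :: "'k ^ 'n \<Rightarrow> ('n \<Rightarrow> ('n, 'k) mpoly) \<Rightarrow> ('n, 'k) mpoly" where
  "contract c G = (\<Sum>i\<in>UNIV. mconst (c $ i) * G i)"

definition tangential :: "('n \<Rightarrow> 'k poly) \<Rightarrow> bool" where
  "tangential g \<longleftrightarrow> (\<forall>c\<in>C. poly (\<Sum>i\<in>UNIV. smult (c $ i) (g i)) (meet c) = 0)"

text \<open>Multiplying a vector field by this product makes it tangent to every hyperplane except
  possibly that of \<open>c\<close>.\<close>

definition Q :: "'k ^ 'n \<Rightarrow> ('n, 'k) mpoly" where "Q c = (\<Prod>c'\<in>C - {c}. lform c')"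

text \<open>The common degree of the \<open>Q c\<close>. There are \<open>K + 1\<close> intersection
  points, just enough to interpolate polynomials of degree at most \<open>K\<close>.\<close>

definition K :: nat where "K = card C - 1"

lemma C_nonzero: "c \<in> C \<Longrightarrow> c \<noteq> 0"
  using y2_C by force

lemma dot_trans: "c \<in> C \<Longrightarrow> dot c (transversal c) = 1"
  using y2_C by (simp add: transversal_def dot_scale)

lemma Q_homog: "c \<in> C \<Longrightarrow> Q c \<in> homog (int K)"
  using homog_prod[of "C - {c}" lform] finite_C by (simp add: Q_def K_def)

lemma Q_vanishes: "c \<in> C \<Longrightarrow> c' \<in> C \<Longrightarrow> c' \<noteq> c \<Longrightarrow> dot c' z = 0 \<Longrightarrow> peval (Q c) (\<lambda>i. z $ i) = 0"
  using finite_C by (auto simp: Q_def peval_simps prod_zero_iff intro!: bexI[of _ c'])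

lemma vfield_D_iff:
  "vfield G \<in> D \<longleftrightarrow> (\<forall>c\<in>C. contract c G \<in> vanishing_ideal (hyperplane c))"
  unfolding contract_def by (rule vfield_log_derivation_iff[OF inf C_nonzero])

lemma D_vfield: "v \<in> D \<Longrightarrow> v = vfield (\<lambda>i. v (mvar i))"
  by (rule derivation_eq_vfield) (simp add: log_derivations_def)

lemma contract_add: "contract c (\<lambda>i. G i + G' i) = contract c G + contract c G'"
  and contract_diff: "contract c (\<lambda>i. G i - G' i) = contract c G - contract c G'"
  and contract_mult: "contract c (\<lambda>i. s * G i) = s * contract c G"
  by (simp_all add: contract_def distrib_left right_diff_distrib sum.distrib sum_subtractf
      sum_distrib_left mult.left_commute)

lemma contract_mconst: "contract c (\<lambda>i. mconst (e $ i)) = mconst (dot c e)"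
  by (simp add: contract_def dot_def mconst_sum mconst_mult)

lemma contract_sum: "contract c (\<lambda>i. \<Sum>j\<in>A. G j i) = (\<Sum>j\<in>A. contract c (G j))"
  unfolding contract_def sum_distrib_left by (rule sum.swap)

lemma contract_homog: "(\<And>i. G i \<in> homog d) \<Longrightarrow> contract c G \<in> homog d"
  unfolding contract_def by (intro homog_sum homog_mconst_mult)

lemma \<rho>_contract: "\<rho> (contract c G) = (\<Sum>i\<in>UNIV. smult (c $ i) (\<rho> (G i)))"
  by (simp add: contract_def \<rho>_simps)

lemma D_add:
  assumes "v \<in> D" "v' \<in> D"
  shows "v + v' \<in> D"
proof -
  define G G' where "G = (\<lambda>i. v (mvar i))" and "G' = (\<lambda>i. v' (mvar i))"
  have eq: "v = vfield G" "v' = vfield G'" unfolding G_def G'_def by (intro D_vfield assms)+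
  have "contract c G \<in> vanishing_ideal (hyperplane c)" "contract c G' \<in> vanishing_ideal (hyperplane c)"
    if "c \<in> C" for c using assms that unfolding eq vfield_D_iff by blast+
  then show ?thesis unfolding eq vfield_add_left vfield_D_iff contract_add
    by (simp add: vanishing_ideal_def peval_simps)
qed

lemma D_scale:
  assumes "v \<in> D"
  shows "fscale s v \<in> D"
proof -
  define G where "G = (\<lambda>i. v (mvar i))"
  have eq: "v = vfield G" unfolding G_def by (intro D_vfield assms)
  show ?thesis using assms unfolding eq vfield_fscale vfield_D_iff contract_mult
    by (simp add: vanishing_ideal_def peval_simps)
qed

section \<open>Interpolation at the points where the arrangement meets the line\<close>

lemma degree_lform: "c \<in> C \<Longrightarrow> degree (\<rho> (lform c)) = 1"
  using y2_C by (simp add: \<rho>_lform)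

lemma poly_lform_root: "c \<in> C \<Longrightarrow> c' \<in> C \<Longrightarrow> poly (\<rho> (lform c')) (meet c) = 0 \<longleftrightarrow> c' = c"
  using separated[of c c'] y2_C[of c] by (cases "c' = c") (auto simp: \<rho>_lform meet_def field_simps)

lemma meet_inj: "inj_on meet C"
  using poly_lform_root by (metis inj_onI)

text \<open>Restricted to the line, the \<open>Q c\<close> are nonzero multiples of the Lagrange
  polynomials for the distinct nodes \<open>meet c\<close>.\<close>

lemma lagrange:
  assumes "degree p \<le> K"
  obtains l where "p = (\<Sum>c\<in>C. smult (l c) (\<rho> (Q c)))"
proof
  have Q0: "poly (\<rho> (Q c)) (meet c') = 0 \<longleftrightarrow> c' \<noteq> c" if "c \<in> C" "c' \<in> C" for c c'
    using that finite_C poly_lform_root by (auto simp: Q_def \<rho>_simps poly_prod prod_zero_iff)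
  let ?l = "\<lambda>c. poly p (meet c) / poly (\<rho> (Q c)) (meet c)"
  let ?q = "\<Sum>c\<in>C. smult (?l c) (\<rho> (Q c))"
  show "p = ?q"
  proof (rule poly_eqI_degree[of "meet ` C"])
    fix t assume "t \<in> meet ` C"
    then obtain c where c: "c \<in> C" "t = meet c" by blast
    have "poly ?q t = (\<Sum>c'\<in>C. if c' = c then poly p t else 0)"
      unfolding poly_sum poly_smult using Q0 c by (intro sum.cong) auto
    then show "poly p t = poly ?q t" using c finite_C by simp
  next
    have pos: "card C > 0" using finite_C C_nonempty by (simp add: card_gt_0_iff)
    then show "degree p < card (meet ` C)"
      using assms card_image[OF meet_inj] by (simp add: K_def)
    have "degree ?q \<le> K"
      using Q_homog by (intro degree_sum_le finite_C order.trans[OF degree_smult_le] degree_\<rho>)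
    then show "degree ?q < card (meet ` C)"
      using pos card_image[OF meet_inj] by (simp add: K_def)
  qed
qed

text \<open>A partition of unity on the chart of \<open>z\<close>: both \<open>x\<close> and
  \<open>y\<close> restrict to polynomials of degree at most 1, so their \<open>K\<close>-th powers
  can be interpolated by the \<open>Q c\<close>.\<close>

lemma multiplier:
  assumes "z \<in> {x, y}"
  obtains l where "z ^ K - (\<Sum>c\<in>C. mconst (l c) * Q c) \<in> IL"
proof -
  have z: "z \<in> homog 1" using assms x_homog y_homog by auto
  have "degree (\<rho> z) * K \<le> 1 * K"
    using degree_\<rho>[of z 1] z by (intro mult_right_mono) simp_all
  from order.trans[OF degree_power_le this] have "degree (\<rho> z ^ K) \<le> K" by simp
  then obtain l where l: "\<rho> z ^ K = (\<Sum>c\<in>C. smult (l c) (\<rho> (Q c)))" by (rule lagrange)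
  have "z ^ K - (\<Sum>c\<in>C. mconst (l c) * Q c) \<in> IL"
  proof (rule IL_I)
    show "z ^ K - (\<Sum>c\<in>C. mconst (l c) * Q c) \<in> homog (int K)"
      by (intro homog_diff homog_sum homog_mconst_mult Q_homog homog_linear_power z)
    show "\<rho> (z ^ K - (\<Sum>c\<in>C. mconst (l c) * Q c)) = 0"
      by (simp add: \<rho>_simps l)
  qed
  then show thesis by (rule that)
qed

lemma \<rho>_bform: "degree p \<le> d \<Longrightarrow> \<rho> (bform d p x y) = p"
  unfolding \<rho>_def by (rule msubst_bform) (use \<rho>_x \<rho>_y in \<open>auto simp: \<rho>_def\<close>)

text \<open>
  Near the point where the hyperplane of \<open>c\<close> meets the line, \<open>Q c\<close> is invertible, and \<open>Q c\<close> times a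
  vector field is logarithmic as soon as it is tangent to the hyperplane of \<open>c\<close>. The local lifts are
  glued with the Lagrange coefficients of \<open>multiplier\<close>.
\<close>

lemma log_lift:
  assumes z: "z \<in> {x, y}" and tan: "tangential g" and deg: "\<And>i. degree (g i) \<le> d" and d: "d \<ge> 1"
  obtains G where "vfield G \<in> D" "\<And>i. G i \<in> homog (int (d + K))" "\<And>i. \<rho> (G i) = \<rho> z ^ K * g i"
proof -
  obtain l where l: "z ^ K - (\<Sum>c\<in>C. mconst (l c) * Q c) \<in> IL" using multiplier[OF z] .
  define F where "F i = bform d (g i) x y" for i
  \<comment> \<open>Tangency makes the \<open>c\<close>-component of \<open>g\<close> vanish at
    \<open>meet c\<close>, hence divisible by the restriction of \<open>lform c\<close>. The
    quotient is homogenized in degree \<open>d - 1\<close>, which is where \<open>d \<ge> 1\<close>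
    enters.\<close>
  define k where "k c = bform (d - 1) ((\<Sum>i\<in>UNIV. smult (c $ i) (g i)) div \<rho> (lform c)) x y" for c
  have F: "F i \<in> homog (int d)" "\<rho> (F i) = g i" for i
    by (simp_all add: F_def bform_homog x_homog y_homog \<rho>_bform deg)
  have k: "lform c * k c \<in> homog (int d)" "\<rho> (lform c * k c) = \<rho> (contract c F)" if c: "c \<in> C" for c
  proof -
    have "k c \<in> homog (int (d - 1))" unfolding k_def by (intro bform_homog x_homog y_homog)
    from homog_mult[OF lform_homog this] show "lform c * k c \<in> homog (int d)" using d by simp
    let ?p = "\<Sum>i\<in>UNIV. smult (c $ i) (g i)"
    have lin: "\<rho> (lform c) = smult (dot c y2) [:- meet c, 1:]"
      using y2_C[OF c] by (simp add: \<rho>_lform meet_def)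
    have "poly ?p (meet c) = 0" using tan c by (simp add: tangential_def)
    then have "[:- meet c, 1:] dvd ?p" by (simp only: poly_eq_0_iff_dvd)
    then have "\<rho> (lform c) dvd ?p" unfolding lin by (rule smult_dvd) (rule y2_C[OF c])
    then have p: "?p = \<rho> (lform c) * (?p div \<rho> (lform c))" by simp
    have degp: "degree ?p \<le> d"
      by (intro degree_sum_le order.trans[OF degree_smult_le] deg) simp
    have "degree (?p div \<rho> (lform c)) \<le> d - 1"
    proof (cases "?p div \<rho> (lform c) = 0")
      case False
      have "degree ?p = degree (\<rho> (lform c) * (?p div \<rho> (lform c)))" using p by simp
      also have "\<dots> = 1 + degree (?p div \<rho> (lform c))"
        using False degree_lform[OF c] by (subst degree_mult_eq) auto
      finally show ?thesis using degp by simp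
    qed simp
    then show "\<rho> (lform c * k c) = \<rho> (contract c F)"
      using p by (simp add: k_def \<rho>_simps \<rho>_bform \<rho>_contract F)
  qed
  \<comment> \<open>Since \<open>c\<close> takes the value 1 on \<open>transversal c\<close>, the
    bracket replaces the \<open>c\<close>-component \<open>contract c F\<close> by
    \<open>lform c * k c\<close>. Both restrict to the same polynomial, so nothing changes along the
    line, but the new one vanishes on the whole hyperplane.\<close>
  define H where "H c i = Q c * (F i - contract c F * mconst (transversal c $ i) + lform c * k c * mconst (transversal c $ i))" for c i
  have H_homog: "H c i \<in> homog (int (d + K))" if c: "c \<in> C" for c i
  proof -
    have "F i - contract c F * mconst (transversal c $ i) + lform c * k c * mconst (transversal c $ i) \<in> homog (int d)"
      using homog_mconst_mult[OF k(1)[OF c], of "transversal c $ i"]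
        homog_mconst_mult[OF contract_homog[of F "int d" c, OF F(1)], of "transversal c $ i"]
      by (intro homog_add homog_diff F) (simp_all add: mult.commute)
    from homog_mult[OF Q_homog[OF c] this] show ?thesis by (simp add: H_def add.commute)
  qed
  have H_contract: "contract c' (H c) \<in> vanishing_ideal (hyperplane c')" if c: "c \<in> C" "c' \<in> C" for c c'
  proof (cases "c' = c")
    case True
    have "contract c (H c) = Q c * (lform c * k c)"
      unfolding H_def contract_mult contract_add contract_diff contract_mconst
      using c by (simp add: dot_trans)
    then show ?thesis by (simp add: True vanishing_ideal_def peval_simps)
  next
    case False
    then show ?thesis
      unfolding H_def contract_mult using Q_vanishes[OF c False]
      by (simp add: vanishing_ideal_def peval_simps)
  qed
  define G where "G i = (\<Sum>c\<in>C. mconst (l c) * H c i)" for i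
  show thesis
  proof
    have "contract c G = (\<Sum>c'\<in>C. mconst (l c') * contract c (H c'))" for c
      unfolding G_def contract_sum contract_mult ..
    then show "vfield G \<in> D" unfolding vfield_D_iff
      using H_contract by (auto simp: vanishing_ideal_def peval_simps intro!: sum.neutral)
    show "G i \<in> homog (int (d + K))" for i
      unfolding G_def by (intro homog_sum homog_mconst_mult H_homog)
    show "\<rho> (G i) = \<rho> z ^ K * g i" for i
    proof -
      have "\<rho> (H c i) = \<rho> (Q c) * g i" if "c \<in> C" for c
        using k(2)[OF that] by (simp add: H_def \<rho>_simps F)
      then have "\<rho> (G i) = \<rho> (\<Sum>c\<in>C. mconst (l c) * Q c) * g i"
        by (simp add: G_def \<rho>_simps sum_distrib_right)
      also have "\<rho> (\<Sum>c\<in>C. mconst (l c) * Q c) = \<rho> z ^ K"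
        using \<rho>_eq_0[OF l] by (simp add: \<rho>_simps)
      finally show ?thesis .
    qed
  qed
qed

text \<open>That the coefficients \<open>N i\<close> lie in \<open>IL\<close> is not enough by
  itself, because the coordinate fields are in general not logarithmic. After multiplication by
  \<open>Q c\<close> they can be exchanged for logarithmic fields with coefficients
  \<open>N j\<close> and \<open>k\<close> still in \<open>IL\<close>, and \<open>multiplier\<close>
  combines these identities over \<open>C\<close>.\<close>

lemma log_restriction_torsion:
  assumes z: "z \<in> {x, y}" and N: "vfield N \<in> D" "\<And>i. N i \<in> IL"
  shows "fscale (z ^ K) (vfield N) \<in> fmod.span {fscale s v | s v. s \<in> IL \<and> v \<in> D}" (is "_ \<in> ?S")
proof -
  obtain l where l: "z ^ K - (\<Sum>c\<in>C. mconst (l c) * Q c) \<in> IL" using multiplier[OF z] .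
  have base: "fscale s v \<in> ?S" if "s \<in> IL" "v \<in> D" for s v
    using that by (intro fmod.span_base) blast
  have "fscale (Q c) (vfield N) \<in> ?S" if c: "c \<in> C" for c
  proof -
    have "contract c N \<in> vanishing_ideal (hyperplane c)"
      using N(1) c by (simp add: vfield_D_iff)
    then obtain k where k: "contract c N = lform c * k"
      using vanishing_ideal_hyperplane[OF inf C_nonzero[OF c]] by blast
    have contract_IL: "contract c N \<in> IL"
      unfolding contract_def by (intro ideal.subspace_sum[OF IL_ideal] IL_scale N)
    have k_IL: "k \<in> IL"
    proof (rule IL_cancel[of y2 "lform c"])
      show "y2 \<in> L" using L_memI[of 0 1] by simp
      show "peval (lform c) (\<lambda>i. y2 $ i) \<noteq> 0" using y2_C[OF c] by simp
      show "peval k (\<lambda>i. w $ i) = 0" if "w \<in> L" "peval (lform c) (\<lambda>i. w $ i) \<noteq> 0" for w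
        using contract_IL that unfolding k by (auto simp: vanishing_ideal_def peval_simps)
    qed
    \<comment> \<open>Where \<open>Q c\<close> is invertible, these generate the logarithmic fields:
      coordinate fields with their \<open>c\<close>-component removed, and the transversal field
      multiplied by \<open>lform c\<close>.\<close>
    define B where "B j = vfield (\<lambda>i. Q c * (mconst (axis j 1 $ i) - mconst (c $ j) * mconst (transversal c $ i)))" for j
    define B' where "B' = vfield (\<lambda>i. (Q c * lform c) * mconst (transversal c $ i))"
    have B: "B j \<in> D" for j
      unfolding B_def vfield_D_iff
    proof
      fix c' assume c': "c' \<in> C"
      have "contract c' (\<lambda>i. Q c * (mconst (axis j 1 $ i) - mconst (c $ j) * mconst (transversal c $ i)))
        = Q c * (mconst (c' $ j) - mconst (c $ j) * mconst (dot c' (transversal c)))"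
        by (simp only: contract_mult contract_diff contract_mconst dot_axis)
      then show "contract c' (\<lambda>i. Q c * (mconst (axis j 1 $ i) - mconst (c $ j) * mconst (transversal c $ i)))
        \<in> vanishing_ideal (hyperplane c')"
        using Q_vanishes[OF c c'] dot_trans[OF c]
        by (cases "c' = c") (auto simp: vanishing_ideal_def peval_simps)
    qed
    have B': "B' \<in> D"
      unfolding B'_def vfield_D_iff contract_mult contract_mconst
      using Q_vanishes[OF c] by (auto simp: vanishing_ideal_def peval_simps)
    have "(\<Sum>j\<in>UNIV. N j * (Q c * (mconst (axis j 1 $ i) - mconst (c $ j) * mconst (transversal c $ i)))) =
        Q c * N i - Q c * contract c N * mconst (transversal c $ i)" for i
    proof -
      have "(\<Sum>j\<in>UNIV. N j * (Q c * (mconst (axis j 1 $ i) - mconst (c $ j) * mconst (transversal c $ i)))) =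
          (\<Sum>j\<in>UNIV. if j = i then Q c * N i else 0) -
          (\<Sum>j\<in>UNIV. Q c * (mconst (c $ j) * N j) * mconst (transversal c $ i))"
        unfolding sum_subtractf[symmetric] right_diff_distrib
        by (intro sum.cong) (auto simp: axis_def mult_ac)
      then show ?thesis
        by (simp add: contract_def sum_distrib_left sum_distrib_right)
    qed
    then have "fscale (Q c) (vfield N) = (\<Sum>j\<in>UNIV. fscale (N j) (B j)) + fscale k B'"
      unfolding B_def B'_def vfield_fscale vfield_sum_left vfield_add_left
      by (intro arg_cong[of _ _ vfield]) (simp add: k mult_ac)
    also have "\<dots> \<in> ?S"
      by (intro fmod.span_add fmod.span_sum base N B B' k_IL)
    finally show ?thesis .
  qed
  then have "(\<Sum>c\<in>C. fscale (mconst (l c)) (fscale (Q c) (vfield N))) \<in> ?S"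
    by (rule fmod.span_sum[OF fmod.span_scale])
  moreover have "fscale (z ^ K - (\<Sum>c\<in>C. mconst (l c) * Q c)) (vfield N) \<in> ?S"
    by (rule base[OF l N(1)])
  ultimately have "fscale (z ^ K - (\<Sum>c\<in>C. mconst (l c) * Q c)) (vfield N) +
      (\<Sum>c\<in>C. fscale (mconst (l c)) (fscale (Q c) (vfield N))) \<in> ?S"
    by (intro fmod.span_add)
  also have "(\<Sum>c\<in>C. fscale (mconst (l c)) (fscale (Q c) (vfield N))) =
      fscale (\<Sum>c\<in>C. mconst (l c) * Q c) (vfield N)"
    by (simp add: fmod.scale_sum_left)
  finally show ?thesis by (simp flip: fmod.scale_left_distrib)
qed

end

section \<open>Charts for the restriction of D0 to the line\<close>

context general_line
begin

definition \<epsilon> :: "'n \<Rightarrow> 'k poly" where "\<epsilon> i = [:y1 $ i, y2 $ i:]"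

abbreviation euler_fields :: "('n \<Rightarrow> 'k poly) set" where
  "euler_fields \<equiv> {p. \<exists>h. \<forall>i. p i = h * \<epsilon> i}"

abbreviation log_forms :: "nat \<Rightarrow> ('n \<Rightarrow> 'k poly) set" where
  "log_forms m \<equiv> {g. (\<forall>i. degree (g i) \<le> m) \<and> tangential g}"

abbreviation D0_line where "D0_line \<equiv> gmod_restrict IL (D0 (hyperplane ` C))"

lemma y1_nonzero: obtains i where "y1 $ i \<noteq> 0"
  using a1 by (force simp: dot_def)

lemma y2_nonzero: obtains i where "y2 $ i \<noteq> 0"
  using b2 by (force simp: dot_def)

lemma tangential_add: "tangential g \<Longrightarrow> tangential g' \<Longrightarrow> tangential (\<lambda>i. g i + g' i)"
  by (simp add: tangential_def smult_add_right sum.distrib)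

lemma tangential_mult: "tangential g \<Longrightarrow> tangential (\<lambda>i. h * g i)"
proof -
  have "(\<Sum>i\<in>UNIV. smult (c $ i) (h * g i)) = h * (\<Sum>i\<in>UNIV. smult (c $ i) (g i))" for c :: "'k ^ 'n"
    by (simp add: sum_distrib_left)
  then show "tangential g \<Longrightarrow> tangential (\<lambda>i. h * g i)" by (simp add: tangential_def del: poly_sum)
qed

lemma tangential_\<epsilon>: "tangential \<epsilon>"
  unfolding tangential_def
proof
  fix c assume "c \<in> C"
  have "(\<Sum>i\<in>UNIV. smult (c $ i) (\<epsilon> i)) = \<rho> (lform c)"
    by (simp add: \<epsilon>_def \<rho>_lform sum_pCons dot_def)
  then show "poly (\<Sum>i\<in>UNIV. smult (c $ i) (\<epsilon> i)) (meet c) = 0"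
    using poly_lform_root[OF \<open>c \<in> C\<close> \<open>c \<in> C\<close>] by simp
qed

lemma tangential_\<rho>:
  assumes "v \<in> D"
  shows "tangential (\<lambda>i. \<rho> (v (mvar i)))"
  unfolding tangential_def
proof
  fix c assume c: "c \<in> C"
  have "vfield (\<lambda>i. v (mvar i)) \<in> D" using D_vfield[OF assms] assms by simp
  then have "contract c (\<lambda>i. v (mvar i)) \<in> vanishing_ideal (hyperplane c)"
    using c by (simp add: vfield_D_iff)
  moreover have "y1 + meet c *s y2 \<in> hyperplane c"
    using y2_C[OF c] by (simp add: dot_add dot_diff dot_scale meet_def)
  ultimately have "peval (contract c (\<lambda>i. v (mvar i))) (\<lambda>i. (y1 + meet c *s y2) $ i) = 0"
    unfolding vanishing_ideal_def by blast
  then show "poly (\<Sum>i\<in>UNIV. smult (c $ i) (\<rho> (v (mvar i)))) (meet c) = 0"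
    by (simp only: \<rho>_contract[symmetric] poly_\<rho>)
qed

lemma euler_D: "vfield mvar \<in> D"
proof -
  have "contract c mvar = lform c" for c by (simp add: contract_def lform_def)
  then show ?thesis by (simp add: vfield_D_iff vanishing_ideal_def)
qed

lemma D_diff: "v \<in> D \<Longrightarrow> v' \<in> D \<Longrightarrow> v - v' \<in> D"
proof -
  assume v: "v \<in> D" "v' \<in> D"
  have "v - v' = v + fscale (- 1) v'" by (auto simp: fscale_def)
  then show ?thesis using D_add[OF v(1) D_scale[OF v(2)]] by metis
qed

text \<open>The value of \<open>\<epsilon>\<close> at parameter 0 is the nonzero vector
  \<open>y1\<close>, so the multiplier itself must vanish there.\<close>

lemma euler_fields_cancel:
  assumes "(\<lambda>i. [:0, 1:] * p i) \<in> euler_fields"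
  shows "p \<in> euler_fields"
proof -
  obtain h where h: "[:0, 1:] * p i = h * \<epsilon> i" for i using assms by blast
  obtain i where i: "y1 $ i \<noteq> 0" by (rule y1_nonzero)
  have "poly ([:0, 1:] * p i) 0 = 0" by simp
  then have "poly h 0 = 0" using i unfolding h by (simp add: \<epsilon>_def)
  then obtain h' where h': "h = [:0, 1:] * h'"
    using poly_eq_0_iff_dvd[of h 0] by (auto elim: dvdE)
  have "p i = h' * \<epsilon> i" for i
  proof -
    have "[:0, 1:] * p i = [:0, 1:] * (h' * \<epsilon> i)" unfolding h h' by (simp only: mult.assoc)
    then show ?thesis by (subst (asm) mult_cancel_left) simp
  qed
  then show ?thesis by blast
qed

lemma D0_rel:
  "grel D0_line =
     fmod.span ({fscale s (vfield mvar) | s. True} \<union> {fscale s v | s v. s \<in> IL \<and> v \<in> D})"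
  by (simp add: gmod_restrict_def D0_def euler_eq_vfield)

lemma D0_rel_\<rho>:
  assumes "v \<in> grel D0_line"
  shows "(\<lambda>i. \<rho> (v (mvar i))) \<in> euler_fields"
proof -
  let ?W = "{v. \<exists>h. \<forall>i. \<rho> (v (mvar i)) = h * \<epsilon> i}"
  have "fmod.span ({fscale s (vfield mvar) | s. True} \<union> {fscale s v | s v. s \<in> IL \<and> v \<in> D}) \<subseteq> ?W"
  proof (rule fmod_span_subsetI)
    fix v assume "v \<in> {fscale s (vfield mvar) | s. True} \<union> {fscale s v | s v. s \<in> IL \<and> v \<in> D}"
    then consider s where "v = fscale s (vfield mvar)" | s w where "v = fscale s w" "s \<in> IL" by blast
    then show "v \<in> ?W"
    proof cases
      case (1 s)
      then have "\<forall>i. \<rho> (v (mvar i)) = \<rho> s * \<epsilon> i" by (simp add: fscale_def \<rho>_simps \<epsilon>_def)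
      then show ?thesis by blast
    next
      case (2 s w)
      then have "\<forall>i. \<rho> (v (mvar i)) = 0 * \<epsilon> i" by (simp add: fscale_def \<rho>_simps \<rho>_eq_0)
      then show ?thesis by blast
    qed
  next
    show "fmod.subspace ?W"
    proof (rule fmod.subspaceI)
      show "0 \<in> ?W" by (auto simp: \<rho>_simps intro: exI[of _ 0])
      show "v + w \<in> ?W" if vw: "v \<in> ?W" "w \<in> ?W" for v w
      proof -
        obtain h h' where "\<forall>i. \<rho> (v (mvar i)) = h * \<epsilon> i" "\<forall>i. \<rho> (w (mvar i)) = h' * \<epsilon> i" using vw by blast
        then have "\<forall>i. \<rho> ((v + w) (mvar i)) = (h + h') * \<epsilon> i" by (simp add: \<rho>_simps distrib_right)
        then show ?thesis by blast
      qed
      show "fscale s v \<in> ?W" if v: "v \<in> ?W" for s v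
      proof -
        obtain h where "\<forall>i. \<rho> (v (mvar i)) = h * \<epsilon> i" using v by blast
        then have "\<forall>i. \<rho> (fscale s v (mvar i)) = (\<rho> s * h) * \<epsilon> i"
          by (simp add: fscale_def \<rho>_simps mult.assoc)
        then show ?thesis by blast
      qed
    qed
  qed
  with assms show ?thesis unfolding D0_rel by blast
qed

text \<open>A derivation that is radial along the line differs by a multiple of the Euler derivation
  from a homogeneous one vanishing on the line, to which \<open>log_restriction_torsion\<close>
  applies. Conversely, \<open>f\<close> restricts to 1 or to the variable, by which
  \<open>euler_fields\<close> can be divided.\<close>

lemma D0_rel_iff:
  assumes f: "f \<in> {x, y, x * y}"
    and v: "v \<in> D" "\<And>i. v (mvar i) \<in> homog (int d)"
  shows "(\<exists>j. fscale (f ^ j) v \<in> grel D0_line) \<longleftrightarrow>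
    (\<lambda>i. \<rho> (v (mvar i))) \<in> euler_fields"
proof
  assume "\<exists>j. fscale (f ^ j) v \<in> grel D0_line"
  then obtain j where "fscale (f ^ j) v \<in> grel D0_line" by blast
  from D0_rel_\<rho>[OF this] have 1: "(\<lambda>i. \<rho> f ^ j * \<rho> (v (mvar i))) \<in> euler_fields"
    by (simp add: fscale_def \<rho>_simps)
  have cancel: "p \<in> euler_fields" if "(\<lambda>i. [:0, 1:] ^ j * p i) \<in> euler_fields" for p j
    using that
  proof (induction j)
    case (Suc j)
    then have "(\<lambda>i. [:0, 1:] * ([:0, 1:] ^ j * p i)) \<in> euler_fields"
      by (simp only: power_Suc mult.assoc)
    from Suc.IH[OF euler_fields_cancel[OF this]] show ?case .
  qed simp
  have "\<rho> f = 1 \<or> \<rho> f = [:0, 1:]" using f by (auto simp: \<rho>_simps)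
  then show "(\<lambda>i. \<rho> (v (mvar i))) \<in> euler_fields"
  proof
    assume "\<rho> f = 1"
    with 1 show ?thesis by simp
  next
    assume "\<rho> f = [:0, 1:]"
    with 1 show ?thesis by (simp only: cancel)
  qed
next
  assume "(\<lambda>i. \<rho> (v (mvar i))) \<in> euler_fields"
  then obtain h where h: "\<rho> (v (mvar i)) = h * \<epsilon> i" for i by blast
  \<comment> \<open>As \<open>y2\<close> is nonzero, some component of \<open>\<epsilon>\<close> has
    degree exactly 1; hence the Euler coefficient has degree at most \<open>d - 1\<close>, and
    \<open>d = 0\<close> forces it to be zero.\<close>
  have deg_h: "d = 0 \<and> h = 0 \<or> d > 0 \<and> degree h \<le> d - 1"
  proof (cases "h = 0")
    case False
    obtain i where "y2 $ i \<noteq> 0" by (rule y2_nonzero)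
    then have "degree (h * \<epsilon> i) = degree h + 1" using False by (subst degree_mult_eq) (auto simp: \<epsilon>_def)
    moreover have "degree (h * \<epsilon> i) \<le> d" using degree_\<rho>[OF v(2)] h by metis
    ultimately show ?thesis by simp
  qed auto
  define s where "s = (if d = 0 then 0 else bform (d - 1) h x y)"
  have s: "s * mvar i \<in> homog (int d)" for i
    using homog_mult[OF bform_homog[OF x_homog y_homog, of "d - 1" h] homog_mvar[of i]]
    by (auto simp: s_def)
  have \<rho>s: "\<rho> s = h" using deg_h \<rho>_bform[of h "d - 1"] by (auto simp: s_def \<rho>_simps)
  define N where "N i = v (mvar i) - s * mvar i" for i
  have v_eq: "v = vfield N + fscale s (vfield mvar)"
    by (subst D_vfield[OF v(1)]) (simp add: vfield_fscale vfield_add_left N_def)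
  have "vfield N = v - fscale s (vfield mvar)" using v_eq by simp
  then have "vfield N \<in> D" using v(1) D_diff[OF _ D_scale[OF euler_D]] by metis
  moreover have "N i \<in> IL" for i
  proof (rule IL_I)
    show "N i \<in> homog (int d)" unfolding N_def by (intro homog_diff v s)
    show "\<rho> (N i) = 0" by (simp add: N_def \<rho>_simps \<rho>s h \<epsilon>_def)
  qed
  ultimately have N: "fscale (z ^ K) (vfield N) \<in> fmod.span {fscale s v | s v. s \<in> IL \<and> v \<in> D}"
    if "z \<in> {x, y}" for z
    using that by (intro log_restriction_torsion)
  let ?S = "fmod.span ({fscale s (vfield mvar) | s. True} \<union> {fscale s v | s v. s \<in> IL \<and> v \<in> D})"
  have zv: "fscale (z ^ K) v \<in> ?S" if "z \<in> {x, y}" for z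
  proof -
    have "fscale (z ^ K) v = fscale (z ^ K) (vfield N) + fscale (z ^ K * s) (vfield mvar)"
      by (subst v_eq) (simp add: fmod.scale_right_distrib)
    moreover have "fscale (z ^ K) (vfield N) \<in> ?S"
      using N[OF that] by (rule subsetD[OF fmod.span_mono, rotated]) blast
    moreover have "fscale (z ^ K * s) (vfield mvar) \<in> ?S" by (intro fmod.span_base) blast
    ultimately show ?thesis by (simp only: fmod.span_add)
  qed
  have "fscale (f ^ K) v \<in> ?S"
  proof (cases "f = x * y")
    case True
    have "fscale (f ^ K) v = fscale (x ^ K) (fscale (y ^ K) v)"
      by (simp add: True power_mult_distrib)
    then show ?thesis using fmod.span_scale[OF zv[of y]] by simp
  next
    case False
    then show ?thesis using zv f by blast
  qed
  then show "\<exists>j. fscale (f ^ j) v \<in> grel D0_line"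
    unfolding D0_rel by blast
qed

lemma D0_gdeg:
  "v \<in> gdeg D0_line d \<longleftrightarrow> v \<in> D \<and> (\<forall>i. v (mvar i) \<in> homog d)"
proof -
  have "(\<forall>l\<in>homog 1. v l \<in> homog d) \<longleftrightarrow> (\<forall>i. v (mvar i) \<in> homog d)" if "v \<in> D"
    using vfield_homog_iff[of "\<lambda>i. v (mvar i)" d] D_vfield[OF that] by simp
  then show ?thesis by (auto simp: gmod_restrict_def D0_def)
qed

lemma D0_charted:
  "charted x y \<rho> D0_line (\<lambda>v i. \<rho> (v (mvar i)))
     euler_fields (log_forms m) m"
proof
  let ?M = D0_line
  show "\<rho> 1 = 1" "\<And>s t. \<rho> (s * t) = \<rho> s * \<rho> t" "\<And>c. \<rho> (mconst c) = [:c:]" "\<rho> x = 1" "\<rho> y = [:0, 1:]"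
    "x \<in> homog 1" "y \<in> homog 1"
    by (simp_all add: \<rho>_simps x_homog y_homog)
  show "v + v' \<in> gdeg ?M d" if "v \<in> gdeg ?M d" "v' \<in> gdeg ?M d" for v v' d
    using that unfolding D0_gdeg by (auto simp: homog_add D_add)
  show "fscale s v \<in> gdeg ?M (d + e)" if "s \<in> homog e" "v \<in> gdeg ?M d" for s e v d
  proof -
    have "fscale s v (mvar i) \<in> homog (d + e)" for i
      using that homog_mult[OF that(1), of "v (mvar i)" d] unfolding D0_gdeg
      by (simp add: fscale_def add.commute)
    then show ?thesis using that unfolding D0_gdeg by (simp add: D_scale)
  qed
  show "\<rho> ((v + v') (mvar i)) = \<rho> (v (mvar i)) + \<rho> (v' (mvar i))"
    "\<rho> (fscale s v (mvar i)) = \<rho> s * \<rho> (v (mvar i))" for v v' :: "('n, 'k) mpoly \<Rightarrow> _" and s i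
    by (simp_all add: fscale_def \<rho>_simps)
  show "(\<lambda>i. 0) \<in> euler_fields" by (auto intro: exI[of _ 0])
  show "(\<lambda>i. p i - p' i) \<in> euler_fields" if p: "p \<in> euler_fields" "p' \<in> euler_fields" for p p'
  proof -
    obtain h h' where "\<forall>i. p i = h * \<epsilon> i" "\<forall>i. p' i = h' * \<epsilon> i" using p by blast
    then have "\<forall>i. p i - p' i = (h - h') * \<epsilon> i" by (simp add: left_diff_distrib)
    then show ?thesis by blast
  qed
  show "(\<lambda>i. q * p i) \<in> euler_fields" if p: "p \<in> euler_fields" for p q
  proof -
    obtain h where "\<forall>i. p i = h * \<epsilon> i" using p by blast
    then have "\<forall>i. q * p i = (q * h) * \<epsilon> i" by (simp add: mult.assoc)
    then show ?thesis by blast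
  qed
  show "p \<in> euler_fields" if "(\<lambda>i. [:0, 1:] * p i) \<in> euler_fields" for p
    by (rule euler_fields_cancel[OF that])
  show "(\<exists>j. fscale (f ^ j) v \<in> grel ?M) \<longleftrightarrow> (\<lambda>i. \<rho> (v (mvar i))) \<in> euler_fields"
    if "f \<in> {x, y, x * y}" "v \<in> gdeg ?M (int d)" for f v d
    by (rule D0_rel_iff) (use that in \<open>auto simp: D0_gdeg\<close>)
  show "\<exists>d. \<exists>v\<in>gdeg ?M (int d). \<forall>i. \<rho> (v (mvar i)) = g i" if g: "g \<in> log_forms m" for g
  proof -
    \<comment> \<open>\<open>log_lift\<close> asks for a positive degree bound; since
      \<open>m\<close> may be 0, the bound is raised to \<open>m + 1\<close>.\<close>
    have "x \<in> {x, y}" "tangential g" "\<And>i. degree (g i) \<le> m + 1" "m + 1 \<ge> 1"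
      using g by (auto intro: le_SucI)
    then obtain G where "vfield G \<in> D" "\<And>i. G i \<in> homog (int (m + 1 + K))" "\<And>i. \<rho> (G i) = \<rho> x ^ K * g i"
      using log_lift[of x g "m + 1"] by blast
    then show ?thesis
      by (intro exI[of _ "m + 1 + K"] bexI[of _ "vfield G"]) (auto simp: D0_gdeg)
  qed
  show "\<exists>d. \<exists>v\<in>gdeg ?M (int d). \<forall>i. [:0, 1:] ^ m * \<rho> (v (mvar i)) = [:0, 1:] ^ d * g i"
    if g: "g \<in> log_forms m" for g
  proof -
    \<comment> \<open>The extra factor \<open>[:0, 1:]\<close> makes the exponents agree:
      \<open>m\<close>, plus \<open>K\<close> from the lift, plus 1 is the degree
      \<open>m + 1 + K\<close> of the lift.\<close>
    have "degree ([:0, 1:] * g i) \<le> m + 1" for i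
      using g degree_mult_le[of "[:0, 1:]" "g i"] by (auto intro: order.trans)
    moreover have "y \<in> {x, y}" "m + 1 \<ge> 1" by simp_all
    moreover have "tangential (\<lambda>i. [:0, 1:] * g i)"
      using g by (intro tangential_mult) simp
    ultimately obtain G where G: "vfield G \<in> D" "\<And>i. G i \<in> homog (int (m + 1 + K))"
        "\<And>i. \<rho> (G i) = \<rho> y ^ K * ([:0, 1:] * g i)"
      using log_lift[of y "\<lambda>i. [:0, 1:] * g i" "m + 1"] by blast
    have "[:0, 1:] ^ m * \<rho> (G i) = [:0, 1:] ^ (m + 1 + K) * g i" for i
      unfolding G(3) \<rho>_y power_add power_one_right by (simp only: mult_ac)
    with G show ?thesis
      by (intro exI[of _ "m + 1 + K"] bexI[of _ "vfield G"]) (auto simp: D0_gdeg)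
  qed
  \<comment> \<open>Dividing the Euler coefficient \<open>h\<close> with remainder by a power of the variable splits it between
    the two charts and bounds the degree of the glued vector field.\<close>
  show "\<exists>g\<in>log_forms m. (\<lambda>i. \<rho> (v (mvar i)) - g i) \<in> euler_fields"
    if v: "v \<in> gdeg ?M (int r)" and w: "w \<in> gdeg ?M (int r')"
      and eq: "(\<lambda>i. [:0, 1:] ^ m * \<rho> (w (mvar i)) - [:0, 1:] ^ r' * \<rho> (v (mvar i))) \<in> euler_fields"
    for v w r r'
  proof -
    obtain h where h: "[:0, 1:] ^ m * \<rho> (w (mvar i)) - [:0, 1:] ^ r' * \<rho> (v (mvar i)) = h * \<epsilon> i" for i
      using eq by blast
    define U where "U = [:0, 1 :: 'k:] ^ r'"
    have U: "U \<noteq> 0" "degree U = r'" by (auto simp: U_def degree_linear_power)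
    define h0 h1 where "h0 = h mod U" and "h1 = h div U"
    have h01: "h = h0 + U * h1" by (simp add: h0_def h1_def)
    define g where "g i = \<rho> (v (mvar i)) + h1 * \<epsilon> i" for i
    have Ug: "U * g i = [:0, 1:] ^ m * \<rho> (w (mvar i)) - h0 * \<epsilon> i" for i
      using h[of i] unfolding h01 g_def U_def[symmetric] by (simp add: algebra_simps)
    have "degree (g i) \<le> m" for i
    proof (cases "g i = 0")
      case False
      have "degree (h0 * \<epsilon> i) \<le> r'"
      proof (cases "h0 = 0")
        case False
        then have "degree h0 < r'" using degree_mod_less[OF U(1), of h] U(2) by (simp add: h0_def)
        moreover have "degree (\<epsilon> i) \<le> 1" by (simp add: \<epsilon>_def)
        ultimately show ?thesis using degree_mult_le[of h0 "\<epsilon> i"] by linarith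
      qed simp
      moreover have "degree ([:0, 1:] ^ m * \<rho> (w (mvar i))) \<le> m + r'"
      proof (rule order.trans[OF degree_mult_le])
        have "degree (\<rho> (w (mvar i))) \<le> r'" using w by (intro degree_\<rho>) (simp add: D0_gdeg)
        then show "degree ([:0, 1:: 'k:] ^ m) + degree (\<rho> (w (mvar i))) \<le> m + r'"
          by (simp add: degree_linear_power)
      qed
      ultimately have "degree (U * g i) \<le> m + r'"
        unfolding Ug by (intro degree_diff_le) simp_all
      then show ?thesis using False U by (simp add: degree_mult_eq)
    qed simp
    moreover have "tangential g"
      unfolding g_def using v tangential_\<rho> tangential_mult[OF tangential_\<epsilon>]
      by (intro tangential_add) (auto simp: D0_gdeg)
    moreover have "\<forall>i. \<rho> (v (mvar i)) - g i = (- h1) * \<epsilon> i" by (simp add: g_def)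
    ultimately show ?thesis by blast
  qed
  show "(\<lambda>i. g i + g' i) \<in> log_forms m" if "g \<in> log_forms m" "g' \<in> log_forms m" for g g'
    using that by (auto intro: degree_add_le tangential_add)
  show "(\<lambda>i. [:c:] * g i) \<in> log_forms m" if "g \<in> log_forms m" for g c
    using that tangential_mult[of g "[:c:]"] order.trans[OF degree_smult_le] by auto
qed

end

section \<open>Forms with a codimension two center\<close>

text \<open>Coordinate vectors are functions on the whole index type of which only the values on
  \<open>I\<close> count (\<open>cong\<close>). The images of the unit vectors indexed by
  \<open>I\<close> form a basis of the range.\<close>

lemma mpoly_dim_by_coordinates:
  fixes \<Phi> :: "('i \<Rightarrow> 'k::field) \<Rightarrow> ('n, 'k) mpoly"
  assumes fin: "finite I" and add: "\<And>c d. \<Phi> (\<lambda>i. c i + d i) = \<Phi> c + \<Phi> d"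
    and scale: "\<And>t c. \<Phi> (\<lambda>i. t * c i) = pscale t (\<Phi> c)"
    and cong: "\<And>c d. (\<And>i. i \<in> I \<Longrightarrow> c i = d i) \<Longrightarrow> \<Phi> c = \<Phi> d"
    and inj: "\<And>c i. \<Phi> c = 0 \<Longrightarrow> i \<in> I \<Longrightarrow> c i = 0"
  shows "mpoly_vs.dim (range \<Phi>) = card I"
proof -
  define \<delta> :: "'i \<Rightarrow> 'i \<Rightarrow> 'k" where "\<delta> i j = (if j = i then 1 else 0)" for i j
  have zero: "\<Phi> (\<lambda>i. 0) = 0" using scale[of 0 "\<lambda>i. 0"] by simp
  have expand_aux: "\<Phi> (\<lambda>j. \<Sum>i\<in>A. c i * \<delta> i j) = (\<Sum>i\<in>A. pscale (c i) (\<Phi> (\<delta> i)))" if "finite A" for A c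
    using that by induction (simp_all add: zero add scale)
  have expand: "\<Phi> c = (\<Sum>i\<in>I. pscale (c i) (\<Phi> (\<delta> i)))" for c
  proof -
    have "\<Phi> c = \<Phi> (\<lambda>j. \<Sum>i\<in>I. c i * \<delta> i j)"
      by (rule cong) (simp add: \<delta>_def fin if_distrib cong: if_cong)
    then show ?thesis by (simp add: expand_aux[OF fin])
  qed
  have inj_\<delta>: "inj_on (\<lambda>i. \<Phi> (\<delta> i)) I"
  proof (rule inj_onI)
    fix i j assume ij: "i \<in> I" "j \<in> I" "\<Phi> (\<delta> i) = \<Phi> (\<delta> j)"
    have "\<Phi> (\<lambda>k. \<delta> i k + (- 1) * \<delta> j k) = \<Phi> (\<delta> i) + pscale (- 1) (\<Phi> (\<delta> j))"
      by (simp only: add scale)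
    also have "\<dots> = 0" by (simp add: ij)
    finally have "\<delta> i i + (- 1) * \<delta> j i = 0" by (rule inj) (rule ij)
    then show "i = j" by (auto simp: \<delta>_def split: if_splits)
  qed
  let ?B = "(\<lambda>i. \<Phi> (\<delta> i)) ` I"
  have indep: "\<not> mpoly_vs.dependent ?B"
  proof
    assume "mpoly_vs.dependent ?B"
    then obtain u v where uv: "v \<in> ?B" "u v \<noteq> 0" "(\<Sum>v\<in>?B. pscale (u v) v) = 0"
      using fin by (auto simp: mpoly_vs.dependent_finite)
    have "\<Phi> (\<lambda>i. u (\<Phi> (\<delta> i))) = 0"
      using uv(3) by (subst expand) (simp add: sum.reindex[OF inj_\<delta>])
    with inj uv(1,2) show False by force
  qed
  have "mpoly_vs.span ?B = range \<Phi>"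
  proof
    show "mpoly_vs.span ?B \<subseteq> range \<Phi>"
    proof (rule mpoly_vs.span_minimal)
      show "mpoly_vs.subspace (range \<Phi>)"
      proof (rule mpoly_vs.subspaceI)
        show "0 \<in> range \<Phi>" using zero by (metis rangeI)
        show "f + g \<in> range \<Phi>" if fg: "f \<in> range \<Phi>" "g \<in> range \<Phi>" for f g
        proof -
          obtain c where "f = \<Phi> c" using fg(1) by (rule rangeE)
          moreover obtain d where "g = \<Phi> d" using fg(2) by (rule rangeE)
          ultimately have "f + g = \<Phi> (\<lambda>i. c i + d i)" by (simp add: add)
          then show ?thesis by blast
        qed
        show "pscale t f \<in> range \<Phi>" if f: "f \<in> range \<Phi>" for t f
        proof -
          obtain c where "f = \<Phi> c" using f by (rule rangeE)
          then have "pscale t f = \<Phi> (\<lambda>i. t * c i)" by (simp add: scale)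
          then show ?thesis by blast
        qed
      qed
    qed blast
    show "range \<Phi> \<subseteq> mpoly_vs.span ?B"
    proof (rule image_subsetI)
      fix c
      show "\<Phi> c \<in> mpoly_vs.span ?B"
        by (subst expand, rule mpoly_vs.span_sum, rule mpoly_vs.span_scale, rule mpoly_vs.span_base)
          (rule imageI)
    qed
  qed
  then have "mpoly_vs.dim (range \<Phi>) = card ?B"
    using mpoly_vs.dim_span_eq_card_independent[OF indep] by simp
  then show ?thesis by (simp add: card_image inj_\<delta>)
qed

context line_frame
begin

definition center :: "('k ^ 'n) set" where "center = {z. dot y1 z = 0 \<and> dot y2 z = 0}"

text \<open>
  The form attached to a vector field along \<open>L\<close>: the hyperplane of a point \<open>z\<close> meets \<open>L\<close> at
  \<open>dot y2 z *s y1 - dot y1 z *s y2\<close>, which explains the arguments of the binary forms.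
\<close>

definition \<Psi> :: "nat \<Rightarrow> ('n \<Rightarrow> 'k poly) \<Rightarrow> ('n, 'k) mpoly" where
  "\<Psi> m g = (\<Sum>i\<in>UNIV. mvar i * bform m (g i) (lform y2) (- lform y1))"

lemma \<Psi>_add: "\<Psi> m (\<lambda>i. g i + g' i) = \<Psi> m g + \<Psi> m g'"
  by (simp add: \<Psi>_def bform_add distrib_left sum.distrib)

lemma \<Psi>_scale: "\<Psi> m (\<lambda>i. [:c:] * g i) = mconst c * \<Psi> m g"
  by (simp add: \<Psi>_def bform_smult sum_distrib_left mult.left_commute)

lemma \<Psi>_homog: "\<Psi> m g \<in> homog (int (m + 1))"
proof -
  have "mvar i * bform m (g i) (lform y2) (- lform y1) \<in> homog (1 + int m)" for i
    by (intro homog_mult homog_mvar bform_homog lform_homog homog_uminus)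
  then show ?thesis unfolding \<Psi>_def by (intro homog_sum) (simp add: add.commute)
qed

lemma peval_\<Psi>:
  assumes "\<And>i. degree (g i) \<le> m" "dot y2 z \<noteq> 0"
  shows "peval (\<Psi> m g) (\<lambda>i. z $ i) =
    dot y2 z ^ m * (\<Sum>i\<in>UNIV. z $ i * poly (g i) (- dot y1 z / dot y2 z))"
  using assms by (simp add: \<Psi>_def peval_simps peval_bform sum_distrib_left mult.left_commute)

text \<open>Where \<open>dot y2 z\<close> is nonzero, \<open>\<Psi> m g\<close> at \<open>z\<close>
  is a nonzero multiple of the pairing of \<open>z\<close> with \<open>g\<close> at the point in
  which the hyperplane of \<open>z\<close> meets the line. All these pairings vanish exactly when
  \<open>g\<close> is, at each point, killed by every hyperplane through that point, that is, when
  it is radial.\<close>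

lemma \<Psi>_eq_0_iff:
  assumes deg: "\<And>i. degree (g i) \<le> m"
  shows "\<Psi> m g = 0 \<longleftrightarrow> (\<exists>h. \<forall>i. g i = h * [:y1 $ i, y2 $ i:])"
proof
  assume "\<exists>h. \<forall>i. g i = h * [:y1 $ i, y2 $ i:]"
  then obtain h where h: "g i = h * [:y1 $ i, y2 $ i:]" for i by blast
  have zero: "peval (\<Psi> m g) (\<lambda>i. z $ i) = 0" if z: "dot y2 z \<noteq> 0" for z
  proof -
    define t where "t = - dot y1 z / dot y2 z"
    have "(\<Sum>i\<in>UNIV. z $ i * poly (g i) t) = poly h t * (dot y1 z + t * dot y2 z)"
      by (simp add: h dot_def sum_distrib_left algebra_simps sum.distrib)
    also have "dot y1 z + t * dot y2 z = 0" using z by (simp add: t_def)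
    finally show ?thesis using peval_\<Psi>[OF deg z] by (simp add: t_def)
  qed
  show "\<Psi> m g = 0"
  proof (rule mpoly_eq_0I[OF inf], rule ccontr)
    fix w assume w: "peval (\<Psi> m g) w \<noteq> 0"
    \<comment> \<open>\<open>dot y2 b\<close> is 1, so moving from \<open>w\<close> towards
      \<open>b\<close> reaches the open set on which \<open>peval_\<Psi>\<close> applies.\<close>
    have "peval (lform y2) (\<lambda>i. b $ i) \<noteq> 0" using b2 by (simp add: dot_commute)
    from nonzero_on_line[OF inf w this] obtain t where
      t: "peval (\<Psi> m g) (\<lambda>i. w i + t * (b $ i - w i)) \<noteq> 0"
      "peval (lform y2) (\<lambda>i. w i + t * (b $ i - w i)) \<noteq> 0" .
    define z :: "'k ^ 'n" where "z = (\<chi> i. w i + t * (b $ i - w i))"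
    have "(\<lambda>i. w i + t * (b $ i - w i)) = (\<lambda>i. z $ i)" by (simp add: z_def)
    with t zero[of z] show False by simp
  qed
next
  assume \<Psi>: "\<Psi> m g = 0"
  \<comment> \<open>\<open>a\<close> pairs with \<open>[:y1 $ i, y2 $ i:]\<close> to the constant 1,
    so contraction with \<open>a\<close> gives the only possible multiplier.\<close>
  define h where "h = (\<Sum>i\<in>UNIV. smult (a $ i) (g i))"
  define g' where "g' i = g i - h * [:y1 $ i, y2 $ i:]" for i
  have hp: "poly h t = (\<Sum>i\<in>UNIV. a $ i * poly (g i) t)" for t
    by (simp add: h_def poly_sum)
  have ag': "(\<Sum>i\<in>UNIV. a $ i * poly (g' i) t) = 0" for t
  proof -
    have "(\<Sum>i\<in>UNIV. a $ i * poly (g' i) t) =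
        (\<Sum>i\<in>UNIV. a $ i * poly (g i) t) - poly h t * (dot a y1 + t * dot a y2)"
      by (simp add: g'_def dot_def sum_distrib_left algebra_simps sum.distrib sum_subtractf)
    then show ?thesis by (simp add: a1 a2 hp)
  qed
  have orth: "(\<Sum>i\<in>UNIV. z $ i * poly (g' i) t) = 0" if z: "dot y2 z \<noteq> 0" for z t
  proof -
    \<comment> \<open>Shifting along \<open>a\<close> keeps \<open>dot y2\<close> and makes the
      hyperplane of \<open>w\<close> pass through the point with parameter \<open>t\<close>; as
      \<open>g'\<close> pairs to zero with \<open>a\<close>, its pairing is unaffected by the
      shift.\<close>
    define w where "w = z - (dot y1 z + t * dot y2 z) *s a"
    have w: "dot y2 w = dot y2 z" "dot y1 w = - t * dot y2 z"
      using a1 a2 by (simp_all add: w_def dot_diff dot_add dot_scale dot_commute)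
    have "(\<Sum>i\<in>UNIV. w $ i * poly (g i) t) = 0"
      using peval_\<Psi>[of g m w, OF deg] \<Psi> z w by simp
    moreover have "(\<Sum>i\<in>UNIV. w $ i * poly (g i) t) =
        (\<Sum>i\<in>UNIV. w $ i * poly (g' i) t) + poly h t * (dot y1 w + t * dot y2 w)"
      by (simp add: g'_def dot_def sum_distrib_left algebra_simps sum.distrib sum_subtractf)
    moreover have "(\<Sum>i\<in>UNIV. w $ i * poly (g' i) t) = (\<Sum>i\<in>UNIV. z $ i * poly (g' i) t) -
        (dot y1 z + t * dot y2 z) * (\<Sum>i\<in>UNIV. a $ i * poly (g' i) t)"
      by (simp add: w_def sum_distrib_left algebra_simps sum_subtractf sum.distrib)
    ultimately show ?thesis by (simp add: ag' w)
  qed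
  have axis_sum: "(\<Sum>i\<in>UNIV. axis j 1 $ i * p i) = p j" for j and p :: "'n \<Rightarrow> 'k"
    by (simp add: axis_def if_distrib[of "\<lambda>c. c * _"] cong: if_cong)
  have "g' j = 0" for j
  proof (rule poly_eq_0_infinite[OF inf])
    fix t
    show "poly (g' j) t = 0"
    proof (cases "y2 $ j = 0")
      case False
      then show ?thesis using orth[of "axis j 1" t] by (simp add: dot_axis axis_sum)
    next
      case True
      \<comment> \<open>\<open>orth\<close> cannot be applied to \<open>axis j 1\<close> directly,
        which is therefore obtained as the difference of \<open>b + axis j 1\<close> and
        \<open>b\<close>.\<close>
      have "dot y2 b \<noteq> 0" "dot y2 (b + axis j 1) \<noteq> 0"
        using True b2 by (simp_all add: dot_add dot_axis dot_commute)
      from orth[OF this(1), of t] orth[OF this(2), of t] show ?thesis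
        by (simp add: distrib_right sum.distrib axis_sum)
    qed
  qed
  then have "\<forall>i. g i = h * [:y1 $ i, y2 $ i:]" by (simp add: g'_def)
  then show "\<exists>h. \<forall>i. g i = h * [:y1 $ i, y2 $ i:]" by blast
qed

lemma lform_center: "lform y1 \<in> vanishing_ideal center" "lform y2 \<in> vanishing_ideal center"
  by (simp_all add: vanishing_ideal_def center_def)

text \<open>Projecting onto the center along \<open>a\<close> and \<open>b\<close> changes each
  variable by a combination of \<open>lform y1\<close> and \<open>lform y2\<close>. The sign matches
  the arguments of the binary forms in \<open>\<Psi>\<close>.\<close>

lemma vanishing_ideal_center:
  assumes "f \<in> vanishing_ideal center"
  obtains p q where "f = p * lform y2 + q * - lform y1"
proof -
  let ?I = "ideal.span {lform y2, - lform y1}"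
  define g where "g i = mvar i - (mconst (a $ i) * lform y1 + mconst (b $ i) * lform y2)" for i
  have "f \<in> ?I"
  proof (rule vanishing_ideal_projection[OF inf ideal.subspace_span _ _ assms])
    fix i
    have "mconst (b $ i) * lform y2 + (- mconst (a $ i)) * - lform y1 \<in> ?I"
      by (rule ideal.span_add; rule ideal.span_scale; rule ideal.span_base) simp_all
    then show "mvar i - g i \<in> ?I" by (simp add: g_def add.commute)
  next
    fix z
    have "(\<chi> i. peval (g i) (\<lambda>i. z $ i)) = z - (dot y1 z *s a + dot y2 z *s b)"
      by (simp add: vec_eq_iff g_def peval_simps mult.commute)
    then show "(\<chi> i. peval (g i) (\<lambda>i. z $ i)) \<in> center" using a1 a2 b1 b2
      by (simp add: center_def dot_diff dot_add dot_scale dot_commute)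
  qed
  then obtain p q where "f - p * lform y2 = q * - lform y1"
    unfolding ideal.span_insert[of "lform y2"] ideal.span_singleton by blast
  then show thesis by (intro that[of p q]) (simp add: diff_eq_eq add.commute)
qed

abbreviation center_monomial :: "nat \<Rightarrow> nat \<Rightarrow> ('n, 'k) mpoly" where
  "center_monomial m k \<equiv> lform y2 ^ (m - k) * (- lform y1) ^ k"

text \<open>Every factor is a combination of the two generators, so a product of \<open>m\<close>
  factors expands into their monomials of degree \<open>m\<close>, and combinations of these
  monomials form an ideal.\<close>

lemma ideal_power_center:
  assumes "f \<in> ideal_power (vanishing_ideal center) m"
  obtains q where "f = (\<Sum>k\<le>m. q k * center_monomial m k)"
proof -
  define J where "J m = {f. \<exists>q. f = (\<Sum>k\<le>m. q k * center_monomial m k)}" for m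
  have J: "ideal.subspace (J m)" for m
  proof (rule ideal.subspaceI)
    show "0 \<in> J m" by (auto simp: J_def intro: exI[of _ "\<lambda>k. 0"])
    show "f + g \<in> J m" if fg: "f \<in> J m" "g \<in> J m" for f g
    proof -
      obtain q q' where "f = (\<Sum>k\<le>m. q k * center_monomial m k)"
        "g = (\<Sum>k\<le>m. q' k * center_monomial m k)"
        using fg unfolding J_def by blast
      then have "f + g = (\<Sum>k\<le>m. (q k + q' k) * center_monomial m k)"
        by (simp only: sum.distrib[symmetric] distrib_right)
      then show ?thesis unfolding J_def by (intro CollectI exI)
    qed
    show "s * f \<in> J m" if f: "f \<in> J m" for s f
    proof -
      obtain q where "f = (\<Sum>k\<le>m. q k * center_monomial m k)"
        using f unfolding J_def by blast
      then have "s * f = (\<Sum>k\<le>m. (s * q k) * center_monomial m k)"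
        by (simp only: sum_distrib_left mult.assoc)
      then show ?thesis unfolding J_def by (intro CollectI exI)
    qed
  qed
  have base: "center_monomial m k \<in> J m" if "k \<le> m" for k m
  proof -
    have "center_monomial m k =
        (\<Sum>j\<le>m. (if j = k then 1 else 0) * center_monomial m j)"
      using that by (simp add: if_distrib[of "\<lambda>c. c * _"] cong: if_cong)
    then show ?thesis unfolding J_def by (intro CollectI exI[of _ "\<lambda>j. if j = k then 1 else 0"])
  qed
  have step: "f * g \<in> J (Suc m)" if f: "f \<in> J m" and g: "g \<in> vanishing_ideal center" for f g m
  proof -
    obtain p q where g': "g = p * lform y2 + q * - lform y1" using vanishing_ideal_center[OF g] .
    obtain c where c: "f = (\<Sum>k\<le>m. c k * center_monomial m k)"
      using f unfolding J_def by blast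
    have "f * g = (\<Sum>k\<le>m. (c k * p) * center_monomial (Suc m) k +
        (c k * q) * center_monomial (Suc m) (Suc k))"
      unfolding c sum_distrib_right
    proof (rule sum.cong)
      fix k assume "k \<in> {..m}"
      then have "Suc m - k = Suc (m - k)" "Suc m - Suc k = m - k" by auto
      then show "c k * center_monomial m k * g =
        (c k * p) * center_monomial (Suc m) k +
        (c k * q) * center_monomial (Suc m) (Suc k)"
        unfolding g' by (simp only: power_Suc distrib_left mult_ac)
    qed simp
    also have "\<dots> \<in> J (Suc m)"
      by (intro ideal.subspace_sum[OF J] ideal.subspace_add[OF J] ideal.subspace_scale[OF J] base) auto
    finally show ?thesis .
  qed
  have prod: "(\<Prod>j<m. h j) \<in> J m" if "\<And>j. j < m \<Longrightarrow> h j \<in> vanishing_ideal center" for h m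
    using that
  proof (induction m)
    case 0
    show ?case using base[of 0 0] by simp
  next
    case (Suc m)
    then show ?case using step[of "\<Prod>j<m. h j" m "h m"] by simp
  qed
  have "ideal_power (vanishing_ideal center) m \<subseteq> J m"
    unfolding ideal_power_def by (rule ideal.span_minimal[OF _ J]) (auto intro: prod)
  with assms show thesis using that unfolding J_def by blast
qed

lemma \<Psi>_ideal_power: "\<Psi> m g \<in> ideal_power (vanishing_ideal center) m"
proof -
  have mem: "center_monomial m k \<in> ideal_power (vanishing_ideal center) m"
    if "k \<le> m" for k
  proof -
    have neg: "- lform y1 \<in> vanishing_ideal center"
      using lform_center(1) by (simp add: vanishing_ideal_def peval_simps)
    define h where "h j = (if j < m - k then lform y2 else - lform y1)" for j
    have "(\<Prod>j<m. h j) = (\<Prod>j<m - k. h j) * (\<Prod>j=m - k..<m. h j)"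
      by (simp add: lessThan_atLeast0 prod.atLeastLessThan_concat)
    also have "\<dots> = center_monomial m k"
      using that by (simp add: h_def)
    finally have "center_monomial m k = (\<Prod>j<m. h j)" by simp
    moreover have "\<forall>j<m. h j \<in> vanishing_ideal center" using neg lform_center by (simp add: h_def)
    ultimately show ?thesis unfolding ideal_power_def by (intro ideal.span_base) blast
  qed
  show ?thesis
    unfolding \<Psi>_def bform_def ideal_power_def mult.assoc
    by (rule ideal.span_sum, rule ideal.span_scale, rule ideal.span_sum, rule ideal.span_scale)
      (use mem[unfolded ideal_power_def] in auto)
qed

text \<open>Passing to the component of degree \<open>m + 1\<close> leaves only the linear parts of
  the coefficients \<open>q k\<close>. Sorted by variable instead of by \<open>k\<close>, the
  coefficients of these linear forms are the polynomials \<open>g i\<close>.\<close>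

lemma \<Psi>_surj:
  assumes f: "f \<in> ideal_power (vanishing_ideal center) m" "f \<in> homog (int (m + 1))"
  obtains g where "\<And>i. degree (g i) \<le> m" "\<Psi> m g = f"
proof -
  obtain q where q: "f = (\<Sum>k\<le>m. q k * center_monomial m k)" using ideal_power_center[OF f(1)] .
  have t: "center_monomial m k \<in> homog (int m)" if "k \<le> m" for k
    using homog_mult[OF homog_linear_power[OF lform_homog] homog_linear_power[OF homog_uminus[OF lform_homog]],
      of y2 "m - k" y1 k] that by simp
  have "f = hpart (1 + m) f" using hpart_id[OF f(2)] by simp
  also have "\<dots> = (\<Sum>k\<le>m. hpart (1 + m) (q k * center_monomial m k))"
    by (subst q) (simp only: hpart_sum)
  also have "\<dots> = (\<Sum>k\<le>m. hpart 1 (q k) * center_monomial m k)"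
    by (intro sum.cong refl hpart_mult_homog t) simp
  finally have f_eq: "f = (\<Sum>k\<le>m. hpart 1 (q k) * center_monomial m k)" .
  have "\<exists>c. hpart 1 (q k) = (\<Sum>i\<in>UNIV. mconst (c i) * mvar i)" for k
  proof -
    have "hpart 1 (q k) \<in> homog 1" using hpart_homog[of 1 "q k"] by simp
    then obtain c where "hpart 1 (q k) = (\<Sum>i\<in>UNIV. mconst (c i) * mvar i)" by (rule linear_form_expansion)
    then show ?thesis by blast
  qed
  then obtain c where c: "hpart 1 (q k) = (\<Sum>i\<in>UNIV. mconst (c k i) * mvar i)" for k by metis
  define g where "g i = (\<Sum>k\<le>m. monom (c k i) k)" for i
  show thesis
  proof
    show "degree (g i) \<le> m" for i
      unfolding g_def by (intro degree_sum_le order.trans[OF degree_monom_le]) auto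
    have coeff: "coeff (g i) k = c k i" if "k \<le> m" for i k
      using that by (simp add: g_def coeff_sum)
    have "\<Psi> m g = (\<Sum>i\<in>UNIV. \<Sum>k\<le>m. mconst (c k i) * mvar i * center_monomial m k)"
      unfolding \<Psi>_def bform_def sum_distrib_left
      by (intro sum.cong refl) (simp add: coeff mult_ac)
    also have "\<dots> = f" unfolding f_eq c sum_distrib_right by (rule sum.swap)
    finally show "\<Psi> m g = f" .
  qed
qed

end

section \<open>The dimension count\<close>

context general_line
begin

abbreviation cone :: "('k ^ 'n) set" where "cone \<equiv> {t *s c | t c. c \<in> C}"

lemma \<Psi>_vanishes_iff:
  assumes deg: "\<And>i. degree (g i) \<le> m"
  shows "\<Psi> m g \<in> vanishing_ideal cone \<longleftrightarrow> tangential g"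
proof -
  have ev: "peval (\<Psi> m g) (\<lambda>i. (t *s c) $ i) =
      t ^ (m + 1) * (dot c y2 ^ m * poly (\<Sum>i\<in>UNIV. smult (c $ i) (g i)) (meet c))" if c: "c \<in> C" for c t
  proof -
    have "dot y2 c \<noteq> 0" using y2_C[OF c] by (simp add: dot_commute)
    from peval_\<Psi>[of g m c, OF deg this]
    have "peval (\<Psi> m g) (\<lambda>i. c $ i) = dot c y2 ^ m * poly (\<Sum>i\<in>UNIV. smult (c $ i) (g i)) (meet c)"
      by (simp add: meet_def poly_sum dot_commute)
    moreover have "(\<lambda>i. (t *s c) $ i) = (\<lambda>i. t * c $ i)" by simp
    ultimately show ?thesis using peval_homog_scaled[OF \<Psi>_homog[of m g], of t "\<lambda>i. c $ i"] by simp
  qed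
  show ?thesis
  proof
    assume \<Psi>: "\<Psi> m g \<in> vanishing_ideal cone"
    show "tangential g" unfolding tangential_def
    proof
      fix c assume c: "c \<in> C"
      then have "1 *s c \<in> cone" by blast
      with \<Psi> have "peval (\<Psi> m g) (\<lambda>i. (1 *s c) $ i) = 0" unfolding vanishing_ideal_def by blast
      then show "poly (\<Sum>i\<in>UNIV. smult (c $ i) (g i)) (meet c) = 0"
        unfolding ev[OF c] using y2_C[OF c] by simp
    qed
  next
    assume tan: "tangential g"
    have "peval (\<Psi> m g) (\<lambda>i. z $ i) = 0" if z: "z \<in> cone" for z
    proof -
      obtain t c where "z = t *s c" and c: "c \<in> C" using z by blast
      then show ?thesis using ev[OF c, of t] tan c by (simp only: tangential_def) simp
    qed
    then show "\<Psi> m g \<in> vanishing_ideal cone" by (simp add: vanishing_ideal_def)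
  qed
qed

lemma forms_eq_\<Psi>:
  "vanishing_ideal cone \<inter> ideal_power (vanishing_ideal center) m \<inter> homog (int (m + 1)) = \<Psi> m ` log_forms m"
proof
  show "\<Psi> m ` log_forms m \<subseteq> vanishing_ideal cone \<inter> ideal_power (vanishing_ideal center) m \<inter> homog (int (m + 1))"
    using \<Psi>_vanishes_iff \<Psi>_ideal_power \<Psi>_homog by blast
  show "vanishing_ideal cone \<inter> ideal_power (vanishing_ideal center) m \<inter> homog (int (m + 1)) \<subseteq> \<Psi> m ` log_forms m"
  proof
    fix f assume f: "f \<in> vanishing_ideal cone \<inter> ideal_power (vanishing_ideal center) m \<inter> homog (int (m + 1))"
    then obtain g where "\<And>i. degree (g i) \<le> m" "\<Psi> m g = f" using \<Psi>_surj[of f m] by blast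
    then show "f \<in> \<Psi> m ` log_forms m" using \<Psi>_vanishes_iff[of g m] f by blast
  qed
qed

lemma dim_forms:
  assumes iso: "sheaves_isomorphic D0_line (gmod_restrict IL (twisted_free as))"
    and nonneg: "\<And>j. j < length as \<Longrightarrow> 0 \<le> as ! j"
  shows "int (mpoly_vs.dim (vanishing_ideal cone \<inter> ideal_power (vanishing_ideal center) m \<inter> homog (int (m + 1))))
    = (\<Sum>j<length as. max 0 (int m + 1 - as ! j))"
proof -
  define G' where "G' = bounded_tuples as m"
  interpret charted_pair x y \<rho> m D0_line "\<lambda>v i. \<rho> (v (mvar i))"
    euler_fields "log_forms m" "gmod_restrict IL (twisted_free as)" "\<lambda>v j. \<rho> (v j)" "{\<lambda>j. 0}" G'
    unfolding charted_pair_def G'_def using D0_charted twisted_charted[OF nonneg] by blast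
  obtain T where
    T_ex: "\<And>g. g \<in> log_forms m \<Longrightarrow> \<exists>h\<in>G'. T g h" and
    T_ex': "\<And>h. h \<in> G' \<Longrightarrow> \<exists>g\<in>log_forms m. T g h" and
    T_add: "\<And>g h g' h'. g \<in> log_forms m \<Longrightarrow> g' \<in> log_forms m \<Longrightarrow> h \<in> G' \<Longrightarrow> h' \<in> G' \<Longrightarrow> T g h \<Longrightarrow>
      T g' h' \<Longrightarrow> T (\<lambda>j. g j + g' j) (\<lambda>j. h j + h' j)" and
    T_scale: "\<And>g h c. g \<in> log_forms m \<Longrightarrow> h \<in> G' \<Longrightarrow> T g h \<Longrightarrow> T (\<lambda>j. [:c:] * g j) (\<lambda>j. [:c:] * h j)" and
    T_inj: "\<And>g g' h. g \<in> log_forms m \<Longrightarrow> g' \<in> log_forms m \<Longrightarrow> h \<in> G' \<Longrightarrow> T g h \<Longrightarrow> T g' h \<Longrightarrow>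
      (\<lambda>j. g j - g' j) \<in> euler_fields" and
    T_fun: "\<And>g h h'. g \<in> log_forms m \<Longrightarrow> h \<in> G' \<Longrightarrow> h' \<in> G' \<Longrightarrow> T g h \<Longrightarrow> T g h' \<Longrightarrow>
      (\<lambda>j. h j - h' j) \<in> {\<lambda>j. 0}" and
    T_cong: "\<And>g g' h. T g h \<Longrightarrow> (\<lambda>j. g j - g' j) \<in> euler_fields \<Longrightarrow> T g' h"
  proof (rule global_sections_correspondence[OF iso], goal_cases)
    case (1 T)
    show ?case by (rule 1(1)) (fact 1(2-))+
  qed
  have \<Psi>_diff: "\<Psi> m g = \<Psi> m g' \<longleftrightarrow> (\<lambda>j. g j - g' j) \<in> euler_fields"
    if g: "g \<in> log_forms m" "g' \<in> log_forms m" for g g'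
  proof -
    have "\<Psi> m (\<lambda>j. g j - g' j) = \<Psi> m (\<lambda>j. g j + [:- 1:] * g' j)" by simp
    also have "\<dots> = \<Psi> m g - \<Psi> m g'"
      by (simp only: \<Psi>_add \<Psi>_scale mconst_uminus mconst_1) simp
    finally have "\<Psi> m g = \<Psi> m g' \<longleftrightarrow> \<Psi> m (\<lambda>j. g j - g' j) = 0" by simp
    moreover have "degree (g i - g' i) \<le> m" for i using g by (simp add: degree_diff_le)
    ultimately show ?thesis using \<Psi>_eq_0_iff[of "\<lambda>j. g j - g' j" m] by (simp add: \<epsilon>_def)
  qed
  \<comment> \<open>The number of coefficients of a polynomial of degree at most
    \<open>m - as ! j\<close>; \<open>nat\<close> makes it 0 when that bound is negative. Hence
    \<open>I\<close> indexes the coordinates of \<open>G'\<close>, with \<open>H\<close> as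
    parametrization.\<close>
  define n where "n j = nat (int m + 1 - as ! j)" for j
  define I where "I = (SIGMA j:{..<length as}. {..<n j})"
  define H where "H c j = (if j < length as then \<Sum>k<n j. monom (c (j, k)) k else 0)" for c :: "nat \<times> nat \<Rightarrow> 'k" and j
  have H_coeff: "coeff (H c j) k = (if j < length as \<and> k < n j then c (j, k) else 0)" for c j k
    by (simp add: H_def coeff_sum)
  have H_mem: "H c \<in> G'" for c
    unfolding G'_def
  proof (intro CollectI conjI allI impI)
    fix j assume "j < length as"
    show "H c j = 0 \<or> int (degree (H c j)) \<le> int m - as ! j"
    proof (rule disjCI)
      assume "\<not> int (degree (H c j)) \<le> int m - as ! j"
      then have "\<not> degree (H c j) < n j" by (simp add: n_def)
      then have "lead_coeff (H c j) = 0" by (simp add: H_coeff)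
      then show "H c j = 0" by simp
    qed
  qed (simp add: H_def)
  have H_surj: "h = H (\<lambda>(j, k). coeff (h j) k)" if h: "h \<in> G'" for h
  proof (rule ext, rule poly_eqI)
    fix j k
    have "coeff (h j) k = 0" if "\<not> (j < length as \<and> k < n j)"
    proof (cases "j < length as")
      case True
      then have "h j = 0 \<or> int (degree (h j)) \<le> int m - as ! j" using h by (simp add: G'_def)
      then show ?thesis
      proof
        assume "int (degree (h j)) \<le> int m - as ! j"
        then show ?thesis using that True by (intro coeff_eq_0) (auto simp: n_def)
      qed simp
    qed (use h in \<open>simp add: G'_def\<close>)
    then show "coeff (h j) k = coeff (H (\<lambda>(j, k). coeff (h j) k) j) k" by (simp add: H_coeff)
  qed
  \<comment> \<open>From coordinates to a tuple, to a vector field related to it by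
    \<open>T\<close>, to its form. The field is determined only modulo Euler fields, which is
    exactly what \<open>\<Psi>\<close> forgets, so the choice is harmless.\<close>
  define \<Phi> where "\<Phi> c = \<Psi> m (SOME g. g \<in> log_forms m \<and> T g (H c))" for c
  have \<Phi>_eq: "\<Phi> c = \<Psi> m g" if g: "g \<in> log_forms m" "T g (H c)" for c g
  proof -
    let ?g = "SOME g. g \<in> log_forms m \<and> T g (H c)"
    have "?g \<in> log_forms m \<and> T ?g (H c)"
      by (rule someI[of "\<lambda>g. g \<in> log_forms m \<and> T g (H c)" g]) (use g in blast)
    then show ?thesis unfolding \<Phi>_def using T_inj[OF _ g(1) H_mem _ g(2)] \<Psi>_diff g by blast
  qed
  have ex: "\<exists>g. g \<in> log_forms m \<and> T g (H c)" for c using T_ex'[OF H_mem] by blast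
  have "mpoly_vs.dim (range \<Phi>) = card I"
  proof (rule mpoly_dim_by_coordinates)
    show "finite I" by (simp add: I_def)
    show "\<Phi> (\<lambda>i. c i + d i) = \<Phi> c + \<Phi> d" for c d
    proof -
      obtain g where g: "g \<in> log_forms m" "T g (H c)" using ex by blast
      obtain g' where g': "g' \<in> log_forms m" "T g' (H d)" using ex by blast
      have "H (\<lambda>i. c i + d i) = (\<lambda>j. H c j + H d j)"
        by (intro ext poly_eqI) (simp add: H_coeff)
      then have "T (\<lambda>j. g j + g' j) (H (\<lambda>i. c i + d i))"
        using T_add[OF g(1) g'(1) H_mem H_mem g(2) g'(2)] by simp
      moreover have "(\<lambda>j. g j + g' j) \<in> log_forms m" by (rule M.G_add[OF g(1) g'(1)])
      ultimately show ?thesis using \<Phi>_eq[OF g] \<Phi>_eq[OF g'] \<Phi>_eq[of "\<lambda>j. g j + g' j"] by (simp only: \<Psi>_add)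
    qed
    show "\<Phi> (\<lambda>i. t * c i) = pscale t (\<Phi> c)" for t c
    proof -
      obtain g where g: "g \<in> log_forms m" "T g (H c)" using ex by blast
      have "H (\<lambda>i. t * c i) = (\<lambda>j. [:t:] * H c j)"
        by (intro ext poly_eqI) (simp add: H_coeff)
      then have "T (\<lambda>j. [:t:] * g j) (H (\<lambda>i. t * c i))"
        using T_scale[OF g(1) H_mem g(2)] by simp
      moreover have "(\<lambda>j. [:t:] * g j) \<in> log_forms m" by (rule M.G_scale[OF g(1)])
      ultimately show ?thesis using \<Phi>_eq[OF g] \<Phi>_eq[of "\<lambda>j. [:t:] * g j"] by (simp only: \<Psi>_scale pscale_eq)
    qed
    show "\<Phi> c = \<Phi> d" if "\<And>i. i \<in> I \<Longrightarrow> c i = d i" for c d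
    proof -
      have "H c = H d" using that by (intro ext poly_eqI) (simp add: H_coeff I_def)
      then show ?thesis by (simp add: \<Phi>_def)
    qed
    show "c i = 0" if "\<Phi> c = 0" "i \<in> I" for c i
    proof -
      obtain g where g: "g \<in> log_forms m" "T g (H c)" using ex by blast
      obtain g' where g': "g' \<in> log_forms m" "T g' (H (\<lambda>i. 0))" using ex by blast
      have H0: "H (\<lambda>i. 0) = (\<lambda>j. 0)" by (intro ext poly_eqI) (simp add: H_coeff)
      have "\<Phi> (\<lambda>i. 0) = 0"
      proof -
        have "T (\<lambda>j. [:0:] * g' j) (H (\<lambda>i. 0))" using T_scale[OF g'(1) H_mem g'(2), of 0] H0 by simp
        moreover have "(\<lambda>j. [:0:] * g' j) \<in> log_forms m" by (rule M.G_scale[OF g'(1)])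
        ultimately have "\<Phi> (\<lambda>i. 0) = \<Psi> m (\<lambda>j. [:0:] * g' j)" by (intro \<Phi>_eq)
        then show ?thesis by (simp only: \<Psi>_scale mconst_0 mult_zero_left)
      qed
      then have "\<Psi> m g = \<Psi> m g'" using that(1) \<Phi>_eq[OF g] \<Phi>_eq[OF g'] by simp
      then have "(\<lambda>j. g j - g' j) \<in> euler_fields" using \<Psi>_diff[OF g(1) g'(1)] by simp
      \<comment> \<open>\<open>T\<close> sees the field only modulo Euler fields, so
        \<open>g'\<close> corresponds to \<open>H c\<close> as well as to the zero tuple, and
        \<open>T_fun\<close> makes these equal.\<close>
      then have "T g' (H c)" by (rule T_cong[OF g(2)])
      from T_fun[OF g'(1) H_mem H_mem this g'(2)] have "H c j = 0" for j
        by (simp add: H0 fun_eq_iff)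
      then have "coeff (H c (fst i)) (snd i) = 0" by simp
      then show ?thesis using that(2) by (auto simp: H_coeff I_def)
    qed
  qed
  moreover have "range \<Phi> = \<Psi> m ` log_forms m"
  proof
    show "range \<Phi> \<subseteq> \<Psi> m ` log_forms m"
    proof (rule image_subsetI)
      fix c
      obtain g where "g \<in> log_forms m" "T g (H c)" using ex by blast
      then show "\<Phi> c \<in> \<Psi> m ` log_forms m" using \<Phi>_eq by (intro image_eqI)
    qed
    show "\<Psi> m ` log_forms m \<subseteq> range \<Phi>"
    proof (rule image_subsetI)
      fix g assume g: "g \<in> log_forms m"
      obtain h where h: "h \<in> G'" "T g h" using T_ex[OF g] by blast
      then have "T g (H (\<lambda>(j, k). coeff (h j) k))" using H_surj[OF h(1)] by simp
      from \<Phi>_eq[OF g this] show "\<Psi> m g \<in> range \<Phi>" by (metis rangeI)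
    qed
  qed
  moreover have "int (card I) = (\<Sum>j<length as. max 0 (int m + 1 - as ! j))"
    by (simp add: I_def n_def max_def)
  ultimately show ?thesis by (simp only: forms_eq_\<Psi>)
qed

end

section \<open>Lines, their dual centers and the Zariski topology\<close>

lemma vec_span_pair: "vec.span {p, q} = {s *s p + t *s q | s t. True}"
proof (intro set_eqI iffI)
  fix v assume "v \<in> vec.span {p, q}"
  then obtain s t where "v - s *s p = t *s q"
    unfolding vec.span_insert[of p] vec.span_singleton by blast
  then have "v = s *s p + t *s q" by (simp add: diff_eq_eq add.commute)
  then show "v \<in> {s *s p + t *s q | s t. True}" by blast
next
  fix v assume "v \<in> {s *s p + t *s q | s t. True}"
  then obtain s t where "v = s *s p + t *s q" by blast
  then have "v - s *s p = t *s q" by simp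
  then show "v \<in> vec.span {p, q}" unfolding vec.span_insert[of p] vec.span_singleton by blast
qed

text \<open>Cramer's rule: the rows of the inverse of the 2 by 2 block at \<open>i\<close> and
  \<open>j\<close>, extended by zero, are dual to \<open>p\<close> and \<open>q\<close>.\<close>

lemma line_frame_exI:
  fixes p q :: "'k::field ^ 'n::finite"
  assumes inf: "infinite (UNIV :: 'k set)" and d: "p $ i * q $ j - p $ j * q $ i \<noteq> 0"
  shows "\<exists>a b. line_frame p q a b"
proof -
  define \<Delta> where "\<Delta> = p $ i * q $ j - p $ j * q $ i"
  have axis: "dot (axis l 1) z = z $ l" for l and z :: "'k ^ 'n"
    by (simp add: dot_commute[of "axis l 1"] dot_axis)
  define a b where "a = (1 / \<Delta>) *s (q $ j *s axis i 1 - q $ i *s axis j 1)"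
    and "b = (1 / \<Delta>) *s (p $ i *s axis j 1 - p $ j *s axis i 1)"
  have "q $ j * p $ i - q $ i * p $ j = \<Delta>" "p $ i * q $ j - p $ j * q $ i = \<Delta>" "\<Delta> \<noteq> 0"
    using d by (simp_all add: \<Delta>_def mult.commute)
  then have "line_frame p q a b"
    using inf by unfold_locales
      (auto simp: a_def b_def dot_scale_left dot_diff_left axis mult.commute
        simp flip: diff_divide_distrib)
  then show ?thesis by blast
qed

lemma minor_nonzero:
  fixes p q :: "'k::field ^ 'n::finite"
  assumes "p \<noteq> 0" "q \<notin> vec.span {p}"
  shows "\<exists>i j. p $ i * q $ j - p $ j * q $ i \<noteq> 0"
proof (rule ccontr)
  assume "\<not> (\<exists>i j. p $ i * q $ j - p $ j * q $ i \<noteq> 0)"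
  then have minors: "p $ i * q $ j = p $ j * q $ i" for i j by simp
  obtain i where "p $ i \<noteq> 0" using assms(1) by (auto simp: vec_eq_iff)
  then have "q = (q $ i / p $ i) *s p" using minors by (simp add: vec_eq_iff field_simps)
  then show False using assms(2) by (metis vec.span_base vec.span_scale singletonI)
qed

text \<open>The second frame vector is prescribed because \<open>general_line\<close> wants it to
  avoid all hyperplanes.\<close>

lemma grassmannian_2_line_frame:
  fixes W :: "('k::field ^ 'n::finite) set"
  assumes inf: "infinite (UNIV :: 'k set)" and W: "W \<in> grassmannian 2" and q: "q \<in> W" "q \<noteq> 0"
  obtains p a b where "line_frame p q a b" "W = vec.span {p, q}"
proof -
  have sub: "vec.subspace W" and dim: "vec.dim W = 2" using W by (simp_all add: grassmannian_def)
  have "vec.dim {q} = 1" using vec.dim_eq_card_independent[of "{q}"] q by simp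
  then have "\<not> W \<subseteq> vec.span {q}" using vec.dim_mono[of W "{q}"] dim by auto
  then obtain p where p: "p \<in> W" "p \<notin> vec.span {q}" by blast
  have pq: "p \<noteq> q" using p vec.span_base by blast
  have "vec.independent {p, q}"
    using p q pq by (simp add: vec.independent_insert)
  moreover have "card {p, q} = 2" using pq by simp
  ultimately have "W \<subseteq> vec.span {p, q}"
    using p q dim by (intro vec.card_ge_dim_independent) auto
  moreover have "vec.span {p, q} \<subseteq> W" using p q sub by (intro vec.span_minimal) auto
  moreover obtain i j where "q $ i * p $ j - q $ j * p $ i \<noteq> 0" using minor_nonzero[OF q(2) p(2)] by blast
  then have "p $ j * q $ i - p $ i * q $ j \<noteq> 0" by (simp add: mult.commute)
  then obtain a b where "line_frame p q a b" using line_frame_exI[OF inf] by blast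
  ultimately show thesis using that by blast
qed

context line_frame
begin

lemma L_eq_span: "L = vec.span {y1, y2}"
  by (simp add: L_def vec_span_pair)

lemma frame_independent: "s *s y1 + t *s y2 = 0 \<Longrightarrow> s = 0 \<and> t = 0"
proof -
  assume *: "s *s y1 + t *s y2 = 0"
  have "dot a (s *s y1 + t *s y2) = s" "dot b (s *s y1 + t *s y2) = t"
    by (simp_all only: dot_add dot_scale a1 a2 b1 b2) simp_all
  then show ?thesis unfolding * by simp
qed

lemma y12: "y1 \<noteq> 0" "y2 \<noteq> 0" "y1 \<noteq> y2" "y1 \<notin> vec.span {y2}"
proof -
  show "y1 \<noteq> 0" "y2 \<noteq> 0" "y1 \<noteq> y2" using a1 a2 b2 by auto
  show "y1 \<notin> vec.span {y2}"
    using a1 a2 by (auto simp: vec.span_singleton dot_scale)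
qed

lemma L_grassmannian: "L \<in> grassmannian 2"
proof -
  have "vec.independent {y1, y2}" using y12 by (simp add: vec.independent_insert)
  then have "vec.dim L = card {y1, y2}"
    unfolding L_eq_span by (rule vec.dim_span_eq_card_independent)
  then show ?thesis using y12 by (simp add: grassmannian_def L_eq_span)
qed

lemma center_eq: "center = {z. \<forall>w\<in>L. dot w z = 0}"
proof -
  have "y1 \<in> L" "y2 \<in> L" using L_memI[of 1 0] L_memI[of 0 1] by simp_all
  then show ?thesis by (auto simp: center_def L_def dot_add_left dot_scale_left)
qed

lemma center_projection: "z - (dot y1 z *s a + dot y2 z *s b) \<in> center"
  using a1 a2 b1 b2 by (simp add: center_def dot_diff dot_add dot_scale dot_commute)

text \<open>Every vector differs from one in the center by a combination of \<open>a\<close> and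
  \<open>b\<close>, so \<open>z\<close> pairs with all vectors in the same way as a combination of
  \<open>y1\<close> and \<open>y2\<close>.\<close>

lemma perp_center:
  assumes "\<And>x. x \<in> center \<Longrightarrow> dot z x = 0"
  shows "z \<in> L"
proof -
  have "dot z x = dot (dot z a *s y1 + dot z b *s y2) x" for x
    using assms[OF center_projection[of x]]
    by (simp add: dot_diff dot_add dot_scale dot_add_left dot_scale_left mult.commute)
  then have "z $ i = (dot z a *s y1 + dot z b *s y2) $ i" for i
    using dot_axis[of _ i] by metis
  then have "z = dot z a *s y1 + dot z b *s y2" by (simp add: vec_eq_iff)
  then show ?thesis using L_memI by metis
qed

lemma center_subspace: "vec.subspace center"
  by (rule vec.subspaceI) (auto simp: center_def dot_add dot_scale)

text \<open>\<open>a\<close> and \<open>b\<close> complete a basis of the center to a basis of the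
  whole space.\<close>

lemma dim_center: "vec.dim center + 2 = CARD('n)"
proof -
  obtain B where B: "finite B" "B \<subseteq> center" "vec.independent B" "vec.span B = center" "card B = vec.dim center"
    using vec.basis_subspace_exists[OF center_subspace] .
  have b: "b \<notin> vec.span B" unfolding B(4) using b2 by (simp add: center_def dot_commute)
  have a: "a \<notin> vec.span (insert b B)"
  proof
    assume "a \<in> vec.span (insert b B)"
    then obtain k where "a - k *s b \<in> center" unfolding vec.span_insert B(4) by blast
    then have "dot y1 (a - k *s b) = 0" by (simp add: center_def)
    then show False using a1 b1 by (simp add: dot_diff dot_scale dot_commute)
  qed
  have ab: "b \<notin> B" "a \<notin> insert b B" using a b vec.span_base by blast+
  have "vec.independent (insert a (insert b B))"
    using a b ab B(3) by (simp add: vec.independent_insert)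
  moreover have "vec.span (insert a (insert b B)) = UNIV"
  proof -
    have "x \<in> vec.span (insert a (insert b B))" for x
    proof -
      have "x - (dot y1 x *s a + dot y2 x *s b) \<in> vec.span (insert a (insert b B))"
        using center_projection[of x] vec.span_mono[of B "insert a (insert b B)"] B(4) by blast
      moreover have "dot y1 x *s a + dot y2 x *s b \<in> vec.span (insert a (insert b B))"
        by (intro vec.span_add vec.span_scale vec.span_base) auto
      ultimately have "(x - (dot y1 x *s a + dot y2 x *s b)) + (dot y1 x *s a + dot y2 x *s b) \<in> vec.span (insert a (insert b B))"
        by (rule vec.span_add)
      then show ?thesis by simp
    qed
    then show ?thesis by blast
  qed
  ultimately have "card (insert a (insert b B)) = vec.dim (UNIV :: ('k ^ 'n) set)"
    using vec.dim_span_eq_card_independent by metis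
  then show ?thesis using ab B by (simp add: card_cart_basis)
qed

end

lemma grassmannian_frame:
  fixes W :: "('k::field ^ 'n::finite) set"
  assumes "W \<in> grassmannian k"
  obtains u :: "nat \<Rightarrow> 'k ^ 'n" where "W = vec.span (u ` {..<k})"
proof -
  obtain B where "finite B" "B \<subseteq> W" "vec.independent B" "vec.span B = W" "card B = vec.dim W"
    using vec.basis_subspace_exists[of W] assms by (auto simp: grassmannian_def)
  moreover then obtain u where "bij_betw u {0..<card B} B" using ex_bij_betw_nat_finite by blast
  ultimately show thesis
    using that[of u] assms by (simp add: grassmannian_def bij_betw_def lessThan_atLeast0)
qed

section \<open>Common nonvanishing, and annihilators that depend polynomially on a frame\<close>

lemma common_nonzero:
  fixes A :: "('n, 'k::field) mpoly set"
  assumes inf: "infinite (UNIV :: 'k set)" and "finite A" and "\<And>p. p \<in> A \<Longrightarrow> \<exists>x. peval p x \<noteq> 0"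
  shows "\<exists>x. peval (\<Prod>p\<in>A. p) x \<noteq> 0"
  using assms(2,3)
proof (induction A rule: finite_induct)
  case (insert p A)
  obtain x where x: "peval p x \<noteq> 0" using insert.prems by blast
  obtain z where z: "peval (\<Prod>p\<in>A. p) z \<noteq> 0" using insert.IH insert.prems by blast
  obtain t where "peval p (\<lambda>i. x i + t * (z i - x i)) \<noteq> 0"
    "peval (\<Prod>p\<in>A. p) (\<lambda>i. x i + t * (z i - x i)) \<noteq> 0"
    using nonzero_on_line[OF inf x z] .
  then show ?case using insert.hyps
    by (intro exI[of _ "\<lambda>i. x i + t * (z i - x i)"]) (simp add: peval_simps)
qed simp

lemma peval_det:
  fixes A :: "('n, 'k::comm_ring_1) mpoly ^ 'm ^ 'm"
  shows "peval (det A) x = det (\<chi> r s. peval (A $ r $ s) x)"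
proof -
  have "peval (of_int (sign p)) x = of_int (sign p)" for p :: "'m \<Rightarrow> 'm"
    by (auto simp: sign_def peval_simps)
  then show ?thesis by (simp add: det_def peval_simps)
qed

lemma det_nonzero_iff_kernel:
  fixes A :: "'k::field ^ 'n ^ 'n"
  shows "det A \<noteq> 0 \<longleftrightarrow> (\<forall>z. (\<forall>r. dot (A $ r) z = 0) \<longrightarrow> z = 0)"
proof -
  have "A *v z = 0 \<longleftrightarrow> (\<forall>r. dot (A $ r) z = 0)" for z
    by (simp add: vec_eq_iff matrix_vector_mult_def dot_def)
  then show ?thesis
    unfolding invertible_det_nz[symmetric] invertible_left_inverse matrix_left_invertible_ker by simp
qed

lemma image_lessThan_2: "u ` {..<2} = {u 0, u (1::nat)}"
  by (auto simp: lessThan_Suc numeral_2_eq_2)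

lemma frame_2_line_frame:
  fixes u :: "nat \<Rightarrow> 'k::field ^ 'n::finite"
  assumes inf: "infinite (UNIV :: 'k set)" and u: "vec.span (u ` {..<2}) \<in> grassmannian 2"
  shows "\<exists>a b. line_frame (u 0) (u 1) a b"
proof -
  have dim: "vec.dim (vec.span {u 0, u 1}) = 2"
    using u by (simp add: grassmannian_def image_lessThan_2)
  have small: "\<not> vec.span {u 0, u 1} \<subseteq> vec.span {v}" for v
    using vec.dim_le_card[of "vec.span {u 0, u 1}" "{v}"] dim by auto
  have "u 0 \<noteq> 0"
  proof
    assume "u 0 = 0"
    then have "vec.span {u 0, u 1} \<subseteq> vec.span {u 1}" by (intro vec.span_minimal) (auto intro: vec.span_base vec.span_zero)
    with small show False by blast
  qed
  moreover have "u 1 \<notin> vec.span {u 0}"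
  proof
    assume "u 1 \<in> vec.span {u 0}"
    then have "vec.span {u 0, u 1} \<subseteq> vec.span {u 0}" by (intro vec.span_minimal) (auto intro: vec.span_base)
    with small show False by blast
  qed
  ultimately obtain i j where "u 0 $ i * u 1 $ j - u 0 $ j * u 1 $ i \<noteq> 0" using minor_nonzero by blast
  from line_frame_exI[OF inf this] show ?thesis .
qed

text \<open>
  A generalized cross product: completing a \<open>k\<close>-frame by two coordinate vectors to a basis, the two
  cross products span the line orthogonal to the frame and are polynomial in its entries.
\<close>

locale row_labelling =
  fixes r0 r1 :: "'n::finite" and \<beta> :: "'n \<Rightarrow> nat" and k :: nat
  assumes r01: "r0 \<noteq> r1" and \<beta>: "bij_betw \<beta> (UNIV - {r0, r1}) {..<k}"
begin

definition frame_matrix :: "(nat \<Rightarrow> 'a ^ 'n) \<Rightarrow> 'a ^ 'n \<Rightarrow> 'a ^ 'n \<Rightarrow> 'a::comm_ring_1 ^ 'n ^ 'n" where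
  "frame_matrix u a x = (\<chi> r. if r = r0 then x else if r = r1 then a else u (\<beta> r))"

definition cross :: "(nat \<Rightarrow> 'a ^ 'n) \<Rightarrow> 'a ^ 'n \<Rightarrow> 'a::comm_ring_1 ^ 'n" where
  "cross u a = (\<chi> i. det (frame_matrix u a (axis i 1)))"

definition cross_poly :: "'n \<Rightarrow> 'n \<Rightarrow> (nat \<times> 'n, 'a::comm_ring_1) mpoly" where
  "cross_poly p i = det (frame_matrix (\<lambda>j. \<chi> s. mvar (j, s)) (axis p 1) (axis i 1))"

lemma dot_cross: "dot (cross u a) x = det (frame_matrix u a x)"
proof -
  have xs: "(\<Sum>i\<in>UNIV. x $ i *s axis i 1) = x" by (simp add: vec_eq_iff axis_def if_distrib cong: if_cong)
  have "det (frame_matrix u a x) =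
      det (\<chi> r. if r = r0 then \<Sum>i\<in>UNIV. x $ i *s axis i 1 else if r = r1 then a else u (\<beta> r))"
    by (simp only: frame_matrix_def xs)
  also have "\<dots> = (\<Sum>i\<in>UNIV. x $ i * det (frame_matrix u a (axis i 1)))"
    by (simp add: det_linear_row_sum det_row_mul frame_matrix_def)
  finally show ?thesis by (simp add: dot_def cross_def mult.commute)
qed

lemma row_exists:
  assumes "j < k"
  obtains r where "r \<noteq> r0" "r \<noteq> r1" "\<beta> r = j"
proof -
  have "j \<in> \<beta> ` (UNIV - {r0, r1})" using \<beta> assms by (simp add: bij_betw_def)
  then show thesis using that by blast
qed

lemma dot_cross_frame:
  assumes "j < k"
  shows "dot (cross u a) (u j) = 0"
proof -
  obtain r where r: "r \<noteq> r0" "r \<noteq> r1" "\<beta> r = j"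
    using row_exists[OF assms] .
  then show ?thesis
    unfolding dot_cross by (intro det_identical_rows[of r0 r]) (simp_all add: row_def frame_matrix_def)
qed

lemma dot_cross_self: "dot (cross u a) a = 0"
  unfolding dot_cross using r01 by (intro det_identical_rows[of r0 r1]) (simp_all add: row_def frame_matrix_def)

text \<open>The kernel condition is symmetric in \<open>a\<close> and \<open>x\<close>, so these two
  rows can be exchanged without tracking signs.\<close>

lemma det_frame_matrix_iff:
  fixes u :: "nat \<Rightarrow> 'k::field ^ 'n"
  shows "det (frame_matrix u a x) \<noteq> 0 \<longleftrightarrow>
    (\<forall>z. (\<forall>j<k. dot (u j) z = 0) \<and> dot a z = 0 \<and> dot x z = 0 \<longrightarrow> z = 0)"
proof -
  have "(\<forall>r. dot (frame_matrix u a x $ r) z = 0) \<longleftrightarrow> (\<forall>j<k. dot (u j) z = 0) \<and> dot a z = 0 \<and> dot x z = 0" for z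
  proof
    assume *: "\<forall>r. dot (frame_matrix u a x $ r) z = 0"
    have "dot (u j) z = 0" if "j < k" for j
    proof -
      obtain r where r: "r \<noteq> r0" "r \<noteq> r1" "\<beta> r = j"
        using row_exists[OF \<open>j < k\<close>] .
      with *[rule_format, of r] show ?thesis by (simp add: frame_matrix_def)
    qed
    moreover have "dot a z = 0" "dot x z = 0"
      using *[rule_format, of r1] *[rule_format, of r0] r01 by (simp_all add: frame_matrix_def)
    ultimately show "(\<forall>j<k. dot (u j) z = 0) \<and> dot a z = 0 \<and> dot x z = 0" by blast
  next
    assume *: "(\<forall>j<k. dot (u j) z = 0) \<and> dot a z = 0 \<and> dot x z = 0"
    have "\<beta> r < k" if "r \<noteq> r0" "r \<noteq> r1" for r
      using \<beta> that unfolding bij_betw_def by blast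
    with * show "\<forall>r. dot (frame_matrix u a x $ r) z = 0" by (simp add: frame_matrix_def)
  qed
  then show ?thesis unfolding det_nonzero_iff_kernel by simp
qed

lemma peval_cross_poly:
  fixes u :: "nat \<Rightarrow> 'k::field ^ 'n"
  shows "peval (cross_poly p i) (\<lambda>(j, s). if j < k then u j $ s else 0) = cross u (axis p 1) $ i"
proof -
  have \<beta>k: "\<beta> r < k" if "r \<noteq> r0" "r \<noteq> r1" for r
    using \<beta> that unfolding bij_betw_def by blast
  have "(\<chi> r s. peval (frame_matrix (\<lambda>j. \<chi> s. mvar (j, s)) (axis p 1) (axis i 1) $ r $ s)
      (\<lambda>(j, s). if j < k then u j $ s else 0)) = frame_matrix u (axis p 1) (axis i 1)"
    by (simp add: vec_eq_iff frame_matrix_def \<beta>k axis_def)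
  then show ?thesis by (simp add: cross_poly_def peval_det cross_def)
qed

text \<open>In the coordinates \<open>p\<close> and \<open>q\<close> each cross product has a zero
  at its own index, so their minor is a product of two entries, which are nonzero together by the
  symmetry of the determinant condition.\<close>

lemma cross_line_frame:
  fixes u :: "nat \<Rightarrow> 'k::field ^ 'n"
  assumes inf: "infinite (UNIV :: 'k set)" and nz: "cross u (axis p 1) $ q \<noteq> 0"
  shows "\<exists>a b. line_frame (cross u (axis p 1)) (cross u (axis q 1)) a b"
proof -
  have "det (frame_matrix u (axis p 1) (axis q 1)) \<noteq> 0"
    using nz by (simp add: cross_def)
  then have "det (frame_matrix u (axis q 1) (axis p 1)) \<noteq> 0"
    unfolding det_frame_matrix_iff by blast
  then have "cross u (axis q 1) $ p \<noteq> 0" by (simp add: cross_def)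
  moreover have "cross u (axis p 1) $ p = 0" "cross u (axis q 1) $ q = 0"
    using dot_cross_self[of u "axis p 1"] dot_cross_self[of u "axis q 1"] by (simp_all add: dot_axis)
  ultimately show ?thesis
    using nz by (intro line_frame_exI[OF inf, of _ q _ p]) simp
qed

end

lemma grassmannian_openI:
  fixes V :: "('k::field ^ 'n) set set"
  assumes "V \<subseteq> grassmannian k"
    and "\<And>u :: nat \<Rightarrow> 'k ^ 'n. vec.span (u ` {..<k}) \<in> grassmannian k \<Longrightarrow>
      vec.span (u ` {..<k}) \<in> V \<longleftrightarrow> (\<exists>f\<in>F. peval f (\<lambda>(j, i). if j < k then u j $ i else 0) \<noteq> 0)"
  shows "grassmannian_open k V"
  unfolding grassmannian_open_def by (intro conjI assms(1) exI[of _ F] allI impI assms(2))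

lemma row_labelling_exists:
  assumes card: "CARD('n::finite) = k + 2"
  shows "\<exists>(r0 :: 'n) r1 \<beta>. row_labelling r0 r1 \<beta> k"
proof -
  obtain h :: "'n \<Rightarrow> nat" where h: "bij_betw h UNIV {0..<k + 2}"
    using ex_bij_betw_finite_nat[of "UNIV :: 'n set"] unfolding card by auto
  define r0 r1 where "r0 = inv_into UNIV h k" and "r1 = inv_into UNIV h (k + 1)"
  have hr: "h r0 = k" "h r1 = k + 1"
    using h by (simp_all add: r0_def r1_def bij_betw_def f_inv_into_f)
  have "h ` (UNIV - {r0, r1}) = h ` UNIV - h ` {r0, r1}"
    using h by (intro image_set_diff) (simp add: bij_betw_def)
  also have "\<dots> = {..<k}" using h hr by (auto simp: bij_betw_def)
  finally have "bij_betw h (UNIV - {r0, r1}) {..<k}"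
    using h by (intro bij_betw_subset[OF h]) auto
  then have "row_labelling r0 r1 h k" using hr by unfold_locales auto
  then show ?thesis by blast
qed

text \<open>Two cross products of a frame of \<open>Q\<close> span its annihilator wherever
  \<open>cross_poly p q\<close> is nonzero, and there the polynomials that test \<open>V\<close> can
  be pulled back. No single pair \<open>p\<close>, \<open>q\<close> serves every \<open>Q\<close>,
  so \<open>F'\<close> collects all pairs, each multiplied by the polynomial that marks its
  domain.\<close>

lemma grassmannian_open_perp:
  fixes V :: "('k::field ^ 'n::finite) set set"
  assumes inf: "infinite (UNIV :: 'k set)" and card: "CARD('n) = k + 2" and V: "grassmannian_open 2 V"
  shows "grassmannian_open k {Q \<in> grassmannian k. \<exists>L\<in>V. Q = {z. \<forall>w\<in>L. dot w z = 0}}"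
proof -
  obtain r0 r1 :: 'n and \<beta> where "row_labelling r0 r1 \<beta> k"
    using row_labelling_exists[OF card] by (elim exE)
  then interpret row_labelling r0 r1 \<beta> k .
  obtain F where F_all: "\<forall>u :: nat \<Rightarrow> 'k ^ 'n. vec.span (u ` {..<2}) \<in> grassmannian 2 \<longrightarrow>
      (vec.span (u ` {..<2}) \<in> V \<longleftrightarrow> (\<exists>f\<in>F. peval f (\<lambda>(j, i). if j < 2 then u j $ i else 0) \<noteq> 0))"
    using V[unfolded grassmannian_open_def, THEN conjunct2] by (rule exE)
  note F = F_all[rule_format]
  have V2: "V \<subseteq> grassmannian 2" using V by (simp add: grassmannian_open_def)
  \<comment> \<open>The entries of the two cross products as polynomials in the frame of
    \<open>Q\<close>; the value 0 at larger indices repeats the convention of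
    \<open>grassmannian_open\<close>.\<close>
  define sub where "sub p q = (\<lambda>(j, i). if j = 0 then cross_poly p i else if j = (1::nat) then cross_poly q i
    else (0 :: (nat \<times> 'n, 'k) mpoly))" for p q
  define F' where "F' = {cross_poly p q * msubst mconst (sub p q) f | p q f. f \<in> F}"
  have "vec.span (u ` {..<k}) \<in> {Q \<in> grassmannian k. \<exists>L\<in>V. Q = {z. \<forall>w\<in>L. dot w z = 0}} \<longleftrightarrow>
      (\<exists>f\<in>F'. peval f (\<lambda>(j, i). if j < k then u j $ i else 0) \<noteq> 0)"
    if Q: "vec.span (u ` {..<k}) \<in> grassmannian k" for u
  proof -
    let ?Q = "vec.span (u ` {..<k})" and ?X = "\<lambda>(j, i). if j < k then u j $ i else 0"
    define w where "w p q j = (if j = 0 then cross u (axis p 1) else cross u (axis q 1))" for p q and j :: nat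
    have ev: "peval (cross_poly p q * msubst mconst (sub p q) f) ?X =
        cross u (axis p 1) $ q * peval f (\<lambda>(j, i). if j < 2 then w p q j $ i else 0)" for p q f
    proof -
      have "(\<lambda>x. peval (sub p q x) ?X) = (\<lambda>(j, i). if j < 2 then w p q j $ i else 0)"
        by (auto simp: fun_eq_iff sub_def w_def peval_cross_poly)
      then show ?thesis
        by (simp only: peval_simps peval_cross_poly peval_msubst_mconst)
    qed
    have w_span: "vec.span (w p q ` {..<2}) = vec.span {cross u (axis p 1), cross u (axis q 1)}" for p q
      unfolding image_lessThan_2 by (simp add: w_def)
    have cross_Q: "dot (cross u c) z = 0" if "z \<in> ?Q" for z c
    proof -
      have "?Q \<subseteq> {z. dot (cross u c) z = 0}"
        by (rule vec.span_minimal) (auto simp: dot_cross_frame vec.subspace_def dot_add dot_scale)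
      with that show ?thesis by blast
    qed
    show ?thesis
    proof
      assume "?Q \<in> {Q \<in> grassmannian k. \<exists>L\<in>V. Q = {z. \<forall>w\<in>L. dot w z = 0}}"
      then obtain L where L: "L \<in> V" "?Q = {z. \<forall>w\<in>L. dot w z = 0}" by blast
      have L2: "L \<in> grassmannian 2" using L V2 by blast
      obtain v :: "nat \<Rightarrow> 'k ^ 'n" where v: "L = vec.span (v ` {..<2})"
        using grassmannian_frame[OF L2] .
      obtain a b where "line_frame (v 0) (v 1) a b"
        using frame_2_line_frame[OF inf L2[unfolded v]] by blast
      then interpret l: line_frame "v 0" "v 1" a b .
      have lL: "l.L = L" unfolding v image_lessThan_2 l.L_eq_span ..
      have Qc: "?Q = l.center" using L(2) l.center_eq lL by simp
      \<comment> \<open>A minor of \<open>L\<close> at \<open>p\<close>, \<open>q\<close> is nonzero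
        exactly when no nonzero vector of \<open>L\<close> has both coordinates zero; then
        \<open>axis p 1\<close> and \<open>axis q 1\<close> complete the frame of \<open>Q\<close>
        to a basis.\<close>
      obtain p q where pq: "v 1 $ p * v 0 $ q - v 1 $ q * v 0 $ p \<noteq> 0"
        using minor_nonzero[OF l.y12(2,4)] by blast
      have "det (frame_matrix u (axis p 1) (axis q 1)) \<noteq> 0"
        unfolding det_frame_matrix_iff
      proof (intro allI impI)
        fix z assume z: "(\<forall>j<k. dot (u j) z = 0) \<and> dot (axis p 1) z = 0 \<and> dot (axis q 1) z = 0"
        then have zp: "z $ p = 0" and zq: "z $ q = 0"
          using dot_axis[of z] by (simp_all add: dot_commute)
        have "?Q \<subseteq> {x. dot z x = 0}"
          by (rule vec.span_minimal)
            (use z in \<open>auto simp: vec.subspace_def dot_add dot_scale dot_commute\<close>)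
        then have "z \<in> L" unfolding Qc lL[symmetric] by (intro l.perp_center) blast
        then obtain s t where st: "z = s *s v 0 + t *s v 1" 
          unfolding lL[symmetric] l.L_def by blast
        have "s * (v 1 $ p * v 0 $ q - v 1 $ q * v 0 $ p) = v 1 $ p * z $ q - v 1 $ q * z $ p"
          "t * (v 1 $ p * v 0 $ q - v 1 $ q * v 0 $ p) = v 0 $ q * z $ p - v 0 $ p * z $ q"
          by (simp_all add: st algebra_simps)
        then have "s = 0" "t = 0" using pq zp zq by simp_all
        then show "z = 0" by (simp add: st)
      qed
      then have nz: "cross u (axis p 1) $ q \<noteq> 0" by (simp add: cross_def)
      obtain a' b' where "line_frame (cross u (axis p 1)) (cross u (axis q 1)) a' b'"
        using cross_line_frame[OF inf nz] by blast
      then interpret c: line_frame "cross u (axis p 1)" "cross u (axis q 1)" a' b' .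
      have "cross u c \<in> L" for c
        using cross_Q unfolding Qc lL[symmetric] by (intro l.perp_center) blast
      then have "c.L \<subseteq> L" unfolding c.L_eq_span using L2
        by (intro vec.span_minimal) (auto simp: grassmannian_def)
      then have "c.L = L"
        using L2 c.L_grassmannian by (intro vec.subspace_dim_equal) (auto simp: grassmannian_def)
      then have w_L: "vec.span (w p q ` {..<2}) = L" by (simp add: w_span c.L_eq_span)
      then obtain f where "f \<in> F" "peval f (\<lambda>(j, i). if j < 2 then w p q j $ i else 0) \<noteq> 0"
        using F[of "w p q"] L(1) L2 by auto
      then have "cross_poly p q * msubst mconst (sub p q) f \<in> F'"
        "peval (cross_poly p q * msubst mconst (sub p q) f) ?X \<noteq> 0"
        using nz unfolding F'_def ev by auto
      then show "\<exists>f\<in>F'. peval f ?X \<noteq> 0" by blast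
    next
      assume "\<exists>f\<in>F'. peval f ?X \<noteq> 0"
      then obtain p q f where f: "f \<in> F" and "peval (cross_poly p q * msubst mconst (sub p q) f) ?X \<noteq> 0"
        unfolding F'_def by blast
      then have nz: "cross u (axis p 1) $ q \<noteq> 0"
        and fw: "peval f (\<lambda>(j, i). if j < 2 then w p q j $ i else 0) \<noteq> 0"
        unfolding ev by auto
      obtain a' b' where "line_frame (cross u (axis p 1)) (cross u (axis q 1)) a' b'"
        using cross_line_frame[OF inf nz] by blast
      then interpret c: line_frame "cross u (axis p 1)" "cross u (axis q 1)" a' b' .
      have w_L: "vec.span (w p q ` {..<2}) = c.L" by (simp add: w_span c.L_eq_span)
      then have "c.L \<in> V" using F[of "w p q"] fw f c.L_grassmannian by auto
      moreover have "?Q \<subseteq> c.center"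
        using cross_Q by (auto simp: c.center_def)
      then have "?Q = c.center"
        using Q c.dim_center card c.center_subspace
        by (intro vec.subspace_dim_equal) (auto simp: grassmannian_def)
      then have "?Q = {z. \<forall>w\<in>c.L. dot w z = 0}" by (simp only: c.center_eq)
      ultimately show "?Q \<in> {Q \<in> grassmannian k. \<exists>L\<in>V. Q = {z. \<forall>w\<in>L. dot w z = 0}}"
        using Q by blast
    qed
  qed
  then show ?thesis by (intro grassmannian_openI[of _ k F']) blast+
qed

text \<open>The assumptions of \<open>general_line\<close> in a form free of frames, as needed for a
  condition on points of the Grassmannian.\<close>

definition generic_line :: "('k::field ^ 'n::finite) set \<Rightarrow> ('k ^ 'n) set \<Rightarrow> bool" where
  "generic_line C W \<longleftrightarrow> (\<exists>v\<in>W. \<forall>c\<in>C. dot c v \<noteq> 0) \<and>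
     (\<forall>c\<in>C. \<forall>c'\<in>C. c \<noteq> c' \<longrightarrow> (\<forall>v\<in>W. dot c v = 0 \<longrightarrow> dot c' v = 0 \<longrightarrow> v = 0))"

definition entry_form :: "'k::comm_ring_1 ^ 'n::finite \<Rightarrow> nat \<Rightarrow> (nat \<times> 'n, 'k) mpoly" where
  "entry_form c j = (\<Sum>i\<in>UNIV. mconst (c $ i) * mvar (j, i))"

definition separation_form :: "'k::comm_ring_1 ^ 'n::finite \<Rightarrow> 'k ^ 'n \<Rightarrow> (nat \<times> 'n, 'k) mpoly" where
  "separation_form c c' = entry_form c 0 * entry_form c' 1 - entry_form c 1 * entry_form c' 0"

lemma peval_entry_form: "peval (entry_form c j) x = dot c (\<chi> i. x (j, i))"
  by (simp add: entry_form_def peval_simps dot_def)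

lemma peval_separation_form: "peval (separation_form c c') x =
    dot c (\<chi> i. x (0, i)) * dot c' (\<chi> i. x (1, i)) - dot c (\<chi> i. x (1, i)) * dot c' (\<chi> i. x (0, i))"
  by (simp add: separation_form_def peval_simps peval_entry_form)

context line_frame
begin

text \<open>Restricted to the line, \<open>c\<close> and \<open>c'\<close> are two linear forms in
  two coordinates, and the determinant tells whether they have a common zero. The vector
  \<open>v\<close> shows that \<open>c\<close> is not identically zero there.\<close>

lemma separated_iff:
  assumes v: "v \<in> L" "dot c v \<noteq> 0"
  shows "(\<forall>v\<in>L. dot c v = 0 \<longrightarrow> dot c' v = 0 \<longrightarrow> v = 0) \<longleftrightarrow>
    dot c y1 * dot c' y2 - dot c y2 * dot c' y1 \<noteq> 0"
proof
  assume *: "\<forall>v\<in>L. dot c v = 0 \<longrightarrow> dot c' v = 0 \<longrightarrow> v = 0"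
  show "dot c y1 * dot c' y2 - dot c y2 * dot c' y1 \<noteq> 0"
  proof
    assume det: "dot c y1 * dot c' y2 - dot c y2 * dot c' y1 = 0"
    \<comment> \<open>This vector spans the zeros of \<open>c\<close> on the line, and the vanishing
      determinant says that \<open>c'\<close> kills it too.\<close>
    let ?w = "dot c y2 *s y1 + (- dot c y1) *s y2"
    have "?w \<in> L" by (rule L_memI)
    moreover have "dot c ?w = 0" "dot c' ?w = 0"
      using det by (simp_all only: dot_add dot_scale) (simp_all add: algebra_simps)
    ultimately have "?w = 0" using * by blast
    then have "dot c y2 = 0" "dot c y1 = 0" using frame_independent by fastforce+
    then show False using v by (auto simp: L_def dot_add dot_scale)
  qed
next
  assume det: "dot c y1 * dot c' y2 - dot c y2 * dot c' y1 \<noteq> 0"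
  show "\<forall>v\<in>L. dot c v = 0 \<longrightarrow> dot c' v = 0 \<longrightarrow> v = 0"
  proof (intro ballI impI)
    fix w assume "w \<in> L" and w: "dot c w = 0" "dot c' w = 0"
    then obtain s t where st: "w = s *s y1 + t *s y2" by (auto simp: L_def)
    have "s * (dot c y1 * dot c' y2 - dot c y2 * dot c' y1) = dot c w * dot c' y2 - dot c y2 * dot c' w"
      "t * (dot c y1 * dot c' y2 - dot c y2 * dot c' y1) = dot c y1 * dot c' w - dot c w * dot c' y1"
      by (simp_all add: st dot_add dot_scale algebra_simps)
    then have "s = 0" "t = 0" using det w by simp_all
    then show "w = 0" by (simp add: st)
  qed
qed

end

text \<open>On frames the witness \<open>v\<close> becomes \<open>s *s u 0 + t *s u 1\<close>: its
  existential quantifier turns into the union over all \<open>A s t\<close>, while the finitely many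
  universal conditions turn into products.\<close>

lemma generic_line_open:
  fixes C :: "('k::field ^ 'n::finite) set"
  assumes inf: "infinite (UNIV :: 'k set)" and fin: "finite C" and U: "grassmannian_open 2 U"
  shows "grassmannian_open 2 {W \<in> U. generic_line C W}"
proof -
  obtain F where F_all: "\<forall>u :: nat \<Rightarrow> 'k ^ 'n. vec.span (u ` {..<2}) \<in> grassmannian 2 \<longrightarrow>
      (vec.span (u ` {..<2}) \<in> U \<longleftrightarrow> (\<exists>f\<in>F. peval f (\<lambda>(j, i). if j < 2 then u j $ i else 0) \<noteq> 0))"
    using U[unfolded grassmannian_open_def, THEN conjunct2] by (rule exE)
  note F = F_all[rule_format]
  define X where "X = (\<lambda>u :: nat \<Rightarrow> 'k ^ 'n. \<lambda>(j, i). if j < (2::nat) then u j $ i else 0)"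
  define A :: "'k \<Rightarrow> 'k \<Rightarrow> (nat \<times> 'n, 'k) mpoly"
    where "A s t = (\<Prod>c\<in>C. mconst s * entry_form c 0 + mconst t * entry_form c 1)" for s t
  define pairs where "pairs = {p \<in> C \<times> C. fst p \<noteq> snd p}"
  define B :: "(nat \<times> 'n, 'k) mpoly" where "B = (\<Prod>p\<in>pairs. separation_form (fst p) (snd p))"
  have fin_pairs: "finite pairs" using fin by (simp add: pairs_def)
  have X: "(\<chi> i. X u (0, i)) = u 0" "(\<chi> i. X u (1, i)) = u 1" for u
    by (simp_all add: X_def vec_eq_iff)
  have A: "peval (A s t) (X u) \<noteq> 0 \<longleftrightarrow> (\<forall>c\<in>C. dot c (s *s u 0 + t *s u 1) \<noteq> 0)" for s t u
    using fin by (simp add: A_def peval_simps peval_entry_form X[simplified] X dot_add dot_scale prod_zero_iff)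
  have B: "peval B (X u) \<noteq> 0 \<longleftrightarrow>
      (\<forall>c\<in>C. \<forall>c'\<in>C. c \<noteq> c' \<longrightarrow> dot c (u 0) * dot c' (u 1) - dot c (u 1) * dot c' (u 0) \<noteq> 0)" for u
    using fin_pairs unfolding B_def peval_simps peval_separation_form X
    by (auto simp: prod_zero_iff pairs_def)
  define F' where "F' = {f * A s t * B | f s t. f \<in> F}"
  have "vec.span (u ` {..<2}) \<in> {W \<in> U. generic_line C W} \<longleftrightarrow> (\<exists>f\<in>F'. peval f (X u) \<noteq> 0)"
    if u: "vec.span (u ` {..<2}) \<in> grassmannian 2" for u :: "nat \<Rightarrow> 'k ^ 'n"
  proof -
    obtain a b where "line_frame (u 0) (u 1) a b" using frame_2_line_frame[OF inf u] by blast
    then interpret l: line_frame "u 0" "u 1" a b .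
    have L: "vec.span (u ` {..<2}) = l.L" unfolding image_lessThan_2 l.L_eq_span ..
    have U_iff: "l.L \<in> U \<longleftrightarrow> (\<exists>f\<in>F. peval f (X u) \<noteq> 0)"
      using F[OF u] unfolding L X_def .
    have ex: "(\<exists>v\<in>l.L. \<forall>c\<in>C. dot c v \<noteq> 0) \<longleftrightarrow> (\<exists>s t. peval (A s t) (X u) \<noteq> 0)"
      unfolding A l.L_def by blast
    have generic: "generic_line C l.L \<longleftrightarrow> (\<exists>s t. peval (A s t) (X u) \<noteq> 0) \<and> peval B (X u) \<noteq> 0"
    proof (cases "\<exists>v\<in>l.L. \<forall>c\<in>C. dot c v \<noteq> 0")
      case True
      then obtain v where v: "v \<in> l.L" "\<And>c. c \<in> C \<Longrightarrow> dot c v \<noteq> 0" by blast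
      have "(\<forall>v\<in>l.L. dot c v = 0 \<longrightarrow> dot c' v = 0 \<longrightarrow> v = 0) \<longleftrightarrow>
          dot c (u 0) * dot c' (u 1) - dot c (u 1) * dot c' (u 0) \<noteq> 0" if "c \<in> C" for c c'
        using l.separated_iff[OF v(1) v(2)[OF that]] .
      then show ?thesis unfolding generic_line_def B ex[symmetric] by simp
    next
      case False
      then show ?thesis unfolding generic_line_def ex[symmetric] by blast
    qed
    have "(\<exists>f\<in>F'. peval f (X u) \<noteq> 0) \<longleftrightarrow>
        (\<exists>f\<in>F. peval f (X u) \<noteq> 0) \<and> (\<exists>s t. peval (A s t) (X u) \<noteq> 0) \<and> peval B (X u) \<noteq> 0"
    proof
      assume "\<exists>f\<in>F'. peval f (X u) \<noteq> 0"
      then obtain f s t where "f \<in> F" "peval (f * A s t * B) (X u) \<noteq> 0" unfolding F'_def by blast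
      then show "(\<exists>f\<in>F. peval f (X u) \<noteq> 0) \<and> (\<exists>s t. peval (A s t) (X u) \<noteq> 0) \<and> peval B (X u) \<noteq> 0"
        by (auto simp: peval_simps)
    next
      assume *: "(\<exists>f\<in>F. peval f (X u) \<noteq> 0) \<and> (\<exists>s t. peval (A s t) (X u) \<noteq> 0) \<and> peval B (X u) \<noteq> 0"
      then obtain f s t where f: "f \<in> F" "peval f (X u) \<noteq> 0" "peval (A s t) (X u) \<noteq> 0" by blast
      have "f * A s t * B \<in> F'" using f(1) unfolding F'_def by blast
      moreover have "peval (f * A s t * B) (X u) \<noteq> 0" using f * by (simp add: peval_simps)
      ultimately show "\<exists>f\<in>F'. peval f (X u) \<noteq> 0" by blast
    qed
    then show ?thesis unfolding L using U_iff generic by blast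
  qed
  then show ?thesis
    using U by (intro grassmannian_openI[of _ 2 F']) (auto simp: grassmannian_open_def X_def)
qed

text \<open>Each of finitely many conditions on a frame is the nonvanishing of a polynomial that is
  nonzero somewhere, so one frame meets them all. The first frame vector itself is made to avoid the
  hyperplanes.\<close>

lemma generic_line_exists:
  fixes C :: "('k::field ^ 'n::finite) set"
  assumes inf: "infinite (UNIV :: 'k set)" and fin: "finite C" and U: "grassmannian_open 2 U" "U \<noteq> {}"
    and nz: "\<And>c. c \<in> C \<Longrightarrow> c \<noteq> 0"
    and indep: "\<And>c c'. c \<in> C \<Longrightarrow> c' \<in> C \<Longrightarrow> c \<noteq> c' \<Longrightarrow> c' \<notin> vec.span {c}"
  shows "\<exists>W\<in>U. generic_line C W"
proof -
  obtain F where F_all: "\<forall>u :: nat \<Rightarrow> 'k ^ 'n. vec.span (u ` {..<2}) \<in> grassmannian 2 \<longrightarrow>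
      (vec.span (u ` {..<2}) \<in> U \<longleftrightarrow> (\<exists>f\<in>F. peval f (\<lambda>(j, i). if j < 2 then u j $ i else 0) \<noteq> 0))"
    using U(1)[unfolded grassmannian_open_def, THEN conjunct2] by (rule exE)
  note F = F_all[rule_format]
  obtain W0 where W0: "W0 \<in> U" "W0 \<in> grassmannian 2" using U by (auto simp: grassmannian_open_def)
  obtain u :: "nat \<Rightarrow> 'k ^ 'n" where u: "W0 = vec.span (u ` {..<2})" using grassmannian_frame[OF W0(2)] .
  then obtain f where f: "f \<in> F" "peval f (\<lambda>(j, i). if j < 2 then u j $ i else 0) \<noteq> 0"
    using F[of u] W0 by auto
  obtain a b where "line_frame (u 0) (u 1) a b" using frame_2_line_frame[OF inf] W0(2) u by blast
  then interpret l0: line_frame "u 0" "u 1" a b .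
  obtain p q where pq: "u 1 $ p * u 0 $ q - u 1 $ q * u 0 $ p \<noteq> 0"
    using minor_nonzero[OF l0.y12(2,4)] by blast
  \<comment> \<open>The common point found below may have nonzero entries at indices from 2 on,
    whereas \<open>grassmannian_open\<close> evaluates with zeros there.\<close>
  define cut :: "nat \<times> 'n \<Rightarrow> (nat \<times> 'n, 'k) mpoly"
    where "cut = (\<lambda>(j, i). if j < 2 then mvar (j, i) else 0)"
  \<comment> \<open>Keeps the two vectors independent; \<open>p\<close> and \<open>q\<close> come
    from a minor that is nonzero at the frame of \<open>W0\<close>.\<close>
  define minor :: "(nat \<times> 'n, 'k) mpoly" where
    "minor = separation_form (axis p 1) (axis q 1)"
  define pairs where "pairs = {p \<in> C \<times> C. fst p \<noteq> snd p}"
  define S where "S = {msubst mconst cut f, minor} \<union> (\<lambda>c. entry_form c 0) ` C \<union>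
    (\<lambda>p. separation_form (fst p) (snd p)) ` pairs"
  have cut: "peval (msubst mconst cut f) x = peval f (\<lambda>(j, i). if j < 2 then (\<chi> i. x (j, i)) $ i else 0)" for x
  proof -
    have "(\<lambda>z. peval (cut z) x) = (\<lambda>(j, i). if j < 2 then (\<chi> i. x (j, i)) $ i else 0)"
      by (auto simp: cut_def fun_eq_iff)
    then show ?thesis by (simp only: peval_msubst_mconst)
  qed
  have axis: "dot (axis i 1) z = z $ i" for i and z :: "'k ^ 'n"
    using dot_axis[of z i] by (simp add: dot_commute)
  define x0 where "x0 = (\<lambda>(j, i). u j $ i)"
  have "peval (\<Prod>p\<in>S. p) x \<noteq> 0 \<longleftrightarrow> (\<forall>p\<in>S. peval p x \<noteq> 0)" for x
    using fin by (simp add: S_def pairs_def peval_simps prod_zero_iff)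
  moreover have "\<exists>x. peval (\<Prod>p\<in>S. p) x \<noteq> 0"
  proof (rule common_nonzero[OF inf])
    show "finite S" using fin by (simp add: S_def pairs_def)
    fix g assume "g \<in> S"
    then consider "g = msubst mconst cut f" | "g = minor" | c where "c \<in> C" "g = entry_form c 0"
      | c c' where "c \<in> C" "c' \<in> C" "c \<noteq> c'" "g = separation_form c c'"
      unfolding S_def pairs_def by fastforce
    then show "\<exists>x. peval g x \<noteq> 0"
    proof cases
      case 1
      have "(\<lambda>(j, i). if j < 2 then (\<chi> i. x0 (j, i)) $ i else 0) = (\<lambda>(j, i). if j < 2 then u j $ i else 0)"
        by (auto simp: x0_def fun_eq_iff)
      then have "peval g x0 \<noteq> 0" unfolding 1 cut using f(2) by simp
      then show ?thesis by blast
    next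
      case 2
      have "peval g x0 \<noteq> 0"
        unfolding 2 minor_def peval_separation_form axis using pq by (simp add: x0_def mult.commute)
      then show ?thesis by blast
    next
      case (3 c)
      obtain i where "c $ i \<noteq> 0" using nz[OF 3(1)] by (auto simp: vec_eq_iff)
      then have "peval g (\<lambda>(j, l). axis i 1 $ l) \<noteq> 0"
        unfolding 3 peval_entry_form by (simp add: dot_axis)
      then show ?thesis by blast
    next
      case (4 c c')
      obtain i j where "c $ i * c' $ j - c $ j * c' $ i \<noteq> 0"
        using minor_nonzero[OF nz indep] 4 by blast
      then have "peval g (\<lambda>(k, l). if k = 0 then axis i 1 $ l else axis j 1 $ l) \<noteq> 0"
        unfolding 4 peval_separation_form by (simp add: dot_axis)
      then show ?thesis by blast
    qed
  qed
  ultimately obtain x where x: "\<And>g. g \<in> S \<Longrightarrow> peval g x \<noteq> 0" by blast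
  define v :: "nat \<Rightarrow> 'k ^ 'n" where "v j = (\<chi> i. x (j, i))" for j
  have "v 0 $ p * v 1 $ q - v 0 $ q * v 1 $ p \<noteq> 0"
    using x[of minor] unfolding S_def minor_def peval_separation_form axis
    by (simp add: v_def mult.commute)
  then obtain a' b' where "line_frame (v 0) (v 1) a' b'" using line_frame_exI[OF inf] by blast
  then interpret l: line_frame "v 0" "v 1" a' b' .
  have L: "vec.span (v ` {..<2}) = l.L" unfolding image_lessThan_2 l.L_eq_span ..
  have "peval f (\<lambda>(j, i). if j < 2 then v j $ i else 0) \<noteq> 0"
    using x[of "msubst mconst cut f"] unfolding S_def cut v_def by blast
  then have "l.L \<in> U" using F[of v] f(1) l.L_grassmannian unfolding L by blast
  moreover have "generic_line C l.L"
  proof -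
    have v0: "v 0 \<in> l.L" using l.L_memI[of 1 0] by simp
    have c: "dot c (v 0) \<noteq> 0" if "c \<in> C" for c
      using x[of "entry_form c 0"] that by (simp add: S_def peval_entry_form v_def)
    have "dot c (v 0) * dot c' (v 1) - dot c (v 1) * dot c' (v 0) \<noteq> 0"
      if "c \<in> C" "c' \<in> C" "c \<noteq> c'" for c c'
    proof -
      have "separation_form c c' \<in> S" using that by (force simp: S_def pairs_def)
      from x[OF this] show ?thesis by (simp only: peval_separation_form v_def not_False_eq_True)
    qed
    then show ?thesis
      unfolding generic_line_def using v0 c l.separated_iff[OF v0 c] by blast
  qed
  ultimately show ?thesis by blast
qed

theorem corollary4p15:
  fixes n :: nat
    and Z :: "('k::alg_closed_field ^ 'n::finite) set set"
    and a :: "int list"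
  assumes "CARD('n) = n + 1" and "n \<ge> 2"
    and "finite Z" and "Z \<noteq> {}" and "Z \<subseteq> grassmannian 1"
    and "has_splitting_type (dual_arrangement Z) a"
  shows "for_general_subspace (n - 1) (\<lambda>Q :: ('k ^ 'n) set. \<forall>d::nat. d \<ge> 1 \<longrightarrow>
    int (mpoly_vs.dim (vanishing_ideal (\<Union>Z) \<inter> ideal_power (vanishing_ideal Q) (d - 1)
                        \<inter> homog (int d)))
      = (\<Sum>i<n. max 0 (int d - a ! i)))"
proof -
  have inf: "infinite (UNIV :: 'k set)" by (rule infinite_UNIV_alg_closed_field)
  have "\<exists>c. c \<noteq> 0 \<and> z = vec.span {c}" if "z \<in> Z" for z
  proof -
    have z: "z \<in> grassmannian 1" using that assms(5) by blast
    obtain u :: "nat \<Rightarrow> 'k ^ 'n" where u: "z = vec.span (u ` {..<1})" using grassmannian_frame[OF z] .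
    then have "z = vec.span {u 0}" by (simp add: lessThan_Suc)
    moreover have "u 0 \<noteq> 0"
    proof
      assume "u 0 = 0"
      then have "vec.dim z = 0" using calculation by simp
      moreover have "vec.dim z = 1" using z by (simp add: grassmannian_def)
      ultimately show False by linarith
    qed
    ultimately show ?thesis by blast
  qed
  then obtain rep where rep: "\<And>z. z \<in> Z \<Longrightarrow> rep z \<noteq> 0" "\<And>z. z \<in> Z \<Longrightarrow> z = vec.span {rep z}"
    by metis
  \<comment> \<open>One coordinate vector for each point; distinct elements are not proportional
    because they span different points.\<close>
  define C where "C = rep ` Z"
  have Z: "Z = (\<lambda>c. vec.span {c}) ` C" unfolding C_def image_image using rep(2) by force
  have C: "finite C" "C \<noteq> {}" "\<And>c. c \<in> C \<Longrightarrow> c \<noteq> 0"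
    using assms(3,4) rep(1) by (auto simp: C_def)
  have indep: "c' \<notin> vec.span {c}" if cc: "c \<in> C" "c' \<in> C" "c \<noteq> c'" for c c'
  proof
    assume "c' \<in> vec.span {c}"
    then obtain t where t: "c' = t *s c" by (auto simp: vec.span_singleton)
    then have "t \<noteq> 0" using C(3)[OF cc(2)] by auto
    then have "vec.span {c'} = vec.span {c}"
      unfolding t by (simp add: vec.span_image_scale[of "{c}" "\<lambda>_. t", simplified])
    moreover obtain z z' where "z \<in> Z" "c = rep z" "z' \<in> Z" "c' = rep z'" using cc by (auto simp: C_def)
    ultimately show False using rep(2) cc(3) by metis
  qed
  have cone: "\<Union>Z = {t *s c | t c. c \<in> C}"
    unfolding Z by (auto simp: vec.span_singleton)
  have arr: "dual_arrangement Z = (\<lambda>c. {y. dot c y = 0}) ` C"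
  proof -
    have "dual_hyperplane (vec.span {c}) = {y. dot c y = 0}" for c :: "'k ^ 'n"
    proof
      show "dual_hyperplane (vec.span {c}) \<subseteq> {y. dot c y = 0}"
        using vec.span_base[of c "{c}"] by (auto simp: dual_hyperplane_def simp flip: dot_def)
      show "{y. dot c y = 0} \<subseteq> dual_hyperplane (vec.span {c})"
        by (auto simp: dual_hyperplane_def vec.span_singleton dot_scale_left simp flip: dot_def)
    qed
    then show ?thesis unfolding dual_arrangement_def Z image_image by simp
  qed
  have len: "length a = n" and nonneg: "\<And>j. j < length a \<Longrightarrow> 0 \<le> a ! j"
    using assms(1,6) by (auto simp: has_splitting_type_def)
  obtain U where U: "grassmannian_open 2 U" "U \<noteq> {}"
    and iso: "\<And>W. W \<in> U \<Longrightarrow> sheaves_isomorphic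
         (gmod_restrict (vanishing_ideal W) (D0 (dual_arrangement Z)))
         (gmod_restrict (vanishing_ideal W) (twisted_free a))"
    using assms(6) unfolding has_splitting_type_def for_general_subspace_def by blast
  define V where "V = {W \<in> U. generic_line C W}"
  \<comment> \<open>The centers dual to generic lines of \<open>U\<close>, an open set by
    \<open>grassmannian_open_perp\<close>.\<close>
  define U' where "U' = {Q \<in> grassmannian (n - 1). \<exists>L\<in>V. Q = {z. \<forall>w\<in>L. dot w z = 0}}"
  have V_open: "grassmannian_open 2 V" unfolding V_def by (rule generic_line_open[OF inf C(1) U(1)])
  have V2: "V \<subseteq> grassmannian 2" using V_open by (simp add: grassmannian_open_def)
  have card: "CARD('n) = (n - 1) + 2" using assms(1,2) by simp
  have "grassmannian_open (n - 1) U'"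
    unfolding U'_def by (rule grassmannian_open_perp[OF inf card V_open])
  moreover have "U' \<noteq> {}"
  proof -
    obtain W where W: "W \<in> V"
      using generic_line_exists[OF inf C(1) U C(3) indep] unfolding V_def by blast
    have W2: "W \<in> grassmannian 2" using W V2 by blast
    obtain u :: "nat \<Rightarrow> 'k ^ 'n" where u: "W = vec.span (u ` {..<2})" using grassmannian_frame[OF W2] .
    obtain a b where "line_frame (u 0) (u 1) a b"
      using frame_2_line_frame[OF inf W2[unfolded u]] by blast
    then interpret l: line_frame "u 0" "u 1" a b .
    have "l.L = W" unfolding u image_lessThan_2 l.L_eq_span ..
    moreover have "l.center \<in> grassmannian (n - 1)"
      using l.center_subspace l.dim_center card by (simp add: grassmannian_def)
    ultimately have "l.center \<in> U'" using W l.center_eq unfolding U'_def by blast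
    then show ?thesis by blast
  qed
  moreover have "int (mpoly_vs.dim (vanishing_ideal (\<Union>Z) \<inter> ideal_power (vanishing_ideal Q) (d - 1)
      \<inter> homog (int d))) = (\<Sum>i<n. max 0 (int d - a ! i))" if Q: "Q \<in> U'" and d: "d \<ge> 1" for Q and d :: nat
  proof -
    obtain W where W: "W \<in> U" "generic_line C W" and QW: "Q = {z. \<forall>w\<in>W. dot w z = 0}"
      using Q unfolding U'_def V_def by blast
    have W2: "W \<in> grassmannian 2" using W V2 unfolding V_def by blast
    \<comment> \<open>This vector on no hyperplane becomes the second frame vector, the point at
      infinity of the chart of \<open>x\<close>.\<close>
    obtain q where q: "q \<in> W" and q_all: "\<forall>c\<in>C. dot c q \<noteq> 0"
      using W(2) unfolding generic_line_def by (elim conjE bexE)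
    have "q \<noteq> 0" using q_all C(2) by force
    obtain p a' b' where frame: "line_frame p q a' b'" and Wpq: "W = vec.span {p, q}"
      by (rule grassmannian_2_line_frame[OF inf W2 q \<open>q \<noteq> 0\<close>])
    interpret l: line_frame p q a' b' by (rule frame)
    have LW: "l.L = W" unfolding Wpq l.L_eq_span ..
    interpret g: general_line p q a' b' C
    proof unfold_locales
      fix c c' assume c: "c \<in> C" "c' \<in> C" "c \<noteq> c'"
      then have "\<forall>v\<in>W. dot c v = 0 \<longrightarrow> dot c' v = 0 \<longrightarrow> v = 0"
        using W(2) unfolding generic_line_def by blast
      then have "dot c p * dot c' q - dot c q * dot c' p \<noteq> 0"
        using l.separated_iff[of q c c'] q q_all c(1) unfolding LW by blast
      then show "dot c p * dot c' q \<noteq> dot c' p * dot c q" by (simp add: mult.commute)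
    qed (use C q_all in auto)
    have Qc: "Q = l.center" using QW l.center_eq LW by simp
    \<comment> \<open>The twist is \<open>m = d - 1\<close>, and \<open>d \<ge> 1\<close> ensures
      that \<open>d - 1 + 1\<close> is again \<open>d\<close>.\<close>
    have "int (mpoly_vs.dim (vanishing_ideal {t *s c | t c. c \<in> C} \<inter>
        ideal_power (vanishing_ideal l.center) (d - 1) \<inter> homog (int (d - 1 + 1))))
      = (\<Sum>j<length a. max 0 (int (d - 1) + 1 - a ! j))"
      using iso[OF W(1)] unfolding arr LW[symmetric] by (rule g.dim_forms[OF _ nonneg])
    then show ?thesis using d by (simp add: cone Qc len of_nat_diff)
  qed
  ultimately show ?thesis unfolding for_general_subspace_def by blast
qed

end
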